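(* Let $\mathrm{char}(\mathbb F)=0$ and $0\neq h\in R=\mathbb F[x]$. Write $H=\mathsf{HH}^1(A_h)$, let $\mathsf Z(H)$ be its center and $[H,H]$ its derived ideal. Then $H=\mathsf Z(H)\oplus [H,H]$; $$\mathcal N=\mathrm{span}_{\mathbb F}\{\mathrm{ad}_{ra_n}\mid r\in R\,\pi_{(h/\pi_h)},\ n\ge 0\}$$ is the unique maximal nilpotent ideal of $[H,H]$; and $H/\mathcal N=\mathsf Z(H)\oplus [H,H]/\mathcal N$, where (i) $\mathsf Z(H)\cong\{D_{r\frac{h}{\pi_h}}\mid r\in R,\ \deg r<\deg \pi_h\}$. (ii) $[H,H]/\mathcal N\cong \big(R/R\,\pi_{(h/\pi_h)}\big)\otimes_{\mathbb F} \mathsf W$, where $\mathsf W=\mathrm{span}_{\mathbb F}\{w_i\mid i\ge -1\}$ is the Witt algebra. (iii) $\big(R/R\,\pi_{(h/\pi_h)}\big)\otimes \mathsf W\cong \big((R/R\mathsf u_1)\otimes\mathsf W\big)\oplus\cdots\oplus\big((R/R\mathsf u_k)\otimes \mathsf W\big)$, a direct sum of simple Lie algebras, where $\mathsf u_1,\dots,\mathsf u_k$ are the distinct monic prime factors of $h$ with multiplicity $>1$, and each summand is the extension of $\mathsf W$ by the field $R/R\mathsf u_i$.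
   Context: $\mathbb F$ is a field, $R=\mathbb F[x]$, $0\ne h\in R$. The Weyl algebra $A_1$ is the unital associative $\mathbb F$-algebra with generators $x,y$ and relation $yx-xy=1$. $A_h$ is the unital associative $\mathbb F$-algebra with generators $x,\hat y$ and relation $\hat yx-x\hat y=h$; it is identified with the subalgebra of $A_1$ generated by $x$ and $\hat y=yh$. $\mathrm{Der}_{\mathbb F}(A_h)$ is the Lie algebra of $\mathbb F$-linear derivations, $\mathrm{Inder}_{\mathbb F}(A_h)$ the ideal of inner derivations, and $\mathsf{HH}^1(A_h)=\mathrm{Der}_{\mathbb F}(A_h)/\mathrm{Inder}_{\mathbb F}(A_h)$; derivations and their images in $\mathsf{HH}^1(A_h)$ are denoted by the same symbol. For $g\in R$, $D_g$ is the derivation of $A_h$ with $D_g(x)=0$, $D_g(\hat y)=g$. For $0\neq f\in R$, $\pi_f\in R$ is the unique monic polynomial such that for all $r\in R$: $f\mid f'r\iff \pi_f\mid r$ (in characteristic 0, the product of the distinct monic prime factors of $f$; $\pi_f=1$ if $f$ is constant); $\pi_{(h/\pi_h)}$ is this polynomial for $f=h/\pi_h$. Put $a_n=\pi_hh^{n-1}y^n$ for $n\ge 0$; $a_0=\pi_hh^{-1}$ lies in the localization $A_1\Sigma^{-1}$, $\Sigma=\{h^m\mid m\ge0\}$, and the others lie in $A_1$. With $\mathrm{ad}_u(v)=uv-vu$, each $\mathrm{ad}_{ra_n}$ ($r\in R$, $n\ge 0$) maps $A_h$ to itself and is regarded as a derivation of $A_h$. The Witt algebra $\mathsf W=\mathrm{Der}_{\mathbb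 F}(\mathbb F[t])$ has basis $w_n=t^{n+1}\frac{d}{dt}$, $n\ge -1$, with $[w_m,w_n]=(n-m)w_{m+n}$ (and $w_{-2}=0$); for a commutative algebra $B$, $B\otimes\mathsf W$ has bracket $[b\otimes w,b'\otimes w']=bb'\otimes[w,w']$. If $k=0$ the sum in (iii) is $0$. $\deg 0=-\infty$. *)

theory Defs
  imports
    "HOL-Computational_Algebra.Computational_Algebra"
    "HOL-Library.Poly_Mapping"
    "HOL-Library.FuncSet"
begin

section \<open>Algebras over a field\<close>

text \<open>Vector spaces over a field \<open>'f\<close> with a bilinear product and an explicit carrier.  The same
  record serves for associative algebras (\<open>\<star>\<close> the product; a unit is not part of the data) and for
  Lie algebras (\<open>\<star>\<close> the bracket).\<close>

record ('f, 'v) alg =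
  carr :: "'v set"
  zer :: "'v" ("\<zero>\<index>")
  pls :: "'v \<Rightarrow> 'v \<Rightarrow> 'v" (infixl "\<oplus>\<index>" 65)
  scl :: "'f \<Rightarrow> 'v \<Rightarrow> 'v" (infixr "\<odot>\<index>" 75)
  mlt :: "'v \<Rightarrow> 'v \<Rightarrow> 'v" (infixl "\<star>\<index>" 70)

definition mns :: "('f::field, 'v) alg \<Rightarrow> 'v \<Rightarrow> 'v \<Rightarrow> 'v" (infixl "\<ominus>\<index>" 65)
  where "a \<ominus>\<^bsub>A\<^esub> b = a \<oplus>\<^bsub>A\<^esub> (-1) \<odot>\<^bsub>A\<^esub> b"

locale f_algebra =
  fixes A :: "('f::field, 'v) alg" (structure)
  assumes zer_closed: "\<zero> \<in> carr A"
    and pls_closed: "\<lbrakk>a \<in> carr A; b \<in> carr A\<rbrakk> \<Longrightarrow> a \<oplus> b \<in> carr A"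
    and scl_closed: "a \<in> carr A \<Longrightarrow> c \<odot> a \<in> carr A"
    and mlt_closed: "\<lbrakk>a \<in> carr A; b \<in> carr A\<rbrakk> \<Longrightarrow> a \<star> b \<in> carr A"
    and pls_assoc: "\<lbrakk>a \<in> carr A; b \<in> carr A; d \<in> carr A\<rbrakk> \<Longrightarrow> (a \<oplus> b) \<oplus> d = a \<oplus> (b \<oplus> d)"
    and pls_comm: "\<lbrakk>a \<in> carr A; b \<in> carr A\<rbrakk> \<Longrightarrow> a \<oplus> b = b \<oplus> a"
    and zer_pls: "a \<in> carr A \<Longrightarrow> \<zero> \<oplus> a = a"
    and mns_self: "a \<in> carr A \<Longrightarrow> a \<ominus> a = \<zero>"
    and scl_pls: "\<lbrakk>a \<in> carr A; b \<in> carr A\<rbrakk> \<Longrightarrow> c \<odot> (a \<oplus> b) = c \<odot> a \<oplus> c \<odot> b"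
    and add_scl: "a \<in> carr A \<Longrightarrow> (c + c') \<odot> a = c \<odot> a \<oplus> c' \<odot> a"
    and scl_scl: "a \<in> carr A \<Longrightarrow> c \<odot> (c' \<odot> a) = (c * c') \<odot> a"
    and one_scl: "a \<in> carr A \<Longrightarrow> 1 \<odot> a = a"
    and pls_mlt: "\<lbrakk>a \<in> carr A; b \<in> carr A; d \<in> carr A\<rbrakk> \<Longrightarrow> (a \<oplus> b) \<star> d = a \<star> d \<oplus> b \<star> d"
    and mlt_pls: "\<lbrakk>a \<in> carr A; b \<in> carr A; d \<in> carr A\<rbrakk> \<Longrightarrow> a \<star> (b \<oplus> d) = a \<star> b \<oplus> a \<star> d"
    and scl_mlt: "\<lbrakk>a \<in> carr A; b \<in> carr A\<rbrakk> \<Longrightarrow> (c \<odot> a) \<star> b = c \<odot> (a \<star> b)"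
    and mlt_scl: "\<lbrakk>a \<in> carr A; b \<in> carr A\<rbrakk> \<Longrightarrow> a \<star> (c \<odot> b) = c \<odot> (a \<star> b)"

locale lie_algebra = f_algebra L for L :: "('f::field, 'v) alg" (structure) +
  assumes alternating: "a \<in> carr L \<Longrightarrow> a \<star> a = \<zero>"
    and jacobi: "\<lbrakk>a \<in> carr L; b \<in> carr L; d \<in> carr L\<rbrakk> \<Longrightarrow>
      a \<star> (b \<star> d) \<oplus> b \<star> (d \<star> a) \<oplus> d \<star> (a \<star> b) = \<zero>"

locale field_algebra = f_algebra K for K :: "('f::field, 'v) alg" (structure) +
  assumes mlt_assoc: "\<lbrakk>a \<in> carr K; b \<in> carr K; d \<in> carr K\<rbrakk> \<Longrightarrow> (a \<star> b) \<star> d = a \<star> (b \<star> d)"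
    and mlt_comm: "\<lbrakk>a \<in> carr K; b \<in> carr K\<rbrakk> \<Longrightarrow> a \<star> b = b \<star> a"
    and unit_inverses: "\<exists>e\<in>carr K. e \<noteq> \<zero> \<and> (\<forall>a\<in>carr K. e \<star> a = a) \<and>
      (\<forall>a\<in>carr K. a \<noteq> \<zero> \<longrightarrow> (\<exists>b\<in>carr K. a \<star> b = e))"

definition subspace :: "('f, 'v) alg \<Rightarrow> 'v set \<Rightarrow> bool" where
  "subspace A S \<longleftrightarrow> S \<subseteq> carr A \<and> \<zero>\<^bsub>A\<^esub> \<in> S \<and> (\<forall>a\<in>S. \<forall>b\<in>S. a \<oplus>\<^bsub>A\<^esub> b \<in> S)
    \<and> (\<forall>c. \<forall>a\<in>S. c \<odot>\<^bsub>A\<^esub> a \<in> S)"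

definition lspan :: "('f, 'v) alg \<Rightarrow> 'v set \<Rightarrow> 'v set" where
  "lspan A S = \<Inter>{T. subspace A T \<and> S \<subseteq> T}"

definition ideal :: "('f, 'v) alg \<Rightarrow> 'v set \<Rightarrow> bool" where
  "ideal A I \<longleftrightarrow> subspace A I \<and> (\<forall>a\<in>carr A. \<forall>i\<in>I. a \<star>\<^bsub>A\<^esub> i \<in> I \<and> i \<star>\<^bsub>A\<^esub> a \<in> I)"

definition ideal_gen :: "('f, 'v) alg \<Rightarrow> 'v set \<Rightarrow> 'v set" where
  "ideal_gen A S = \<Inter>{I. ideal A I \<and> S \<subseteq> I}"

definition restr :: "('f, 'v) alg \<Rightarrow> 'v set \<Rightarrow> ('f, 'v) alg" where
  "restr A S = A\<lparr>carr := S\<rparr>"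

definition coset :: "('f, 'v) alg \<Rightarrow> 'v set \<Rightarrow> 'v \<Rightarrow> 'v set" where
  "coset A I a = (\<lambda>i. a \<oplus>\<^bsub>A\<^esub> i) ` I"

definition quot :: "('f, 'v) alg \<Rightarrow> 'v set \<Rightarrow> ('f, 'v set) alg" where
  "quot A I = \<lparr>carr = coset A I ` carr A,
     zer = coset A I \<zero>\<^bsub>A\<^esub>,
     pls = (\<lambda>X Y. \<Union>a\<in>X. \<Union>b\<in>Y. coset A I (a \<oplus>\<^bsub>A\<^esub> b)),
     scl = (\<lambda>c X. \<Union>a\<in>X. coset A I (c \<odot>\<^bsub>A\<^esub> a)),
     mlt = (\<lambda>X Y. \<Union>a\<in>X. \<Union>b\<in>Y. coset A I (a \<star>\<^bsub>A\<^esub> b))\<rparr>"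

definition alg_iso :: "('v \<Rightarrow> 'w) \<Rightarrow> ('f, 'v) alg \<Rightarrow> ('f, 'w) alg \<Rightarrow> bool" where
  "alg_iso f A B \<longleftrightarrow> bij_betw f (carr A) (carr B)
    \<and> (\<forall>a\<in>carr A. \<forall>b\<in>carr A. f (a \<oplus>\<^bsub>A\<^esub> b) = f a \<oplus>\<^bsub>B\<^esub> f b \<and> f (a \<star>\<^bsub>A\<^esub> b) = f a \<star>\<^bsub>B\<^esub> f b)
    \<and> (\<forall>c. \<forall>a\<in>carr A. f (c \<odot>\<^bsub>A\<^esub> a) = c \<odot>\<^bsub>B\<^esub> f a)"

definition isomorphic :: "('f, 'v) alg \<Rightarrow> ('f, 'w) alg \<Rightarrow> bool" where
  "isomorphic A B \<longleftrightarrow> (\<exists>f. alg_iso f A B)"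

definition direct_sum :: "'i set \<Rightarrow> ('i \<Rightarrow> ('f, 'v) alg) \<Rightarrow> ('f, 'i \<Rightarrow> 'v) alg" where
  "direct_sum I A = \<lparr>carr = {x \<in> (\<Pi>\<^sub>E i\<in>I. carr (A i)). finite {i\<in>I. x i \<noteq> \<zero>\<^bsub>A i\<^esub>}},
     zer = (\<lambda>i\<in>I. \<zero>\<^bsub>A i\<^esub>),
     pls = (\<lambda>x y. \<lambda>i\<in>I. x i \<oplus>\<^bsub>A i\<^esub> y i),
     scl = (\<lambda>c x. \<lambda>i\<in>I. c \<odot>\<^bsub>A i\<^esub> x i),
     mlt = (\<lambda>x y. \<lambda>i\<in>I. x i \<star>\<^bsub>A i\<^esub> y i)\<rparr>"

text \<open>\<open>A = S \<oplus> T\<close>, an internal direct sum of ideals.\<close>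

definition is_direct_sum :: "('f, 'v) alg \<Rightarrow> 'v set \<Rightarrow> 'v set \<Rightarrow> bool" where
  "is_direct_sum A S T \<longleftrightarrow> ideal A S \<and> ideal A T \<and> S \<inter> T = {\<zero>\<^bsub>A\<^esub>}
    \<and> carr A = {s \<oplus>\<^bsub>A\<^esub> t | s t. s \<in> S \<and> t \<in> T}"


subsection \<open>Tensor product of algebras over the ground field\<close>

text \<open>The quotient of the vector space with basis \<open>carr A \<times> carr B\<close> by the bilinearity relations,
  with \<open>(a \<otimes> b) \<star> (a' \<otimes> b') = (a \<star> a') \<otimes> (b \<star> b')\<close>.\<close>

definition pair_algebra ::
    "('f::field, 'v) alg \<Rightarrow> ('f, 'w) alg \<Rightarrow> ('f, ('v \<times> 'w) \<Rightarrow>\<^sub>0 'f) alg" where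
  "pair_algebra A B = \<lparr>carr = {p. Poly_Mapping.keys p \<subseteq> carr A \<times> carr B},
     zer = 0, pls = (+), scl = (\<lambda>c. Poly_Mapping.map ((*) c)),
     mlt = (\<lambda>p q. \<Sum>(a, b)\<in>Poly_Mapping.keys p. \<Sum>(a', b')\<in>Poly_Mapping.keys q.
       Poly_Mapping.single (a \<star>\<^bsub>A\<^esub> a', b \<star>\<^bsub>B\<^esub> b')
         (Poly_Mapping.lookup p (a, b) * Poly_Mapping.lookup q (a', b')))\<rparr>"

definition bilinear_rels ::
    "('f::field, 'v) alg \<Rightarrow> ('f, 'w) alg \<Rightarrow> (('v \<times> 'w) \<Rightarrow>\<^sub>0 'f) set" where
  "bilinear_rels A B = (let s = (\<lambda>a b. Poly_Mapping.single (a, b)) in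
     {s (a \<oplus>\<^bsub>A\<^esub> a') b 1 - s a b 1 - s a' b 1 | a a' b. a \<in> carr A \<and> a' \<in> carr A \<and> b \<in> carr B}
   \<union> {s a (b \<oplus>\<^bsub>B\<^esub> b') 1 - s a b 1 - s a b' 1 | a b b'. a \<in> carr A \<and> b \<in> carr B \<and> b' \<in> carr B}
   \<union> {s (c \<odot>\<^bsub>A\<^esub> a) b 1 - s a b c | c a b. a \<in> carr A \<and> b \<in> carr B}
   \<union> {s a (c \<odot>\<^bsub>B\<^esub> b) 1 - s a b c | c a b. a \<in> carr A \<and> b \<in> carr B})"

definition tensor ::
    "('f::field, 'v) alg \<Rightarrow> ('f, 'w) alg \<Rightarrow> ('f, (('v \<times> 'w) \<Rightarrow>\<^sub>0 'f) set) alg" where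
  "tensor A B = quot (pair_algebra A B) (lspan (pair_algebra A B) (bilinear_rels A B))"


subsection \<open>Lie algebras\<close>

definition center :: "('f, 'v) alg \<Rightarrow> 'v set" where
  "center L = {z \<in> carr L. \<forall>a\<in>carr L. z \<star>\<^bsub>L\<^esub> a = \<zero>\<^bsub>L\<^esub>}"

definition derived :: "('f, 'v) alg \<Rightarrow> 'v set" where
  "derived L = lspan L {a \<star>\<^bsub>L\<^esub> b | a b. a \<in> carr L \<and> b \<in> carr L}"

primrec lower_central :: "('f, 'v) alg \<Rightarrow> nat \<Rightarrow> 'v set" where
  "lower_central L 0 = carr L"
| "lower_central L (Suc n) =
     lspan L {a \<star>\<^bsub>L\<^esub> b | a b. a \<in> carr L \<and> b \<in> lower_central L n}"

definition nilpotent :: "('f, 'v) alg \<Rightarrow> bool" where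
  "nilpotent L \<longleftrightarrow> (\<exists>n. lower_central L n = {\<zero>\<^bsub>L\<^esub>})"

definition nilpotent_ideal :: "('f, 'v) alg \<Rightarrow> 'v set \<Rightarrow> bool" where
  "nilpotent_ideal L I \<longleftrightarrow> ideal L I \<and> nilpotent (restr L I)"

definition maximal_nilpotent_ideal :: "('f, 'v) alg \<Rightarrow> 'v set \<Rightarrow> bool" where
  "maximal_nilpotent_ideal L I \<longleftrightarrow>
     nilpotent_ideal L I \<and> (\<forall>J. nilpotent_ideal L J \<and> I \<subseteq> J \<longrightarrow> J = I)"

definition simple_lie_algebra :: "('f::field, 'v) alg \<Rightarrow> bool" where
  "simple_lie_algebra L \<longleftrightarrow> lie_algebra L
    \<and> (\<exists>a\<in>carr L. \<exists>b\<in>carr L. a \<star>\<^bsub>L\<^esub> b \<noteq> \<zero>\<^bsub>L\<^esub>)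
    \<and> (\<forall>I. ideal L I \<longrightarrow> I = {\<zero>\<^bsub>L\<^esub>} \<or> I = carr L)"


subsection \<open>Derivations and first Hochschild cohomology\<close>

text \<open>Derivations are made \<open>undefined\<close> outside the carrier, so that equality of functions is
  equality of derivations.\<close>

definition Der :: "('f::field, 'v) alg \<Rightarrow> ('f, 'v \<Rightarrow> 'v) alg" where
  "Der A = \<lparr>carr = {d \<in> carr A \<rightarrow>\<^sub>E carr A.
       (\<forall>a\<in>carr A. \<forall>b\<in>carr A. d (a \<oplus>\<^bsub>A\<^esub> b) = d a \<oplus>\<^bsub>A\<^esub> d b)
     \<and> (\<forall>c. \<forall>a\<in>carr A. d (c \<odot>\<^bsub>A\<^esub> a) = c \<odot>\<^bsub>A\<^esub> d a)
     \<and> (\<forall>a\<in>carr A. \<forall>b\<in>carr A. d (a \<star>\<^bsub>A\<^esub> b) = d a \<star>\<^bsub>A\<^esub> b \<oplus>\<^bsub>A\<^esub> a \<star>\<^bsub>A\<^esub> d b)},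
     zer = (\<lambda>a\<in>carr A. \<zero>\<^bsub>A\<^esub>),
     pls = (\<lambda>d e. \<lambda>a\<in>carr A. d a \<oplus>\<^bsub>A\<^esub> e a),
     scl = (\<lambda>c d. \<lambda>a\<in>carr A. c \<odot>\<^bsub>A\<^esub> d a),
     mlt = (\<lambda>d e. \<lambda>a\<in>carr A. d (e a) \<ominus>\<^bsub>A\<^esub> e (d a))\<rparr>"

definition Inder :: "('f::field, 'v) alg \<Rightarrow> ('v \<Rightarrow> 'v) set" where
  "Inder A = {\<lambda>a\<in>carr A. u \<star>\<^bsub>A\<^esub> a \<ominus>\<^bsub>A\<^esub> a \<star>\<^bsub>A\<^esub> u | u. u \<in> carr A}"

definition HH1 :: "('f::field, 'v) alg \<Rightarrow> ('f, ('v \<Rightarrow> 'v) set) alg" where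
  "HH1 A = quot (Der A) (Inder A)"


section \<open>Free algebras and presentations\<close>

datatype 'g word = Word (letters: "'g list")

instantiation word :: (type) monoid_add
begin

definition zero_word :: "'a word" where "0 = Word []"

definition plus_word :: "'a word \<Rightarrow> 'a word \<Rightarrow> 'a word"
  where "v + w = Word (letters v @ letters w)"

instance
  by standard (simp_all add: zero_word_def plus_word_def)

end

text \<open>As \<open>'g word\<close> is the free monoid, the ring structure of \<open>'g word \<Rightarrow>\<^sub>0 'f\<close> is that of the free
  associative algebra on \<open>'g\<close>; the scalar \<open>c\<close> is \<open>Poly_Mapping.single 0 c\<close>.\<close>

type_synonym ('f, 'g) free = "'g word \<Rightarrow>\<^sub>0 'f"

definition free_algebra :: "('f::field, ('f, 'g) free) alg" where
  "free_algebra = \<lparr>carr = UNIV, zer = 0, pls = (+),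
     scl = (\<lambda>c. Poly_Mapping.map ((*) c)), mlt = (*)\<rparr>"

definition gen :: "'g \<Rightarrow> ('f::field, 'g) free" where
  "gen g = Poly_Mapping.single (Word [g]) 1"

definition subst :: "('g \<Rightarrow> ('f::field, 'k) free) \<Rightarrow> ('f, 'g) free \<Rightarrow> ('f, 'k) free" where
  "subst \<phi> p = (\<Sum>w\<in>Poly_Mapping.keys p.
     Poly_Mapping.single 0 (Poly_Mapping.lookup p w) * prod_list (map \<phi> (letters w)))"

definition poly_at :: "'f::field poly \<Rightarrow> ('f, 'g) free \<Rightarrow> ('f, 'g) free" where
  "poly_at r a = (\<Sum>i\<le>degree r. Poly_Mapping.single 0 (coeff r i) * a ^ i)"

text \<open>The two-sided ideal generated by the relations \<open>\<rho>\<close>, the class of \<open>p\<close> in the algebra they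
  present, and that algebra.\<close>

definition rel_ideal :: "('f::field, 'g) free set \<Rightarrow> ('f, 'g) free set" where
  "rel_ideal \<rho> = ideal_gen free_algebra \<rho>"

definition cls :: "('f::field, 'g) free set \<Rightarrow> ('f, 'g) free \<Rightarrow> ('f, 'g) free set" where
  "cls \<rho> p = coset free_algebra (rel_ideal \<rho>) p"

definition presented :: "('f::field, 'g) free set \<Rightarrow> ('f, ('f, 'g) free set) alg" where
  "presented \<rho> = quot free_algebra (rel_ideal \<rho>)"


section \<open>The algebra \<open>A\<^sub>h\<close> and the localized Weyl algebra\<close>

datatype gen2 = X | Yh

definition Ah_rels :: "'f::field poly \<Rightarrow> ('f, gen2) free set" where
  "Ah_rels h = {gen Yh * gen X - gen X * gen Yh - poly_at h (gen X)}"

definition Ah :: "'f::field poly \<Rightarrow> ('f, ('f, gen2) free set) alg" where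
  "Ah h = presented (Ah_rels h)"

text \<open>The localization of the Weyl algebra at the powers of \<open>h\<close> is obtained by adjoining a
  two-sided inverse \<open>lz\<close> of \<open>h\<close>.\<close>

datatype gen3 = GX | GY | GZ

abbreviation lx :: "('f::field, gen3) free" where "lx \<equiv> gen GX"
abbreviation ly :: "('f::field, gen3) free" where "ly \<equiv> gen GY"
abbreviation lz :: "('f::field, gen3) free" where "lz \<equiv> gen GZ"

definition loc_rels :: "'f::field poly \<Rightarrow> ('f, gen3) free set" where
  "loc_rels h = {ly * lx - lx * ly - 1, poly_at h lx * lz - 1, lz * poly_at h lx - 1}"

definition Weyl_loc :: "'f::field poly \<Rightarrow> ('f, ('f, gen3) free set) alg" where
  "Weyl_loc h = presented (loc_rels h)"

text \<open>The embedding of \<open>A\<^sub>h\<close> with \<open>X \<mapsto> x\<close> and \<open>Yh \<mapsto> y h\<close>.\<close>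

definition embed :: "'f::field poly \<Rightarrow> ('f, gen2) free set \<Rightarrow> ('f, gen3) free set" where
  "embed h C = (\<Union>p\<in>C. cls (loc_rels h)
     (subst (\<lambda>g. case g of X \<Rightarrow> lx | Yh \<Rightarrow> ly * poly_at h lx) p))"

text \<open>\<open>ad\<^sub>u\<close> for \<open>u\<close> in the localized Weyl algebra, as a map on \<open>A\<^sub>h\<close>; meaningful when \<open>ad\<^sub>u\<close> maps
  (the image of) \<open>A\<^sub>h\<close> to itself.\<close>

definition ad :: "'f::field poly \<Rightarrow> ('f, gen3) free set
    \<Rightarrow> ('f, gen2) free set \<Rightarrow> ('f, gen2) free set" where
  "ad h u = (\<lambda>a\<in>carr (Ah h). THE b. b \<in> carr (Ah h) \<and>
     embed h b = u \<star>\<^bsub>Weyl_loc h\<^esub> embed h a \<ominus>\<^bsub>Weyl_loc h\<^esub> embed h a \<star>\<^bsub>Weyl_loc h\<^esub> u)"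

definition pi_poly :: "'f::field poly \<Rightarrow> 'f poly" where
  "pi_poly f = (THE p. lead_coeff p = 1 \<and> (\<forall>r. f dvd pderiv f * r \<longleftrightarrow> p dvd r))"

definition a_elem :: "'f::field poly \<Rightarrow> nat \<Rightarrow> ('f, gen3) free" where
  "a_elem h n = (case n of
     0 \<Rightarrow> poly_at (pi_poly h) lx * lz
   | Suc m \<Rightarrow> poly_at (pi_poly h * h ^ m) lx * ly ^ n)"

definition ad_ra :: "'f::field poly \<Rightarrow> 'f poly \<Rightarrow> nat
    \<Rightarrow> ('f, gen2) free set \<Rightarrow> ('f, gen2) free set" where
  "ad_ra h r n = ad h (cls (loc_rels h) (poly_at r lx * a_elem h n))"

definition D_der :: "'f::field poly \<Rightarrow> 'f poly \<Rightarrow> ('f, gen2) free set \<Rightarrow> ('f, gen2) free set" where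
  "D_der h g = (THE d. d \<in> carr (Der (Ah h)) \<and> d (cls (Ah_rels h) (gen X)) = \<zero>\<^bsub>Ah h\<^esub>
     \<and> d (cls (Ah_rels h) (gen Yh)) = cls (Ah_rels h) (poly_at g (gen X)))"

definition to_HH1 :: "'f::field poly \<Rightarrow> (('f, gen2) free set \<Rightarrow> ('f, gen2) free set)
    \<Rightarrow> (('f, gen2) free set \<Rightarrow> ('f, gen2) free set) set" where
  "to_HH1 h d = coset (Der (Ah h)) (Inder (Ah h)) d"


section \<open>Polynomial algebra and Witt algebra\<close>

definition R_alg :: "('f::field, 'f poly) alg" where
  "R_alg = \<lparr>carr = UNIV, zer = 0, pls = (+), scl = smult, mlt = (*)\<rparr>"

definition R_mod :: "'f::field poly \<Rightarrow> ('f, 'f poly set) alg" where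
  "R_mod u = quot R_alg (range (\<lambda>r. r * u))"

definition Witt :: "('f::field, 'f poly \<Rightarrow> 'f poly) alg" where
  "Witt = Der R_alg"

text \<open>\<open>w\<^sub>n = t\<^sup>n\<^sup>+\<^sup>1 d/dt\<close> for \<open>n \<ge> -1\<close>.\<close>

definition witt_w :: "int \<Rightarrow> 'f::field poly \<Rightarrow> 'f poly" where
  "witt_w n = (\<lambda>p. monom 1 (nat (n + 1)) * pderiv p)"

end

theory Submission
  imports Defs
begin

text \<open>
  Taylor expansion at a point where \<open>h\<close> does not vanish represents the localized Weyl algebra
  faithfully by operators on power series, with \<open>y\<close> acting as \<open>d/dx\<close>.  There every derivation of
  \<open>A\<^sub>h\<close> is \<open>ad\<^sub>w\<close> for an operator \<open>w = \<sigma> + \<pi>\<^sub>h h\<^sup>-\<^sup>1 a\<close>, where \<open>a \<in> A\<^sub>h\<close> and \<open>\<sigma>\<close> is multiplication by an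
  antiderivative of a multiple of \<open>1 / \<pi>\<^sub>h\<close>: correct the value at \<open>x\<close> first, then the value at \<open>yh\<close>
  by the defining property of \<open>\<pi>\<^sub>h\<close> and a Hermite reduction modulo \<open>\<kappa> = h / \<pi>\<^sub>h\<close>.

  Modulo inner derivations \<open>\<sigma>\<close> contributes \<open>R / R \<pi>\<^sub>h\<close>, which is central, and \<open>a\<close> contributes
  \<open>(R / R \<kappa>)[t]\<close> with the bracket \<open>\<pi>\<^sub>h {f, g} + \<rho> (g f\<^sub>t - f g\<^sub>t)\<close>, where \<open>{f, g} = f\<^sub>t g\<^sub>x - g\<^sub>t f\<^sub>x\<close> and
  \<open>\<rho> = - \<pi>\<^sub>h \<kappa>' / \<kappa>\<close> is a unit modulo \<open>\<kappa>\<close>.  Bracketing with \<open>1\<close> shows that this part is perfect.  Let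
  \<open>q\<close> be the radical of \<open>\<kappa>\<close>.  The powers of \<open>q\<close> filter the bracket, so the multiples of \<open>q\<close> form a
  nilpotent ideal; modulo \<open>q\<close> the Poisson term vanishes and \<open>f \<mapsto> - \<rho> f d/dt\<close> identifies the quotient
  with the vector fields on the line over \<open>R / R q\<close>.
\<close>


section \<open>Divisibility of polynomials over a field\<close>

text \<open>An antiderivative of a multiple of 1 / pi_h is in general not rational, so D_g need not
  be a commutator with an element of the localized Weyl algebra. In power series at a point where h
  does not vanish, h is invertible and everything integrates; D_g becomes a commutator as well, and
  all brackets of derivations reduce to one calculation with commutators. Two identities govern it:
  a_0 h = pi_h and a_0 \<kappa> = 1. The constant \<rho> is the commutator of yh and a_0 = 1 /
  \<kappa>, that is h (1 / \<kappa>)'. The commutator of two elements of A_h is h times a Poisson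
  bracket up to multiples of h \<kappa>; with a factor a_0 for each element this leaves pi_h {f, g},
  and the error is absorbed into A_h, where it gives inner derivations. As h may have irreducible
  factors of any degree, all facts about pi_h, \<kappa> and \<rho> are read off from multiplicities
  of prime elements. Characteristic 0 enters because differentiation lowers a positive multiplicity
  by exactly one.\<close>

lemma poly_bezout:
  fixes a b :: "'f::field poly"
  shows "\<exists>g u v. g = u * a + v * b \<and> g dvd a \<and> g dvd b"
\<comment> \<open>Euclid's algorithm. \<open>degree\<close> does not separate zero from the nonzero
  constants, so the measure ranks the remainder zero below them.\<close>
proof (induction "if b = 0 then 0 else Suc (degree b)" arbitrary: a b rule: less_induct)
  case less
  show ?case
  proof (cases "b = 0")
    case True
    then show ?thesis by (intro exI[of _ a] exI[of _ 1] exI[of _ 0]) auto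
  next
    case False
    have "(if a mod b = 0 then 0 else Suc (degree (a mod b))) < (if b = 0 then 0 else Suc (degree b))"
      using False degree_mod_less'[of b a] by auto
    from less[OF this] obtain g u v
      where g: "g = u * b + v * (a mod b)" "g dvd b" "g dvd a mod b" by blast
    have m: "a mod b = a - (a div b) * b" by (simp add: minus_div_mult_eq_mod)
    have "g = v * a + (u - v * (a div b)) * b"
      by (subst g(1), subst m) (simp add: algebra_simps)
    moreover have "g dvd a" using g(2,3) by (simp add: dvd_mod_iff)
    ultimately show ?thesis using g(2) by blast
  qed
qed

lemma poly_prime_divisor:
  fixes f :: "'f::field poly"
  assumes "f \<noteq> 0" "\<not> is_unit f"
  shows "\<exists>p. prime_elem p \<and> p dvd f"
  using assms
proof (induction "degree f" arbitrary: f rule: less_induct)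
  case less
  show ?case
  proof (cases "irreducible f")
    case True
    then show ?thesis using field_poly_irreducible_imp_prime by (intro exI[of _ f]) simp
  next
    case False
    then obtain a b where ab: "f = a * b" "\<not> is_unit a" "\<not> is_unit b"
      using less.prems unfolding irreducible_def by blast
    have nz: "a \<noteq> 0" "b \<noteq> 0" using ab less.prems by auto
    have "degree b > 0" using ab(3) nz(2) by (simp add: is_unit_iff_degree)
    then have "degree a < degree f" using ab nz by (simp add: degree_mult_eq)
    from less.hyps[OF this nz(1) ab(2)] show ?thesis using ab(1) by (meson dvd_mult2)
  qed
qed

lemma poly_coprime_bezout:
  fixes a b :: "'f::field poly"
  assumes "a \<noteq> 0" and "\<And>p. prime_elem p \<Longrightarrow> p dvd a \<Longrightarrow> p dvd b \<Longrightarrow> False"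
  shows "\<exists>u v. u * a + v * b = 1"
proof -
  obtain g u v where g: "g = u * a + v * b" "g dvd a" "g dvd b" using poly_bezout by blast
  have "g \<noteq> 0" using g(2) assms(1) by auto
  then have "is_unit g" using poly_prime_divisor[of g] assms(2) g(2,3) by (meson dvd_trans)
  then obtain k where "1 = g * k" by (auto elim: dvdE)
  then have "(k * u) * a + (k * v) * b = 1" using g(1) by (simp add: algebra_simps)
  then show ?thesis by blast
qed

lemma prime_bezout:
  fixes p b :: "'f::field poly"
  assumes "prime_elem p" "\<not> p dvd b"
  shows "\<exists>u v. u * p + v * b = 1"
proof (rule poly_coprime_bezout)
  show "p \<noteq> 0" using assms(1) by auto
  fix r assume "prime_elem r" "r dvd p" "r dvd b"
  moreover have "irreducible p" using assms(1) by (rule prime_elem_imp_irreducible)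
  ultimately have "p dvd r"
    by (meson irreducibleD' prime_elem_not_unit)
  then show False using assms(2) \<open>r dvd b\<close> by (meson dvd_trans)
qed

lemma prime_power_decomp:
  fixes p x :: "'f::field poly"
  assumes "prime_elem p" "x \<noteq> 0"
  shows "\<exists>a y. x = p ^ a * y \<and> \<not> p dvd y"
  using assms(2)
proof (induction "degree x" arbitrary: x rule: less_induct)
  case less
  show ?case
  proof (cases "p dvd x")
    case False
    then show ?thesis by (intro exI[of _ 0] exI[of _ x]) auto
  next
    case True
    then obtain z where z: "x = p * z" by blast
    have "z \<noteq> 0" "p \<noteq> 0" using z less.prems by auto
    moreover have "degree p > 0"
      using assms(1) \<open>p \<noteq> 0\<close> prime_elem_not_unit is_unit_iff_degree by blast
    ultimately have "degree z < degree x" using z by (simp add: degree_mult_eq)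
    from less.hyps[OF this \<open>z \<noteq> 0\<close>] obtain a y where "z = p ^ a * y" "\<not> p dvd y" by blast
    then show ?thesis using z by (intro exI[of _ "Suc a"] exI[of _ y]) auto
  qed
qed

lemma prime_power_dvd_cancel:
  fixes r a b :: "'f::field poly"
  assumes "prime_elem r" "\<not> r dvd a" "r ^ k dvd a * b"
  shows "r ^ k dvd b"
  using assms(3)
proof (induction k arbitrary: b)
  case (Suc k)
  then have "r dvd a * b" by (metis dvd_mult_left power_Suc)
  then have "r dvd b" using assms(1,2) by (simp add: prime_elem_dvd_mult_iff)
  then obtain c where c: "b = r * c" ..
  have "r * r ^ k dvd r * (a * c)" using Suc.prems c by (simp add: mult.left_commute)
  then have "r ^ k dvd a * c" using assms(1) by auto
  then have "r ^ k dvd c" by (rule Suc.IH)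
  then show ?case using c by simp
qed simp

text \<open>Divisibility can be tested at one prime at a time. The induction removes a prime
  \<open>p\<close> from both sides and has to restore the hypothesis for the cofactors.\<close>

lemma dvd_by_prime_powers:
  fixes a b :: "'f::field poly"
  assumes "a \<noteq> 0" "b \<noteq> 0"
    and "\<And>p k. prime_elem p \<Longrightarrow> p ^ k dvd a \<Longrightarrow> p ^ k dvd b"
  shows "a dvd b"
  using assms
proof (induction "degree a" arbitrary: a b rule: less_induct)
  case less
  show ?case
  proof (cases "is_unit a")
    case True
    then show ?thesis by (rule unit_imp_dvd)
  next
    case False
    then obtain p where p: "prime_elem p" "p dvd a" using poly_prime_divisor less.prems(1) by blast
    then have "p dvd b" using less.prems(3)[of p 1] by simp
    then obtain b' where b': "b = p * b'" ..
    from p(2) obtain a' where "a = p * a'" ..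
    note ab = this b'
    have nz: "a' \<noteq> 0" "b' \<noteq> 0" "p \<noteq> 0" using ab less.prems by auto
    have "degree p > 0" using p(1) nz(3) prime_elem_not_unit is_unit_iff_degree by blast
    then have deg: "degree a' < degree a" using ab nz by (simp add: degree_mult_eq)
    have "r ^ k dvd b'" if r: "prime_elem r" "r ^ k dvd a'" for r k
    \<comment> \<open>If \<open>r\<close> is associated to \<open>p\<close>, one more factor
      \<open>p\<close> is available in \<open>a\<close>, hence in \<open>b\<close>; otherwise the
      factor \<open>p\<close> of \<open>b\<close> is cancelled.\<close>
    proof (cases "p dvd r")
      case True
      then obtain w where w: "r = p * w" by blast
      have "is_unit w"
        using irreducibleD[OF prime_elem_imp_irreducible[OF r(1)] w] p(1) prime_elem_not_unit by blast
      then obtain w' where w': "1 = w * w'" by (auto elim: dvdE)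
      have pr: "p ^ k dvd r ^ k" "r ^ k dvd p ^ k"
      proof -
        show "p ^ k dvd r ^ k" using True by (rule dvd_power_same)
        have "r dvd p" using w w' by (metis dvd_triv_left mult.assoc mult.right_neutral)
        then show "r ^ k dvd p ^ k" by (rule dvd_power_same)
      qed
      have "p ^ Suc k dvd a" using pr(1) r(2) ab(1) by (auto intro: mult_dvd_mono dvd_trans)
      then have "p ^ Suc k dvd b" using less.prems(3) p(1) by blast
      then have "p ^ k dvd b'" using ab(2) nz(3) by simp
      then show ?thesis using pr(2) by (rule dvd_trans[rotated])
    next
      case False
      have "r ^ k dvd b" using less.prems(3)[OF r(1), of k] r(2) ab(1) by (simp add: dvd_mult)
      then have *: "r ^ k dvd p * b'" using ab by simp
      have "\<not> r dvd p"
      proof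
        assume "r dvd p"
        then have "p dvd r" using irreducibleD'[OF prime_elem_imp_irreducible[OF p(1)]] r(1)
            prime_elem_not_unit by blast
        then show False using False by simp
      qed
      then show ?thesis using prime_power_dvd_cancel[OF r(1) _ *] by simp
    qed
    from less.hyps[OF deg nz(1,2) this] show ?thesis using ab by simp
  qed
qed

section \<open>Derivatives and multiplicities of prime factors\<close>

lemma prime_elem_pderiv:
  fixes p :: "'f::field_char_0 poly"
  assumes "prime_elem p"
  shows "\<not> p dvd pderiv p"
proof
  assume "p dvd pderiv p"
  have "p \<noteq> 0" using assms by auto
  then have "degree p > 0" using assms prime_elem_not_unit is_unit_iff_degree by blast
  then have "pderiv p \<noteq> 0" by (simp add: pderiv_eq_0_iff)
  with \<open>p dvd pderiv p\<close> have "degree p \<le> degree (pderiv p)" by (rule dvd_imp_degree_le)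
  then show False using \<open>degree p > 0\<close> by (simp add: degree_pderiv)
qed

text \<open>The additional factor \<open>p\<close> on the left replaces the exponent
  \<open>a - 1\<close>, so that \<open>a = 0\<close> is no special case.\<close>

lemma pderiv_power_mult:
  fixes p u :: "'f::field_char_0 poly"
  shows "p * pderiv (p ^ a * u) = p ^ a * (of_nat a * pderiv p * u + p * pderiv u)"
proof (induction a)
  case (Suc a)
  have "p * pderiv (p ^ Suc a * u) = p * pderiv (p * (p ^ a * u))" by (simp add: mult.assoc)
  also have "\<dots> = p * (p * pderiv (p ^ a * u)) + p * pderiv p * (p ^ a * u)"
    by (simp only: pderiv_mult) (simp add: algebra_simps)
  also have "\<dots> = p ^ Suc a * (of_nat (Suc a) * pderiv p * u + p * pderiv u)"
    unfolding Suc.IH by (simp add: algebra_simps)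
  finally show ?case .
qed simp

lemma of_int_unit_poly: "c \<noteq> (0::int) \<Longrightarrow> is_unit (of_int c :: 'f::field_char_0 poly)"
  by (simp add: of_int_poly is_unit_const_poly_iff dvd_field_iff)

text \<open>The Wronskian has valuation \<open>a + b - 1\<close> at \<open>p\<close>; the factor \<open>p\<close> on the left avoids the
  subtraction.\<close>

lemma wronskian_prime_power:
  fixes p u v :: "'f::field_char_0 poly"
  assumes p: "prime_elem p" and uv: "\<not> p dvd u" "\<not> p dvd v" and ab: "a \<noteq> b"
  shows "\<exists>w. \<not> p dvd w \<and> p * (p ^ a * u * pderiv (p ^ b * v) - p ^ b * v * pderiv (p ^ a * u))
    = p ^ (a + b) * w"
proof -
  define w where "w = of_int (int b - int a) * (pderiv p * u * v) + p * (u * pderiv v - v * pderiv u)"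
  have "p * (p ^ a * u * pderiv (p ^ b * v) - p ^ b * v * pderiv (p ^ a * u))
     = p ^ a * u * (p * pderiv (p ^ b * v)) - p ^ b * v * (p * pderiv (p ^ a * u))"
    by (simp add: algebra_simps)
  also have "\<dots> = p ^ (a + b) * w"
    unfolding pderiv_power_mult w_def by (simp add: algebra_simps power_add)
  finally have eq: "p * (p ^ a * u * pderiv (p ^ b * v) - p ^ b * v * pderiv (p ^ a * u))
     = p ^ (a + b) * w" .
  have "\<not> p dvd w"
  proof
    assume "p dvd w"
    then have "p dvd of_int (int b - int a) * (pderiv p * u * v)"
      unfolding w_def by (simp add: dvd_add_left_iff)
    moreover have "is_unit (of_int (int b - int a) :: 'f poly)"
      using ab by (intro of_int_unit_poly) simp
    ultimately have "p dvd pderiv p * u * v" by (metis dvd_mult_unit_iff')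
    then show False using p uv prime_elem_pderiv[OF p] by (simp add: prime_elem_dvd_mult_iff)
  qed
  with eq show ?thesis by blast
qed

section \<open>Monic representatives and the prime factors of \<open>pi_poly\<close>\<close>

lemma monic_associated_eq:
  fixes a b :: "'f::field poly"
  assumes "lead_coeff a = 1" "lead_coeff b = 1" "a dvd b" "b dvd a"
  shows "a = b"
proof -
  have "degree a = degree b" using assms by (metis dvd_imp_degree_le le_antisym leading_coeff_0_iff zero_neq_one)
  obtain k where k: "b = a * k" using assms(3) by blast
  have "b \<noteq> 0" using assms(2) by auto
  then have "degree k = 0" using \<open>degree a = degree b\<close> k by (auto simp: degree_mult_eq)
  moreover have "lead_coeff k = 1" using k assms(1,2) by (simp add: lead_coeff_mult)
  ultimately have "k = 1" by (metis degree_eq_zeroE lead_coeff_pCons(2) pCons_one)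
  with k show ?thesis by simp
qed

lemma normalize_monic:
  fixes a :: "'f::field poly"
  assumes "a \<noteq> 0"
  shows "\<exists>b. lead_coeff b = 1 \<and> a dvd b \<and> b dvd a"
  using assms
  by (intro exI[of _ "smult (inverse (lead_coeff a)) a"]) (auto intro: smult_dvd dvd_smult)

text \<open>Dividing \<open>f\<close> and its derivative by their greatest common divisor
  \<open>g\<close> leaves coprime \<open>f1\<close> and \<open>f2\<close>, so \<open>f\<close>
  divides \<open>pderiv f * r\<close> exactly when \<open>f1\<close> divides \<open>r\<close>;
  \<open>p\<close> is \<open>f1\<close> made monic.\<close>

lemma pi_poly_exists:
  fixes f :: "'f::field poly"
  assumes "f \<noteq> 0"
  shows "\<exists>!p. lead_coeff p = 1 \<and> (\<forall>r. f dvd pderiv f * r \<longleftrightarrow> p dvd r)"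
proof -
  obtain g u v where g: "g = u * f + v * pderiv f" "g dvd f" "g dvd pderiv f"
    using poly_bezout by blast
  from g(2) obtain f1 where f1: "f = g * f1" ..
  from g(3) obtain f2 where f2: "pderiv f = g * f2" ..
  have "g \<noteq> 0" using f1 assms by (metis mult_zero_left)
  have "f1 \<noteq> 0" using f1 assms by (metis mult_zero_right)
  have "g * (u * f1 + v * f2) = u * (g * f1) + v * (g * f2)" by (simp add: algebra_simps)
  also have "\<dots> = g * 1" using g(1) unfolding f1[symmetric] f2[symmetric] by simp
  finally have "g * (u * f1 + v * f2) = g * 1" .
  then have uv: "u * f1 + v * f2 = 1" using \<open>g \<noteq> 0\<close> mult_left_cancel by blast
  obtain p where p: "lead_coeff p = 1" "f1 dvd p" "p dvd f1" using normalize_monic \<open>f1 \<noteq> 0\<close> by blast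
  have iff: "f dvd pderiv f * r \<longleftrightarrow> p dvd r" for r
  proof -
    have "f dvd pderiv f * r \<longleftrightarrow> f1 dvd f2 * r"
      using \<open>g \<noteq> 0\<close> by (subst f2, subst f1) (simp add: mult.assoc)
    also have "\<dots> \<longleftrightarrow> f1 dvd r"
    proof
      assume *: "f1 dvd f2 * r"
      have "r = (u * f1 + v * f2) * r" using uv by simp
      also have "\<dots> = f1 * (u * r) + v * (f2 * r)" by (simp add: algebra_simps)
      finally have r: "f1 * (u * r) + v * (f2 * r) = r" ..
      have "f1 dvd f1 * (u * r) + v * (f2 * r)" using * by (intro dvd_add dvd_triv_left dvd_mult[OF *])
      then show "f1 dvd r" unfolding r .
    qed simp
    also have "\<dots> \<longleftrightarrow> p dvd r" using p by (meson dvd_trans)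
    finally show ?thesis .
  qed
  show ?thesis
  proof (rule ex1I[of _ p])
    show "lead_coeff p = 1 \<and> (\<forall>r. f dvd pderiv f * r \<longleftrightarrow> p dvd r)" using p(1) iff by simp
    fix p' assume p': "lead_coeff p' = 1 \<and> (\<forall>r. f dvd pderiv f * r \<longleftrightarrow> p' dvd r)"
    then have "p' dvd r \<longleftrightarrow> p dvd r" for r using iff by simp
    from this[of p] this[of p'] have "p' dvd p" "p dvd p'" by simp_all
    with conjunct1[OF p'] p(1) show "p' = p" by (rule monic_associated_eq)
  qed
qed

lemma
  fixes f :: "'f::field poly"
  assumes "f \<noteq> 0"
  shows monic_pi_poly: "lead_coeff (pi_poly f) = 1"
    and pi_poly_dvd_iff: "f dvd pderiv f * r \<longleftrightarrow> pi_poly f dvd r"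
proof -
  have *: "lead_coeff (pi_poly f) = 1 \<and> (\<forall>r. f dvd pderiv f * r \<longleftrightarrow> pi_poly f dvd r)"
    unfolding pi_poly_def by (rule theI'[OF pi_poly_exists[OF assms]])
  show "lead_coeff (pi_poly f) = 1" using * by (rule conjunct1)
  show "f dvd pderiv f * r \<longleftrightarrow> pi_poly f dvd r" using * by (rule conjunct2[THEN spec])
qed

lemma pi_poly_nonzero: "f \<noteq> 0 \<Longrightarrow> pi_poly f \<noteq> (0 :: 'f::field poly)"
  using monic_pi_poly[of f] by auto

lemma pi_poly_dvd: "f \<noteq> 0 \<Longrightarrow> pi_poly f dvd (f :: 'f::field poly)"
  by (metis dvd_triv_right pi_poly_dvd_iff)

text \<open>If \<open>p\<close> divides \<open>f\<close> with multiplicity a > 0, it divides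
  \<open>pderiv f\<close> with multiplicity exactly a - 1, because the integer a is a unit. The
  missing factor must come from \<open>pi_poly f\<close>.\<close>

lemma prime_dvd_pi_poly:
  fixes f p :: "'f::field_char_0 poly"
  assumes f: "f \<noteq> 0" and p: "prime_elem p"
  shows "p dvd pi_poly f \<longleftrightarrow> p dvd f"
proof
  assume pf: "p dvd f"
  obtain a u where fa: "f = p ^ a * u" "\<not> p dvd u" using prime_power_decomp p f by blast
  have "a \<noteq> 0" using fa pf by (metis mult_1 power_0)
  define w where "w = of_nat a * pderiv p * u + p * pderiv u"
  have w: "p * pderiv f = p ^ a * w" unfolding w_def fa(1) by (rule pderiv_power_mult)
  have "\<not> p dvd w"
  proof
    assume "p dvd w"
    then have "p dvd of_int (int a) * (pderiv p * u)"
      unfolding w_def by (simp add: dvd_add_left_iff mult.assoc)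
    then have "p dvd pderiv p * u"
      using of_int_unit_poly[of "int a"] \<open>a \<noteq> 0\<close> by (metis dvd_mult_unit_iff' of_nat_eq_0_iff)
    then show False using p fa(2) prime_elem_pderiv[OF p] by (simp add: prime_elem_dvd_mult_iff)
  qed
  have "f dvd pderiv f * pi_poly f" using pi_poly_dvd_iff[OF f] by simp
  then have "p ^ a dvd pderiv f * pi_poly f" using fa(1) by (metis dvd_mult_left)
  then have "p ^ a * p dvd (p * pderiv f) * pi_poly f"
    by (metis mult.commute mult.left_commute mult_dvd_mono dvd_refl)
  then have "p ^ a * p dvd p ^ a * (w * pi_poly f)" by (simp add: w mult.assoc)
  then have "p dvd w * pi_poly f" using p by auto
  then show "p dvd pi_poly f" using p \<open>\<not> p dvd w\<close> by (simp add: prime_elem_dvd_mult_iff)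
next
  show "p dvd pi_poly f \<Longrightarrow> p dvd f" using pi_poly_dvd[OF f] by (meson dvd_trans)
qed

text \<open>With \<open>f = p ^ a * u\<close> and \<open>u\<close> prime to \<open>p\<close>,
  already \<open>u * p\<close> makes \<open>f\<close> divide \<open>pderiv f * (u * p)\<close>. So
  \<open>pi_poly f\<close> divides \<open>u * p\<close>, which has only one factor
  \<open>p\<close>.\<close>

lemma pi_poly_prime_square:
  fixes f p :: "'f::field_char_0 poly"
  assumes f: "f \<noteq> 0" and p: "prime_elem p"
  shows "\<not> p ^ 2 dvd pi_poly f"
proof
  assume p2: "p ^ 2 dvd pi_poly f"
  obtain a u where fa: "f = p ^ a * u" "\<not> p dvd u" using prime_power_decomp p f by blast
  have "pderiv f * (u * p) = p * pderiv (p ^ a * u) * u" using fa(1) by simp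
  also have "\<dots> = f * (of_nat a * pderiv p * u + p * pderiv u)"
    unfolding pderiv_power_mult fa(1) by simp
  finally have "f dvd pderiv f * (u * p)" by simp
  then have "pi_poly f dvd u * p" using pi_poly_dvd_iff[OF f] by simp
  with p2 have "p * p dvd u * p" unfolding power2_eq_square by (rule dvd_trans)
  then have "p dvd u" using p by auto
  then show False using fa(2) by simp
qed

lemma squarefree_dvd:
  fixes a b :: "'f::field poly"
  assumes "a \<noteq> 0" "b \<noteq> 0" and "\<And>p. prime_elem p \<Longrightarrow> \<not> p ^ 2 dvd a"
    and "\<And>p. prime_elem p \<Longrightarrow> p dvd a \<Longrightarrow> p dvd b"
  shows "a dvd b"
proof (rule dvd_by_prime_powers[OF assms(1,2)])
  fix p :: "'f poly" and k assume p: "prime_elem p" and k: "p ^ k dvd a"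
  have "k < 2" using assms(3)[OF p] k by (meson not_le power_le_dvd)
  then have "k = 0 \<or> k = 1" by auto
  then show "p ^ k dvd b" using assms(4)[OF p] k by auto
qed

lemma dvd_of_nat_Suc_mult_iff: "u dvd of_nat (Suc n) * r \<longleftrightarrow> u dvd r"
  for u r :: "'f::field_char_0 poly"
  using of_int_unit_poly[of "int (Suc n)", where 'f = 'f] by (simp add: dvd_mult_unit_iff' del: of_nat_Suc)

section \<open>Multiplicities of primes in \<open>ph\<close>, \<open>\<kappa>\<close> and
  \<open>\<rho>\<close>\<close>

locale poly_data =
  fixes h :: "'f::field_char_0 poly"
  assumes h_nonzero: "h \<noteq> 0"
begin

text \<open>In the notation of the statement \<open>ph\<close> is \<open>\<pi>\<^sub>h\<close>, \<open>\<kappa> = h / \<pi>\<^sub>h\<close>, \<open>\<rho> = - \<pi>\<^sub>h \<kappa>' / \<kappa>\<close> and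
  \<open>T r = - h (r / \<kappa>)'\<close>, so that \<open>ad\<^bsub>r a\<^sub>0\<^esub> = D\<^bsub>T r\<^esub>\<close>.\<close>

definition "ph = pi_poly h"
definition "\<kappa> = h div ph"
text \<open>The division is exact: up to a unit, \<open>\<kappa>\<close> is the greatest common
  divisor of \<open>h\<close> and its derivative.\<close>

definition "\<theta> = pderiv h div \<kappa>"
definition "\<rho> = pderiv ph - \<theta>"
definition "q = pi_poly \<kappa>"
definition "T r = - (pderiv r * ph + r * \<rho>)"

lemma ph_\<kappa>: "ph * \<kappa> = h"
  unfolding \<kappa>_def ph_def using pi_poly_dvd[OF h_nonzero] by simp

lemma ph_nonzero: "ph \<noteq> 0" and \<kappa>_nonzero: "\<kappa> \<noteq> 0"
  using ph_\<kappa> h_nonzero by auto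

lemma ph_iff: "h dvd pderiv h * r \<longleftrightarrow> ph dvd r"
  unfolding ph_def using h_nonzero by (rule pi_poly_dvd_iff)

lemma pderiv_h: "pderiv h = \<kappa> * \<theta>"
proof -
  have "ph * \<kappa> dvd pderiv h * ph" using ph_iff[of ph] ph_\<kappa> by simp
  then have "\<kappa> dvd pderiv h" using ph_nonzero by (simp add: mult.commute)
  then show ?thesis by (simp add: \<theta>_def)
qed

lemma \<rho>_\<kappa>: "\<rho> * \<kappa> = - (ph * pderiv \<kappa>)"
proof -
  have "\<kappa> * \<theta> = pderiv (ph * \<kappa>)" using pderiv_h ph_\<kappa> by simp
  then have "\<kappa> * \<theta> = ph * pderiv \<kappa> + \<kappa> * pderiv ph" by (simp only: pderiv_mult)
  then show ?thesis by (simp add: \<rho>_def algebra_simps)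
qed

lemma q_nonzero: "q \<noteq> 0"
  unfolding q_def using \<kappa>_nonzero by (rule pi_poly_nonzero)

lemma q_dvd_\<kappa>: "q dvd \<kappa>"
  unfolding q_def using \<kappa>_nonzero by (rule pi_poly_dvd)

lemma prime_dvd_q: "prime_elem p \<Longrightarrow> p dvd q \<longleftrightarrow> p dvd \<kappa>"
  unfolding q_def using \<kappa>_nonzero by (rule prime_dvd_pi_poly)

lemma prime_dvd_ph: "prime_elem p \<Longrightarrow> p dvd ph \<longleftrightarrow> p dvd h"
  unfolding ph_def using h_nonzero by (rule prime_dvd_pi_poly)

lemma q_prime_square: "prime_elem p \<Longrightarrow> \<not> p ^ 2 dvd q"
  unfolding q_def using \<kappa>_nonzero by (rule pi_poly_prime_square)

lemma ph_prime_decomp: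
  assumes p: "prime_elem p" and "p dvd \<kappa>"
  obtains p1 where "ph = p * p1" "\<not> p dvd p1"
proof -
  have "p dvd ph" using assms(2) prime_dvd_ph[OF p] dvd_mult[of p \<kappa> ph] ph_\<kappa> by simp
  then obtain p1 where p1: "ph = p * p1" by blast
  moreover have "\<not> p dvd p1"
    using pi_poly_prime_square[OF h_nonzero p] p1 by (auto simp: ph_def[symmetric] power2_eq_square)
  ultimately show ?thesis by (rule that)
qed

lemma \<kappa>_dvd_h: "\<kappa> dvd h"
  by (metis dvd_triv_right ph_\<kappa>)

lemma q_dvd_ph: "q dvd ph"
proof (rule squarefree_dvd[OF q_nonzero ph_nonzero q_prime_square])
  fix p assume p: "prime_elem p" "p dvd q"
  then have "p dvd \<kappa>" using prime_dvd_q by simp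
  then have "p dvd h" using \<kappa>_dvd_h by (rule dvd_trans)
  then show "p dvd ph" using prime_dvd_ph p(1) by simp
qed

text \<open>A prime of \<open>\<kappa>\<close> divides \<open>q\<close>, and its multiplicity in
  \<open>\<kappa>\<close> is at most \<open>degree \<kappa>\<close>. This crude exponent later
  bounds the length of the lower central series of \<open>N\<close>.\<close>

lemma \<kappa>_dvd_q_power: "\<kappa> dvd q ^ degree \<kappa>"
proof (rule dvd_by_prime_powers)
  show "\<kappa> \<noteq> 0" "q ^ degree \<kappa> \<noteq> 0" using \<kappa>_nonzero q_nonzero by auto
  fix p :: "'f poly" and k assume p: "prime_elem p" and k: "p ^ k dvd \<kappa>"
  show "p ^ k dvd q ^ degree \<kappa>"
  proof (cases "k = 0")
    case False
    have "p dvd p ^ k" using False by (simp add: dvd_power)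
    then have "p dvd \<kappa>" using k by (rule dvd_trans)
    then have "p ^ k dvd q ^ k" using prime_dvd_q p by (simp add: dvd_power_same)
    moreover have "k \<le> degree \<kappa>"
    proof -
      have "degree p > 0" using p prime_elem_not_unit is_unit_iff_degree by (metis gr0I prime_elem_not_zeroI not_prime_elem_zero)
      moreover have "p \<noteq> 0" using p by auto
      ultimately have "k \<le> degree (p ^ k)" by (simp add: degree_power_eq)
      also have "\<dots> \<le> degree \<kappa>" using k \<kappa>_nonzero by (rule dvd_imp_degree_le)
      finally show ?thesis .
    qed
    ultimately show ?thesis by (meson dvd_trans le_imp_power_dvd)
  qed simp
qed

text \<open>In \<open>\<rho> * \<kappa> = - (ph * pderiv \<kappa>)\<close> the right side contains
  \<open>p\<close> once from \<open>ph\<close> and once less than \<open>\<kappa>\<close> from the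
  derivative, so no factor \<open>p\<close> is left for \<open>\<rho>\<close>.\<close>

lemma prime_dvd_\<kappa>_not_dvd_\<rho>:
  assumes p: "prime_elem p" "p dvd \<kappa>"
  shows "\<not> p dvd \<rho>"
proof
  assume "p dvd \<rho>"
  then obtain r1 where r1: "\<rho> = p * r1" by blast
  obtain p1 where p1: "ph = p * p1" "\<not> p dvd p1" using ph_prime_decomp p by blast
  obtain a u where a: "\<kappa> = p ^ a * u" "\<not> p dvd u" using prime_power_decomp p \<kappa>_nonzero by blast
  have "a \<noteq> 0" using a p by (metis mult_1 power_0)
  have "\<not> p dvd 1" using p(1) prime_elem_not_unit by blast
  \<comment> \<open>Against the constant 1 the Wronskian is minus the derivative of
    \<open>\<kappa>\<close>.\<close>
  then obtain w where w: "\<not> p dvd w"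
    "p * (p ^ a * u * pderiv (p ^ 0 * 1) - p ^ 0 * 1 * pderiv (p ^ a * u)) = p ^ (a + 0) * w"
    using wronskian_prime_power[OF p(1) a(2), of 1 a 0] \<open>a \<noteq> 0\<close> by blast
  then have "p * pderiv \<kappa> = - (p ^ a * w)" using a(1) by (simp add: minus_equation_iff)
  moreover have "\<rho> * \<kappa> = - (p1 * (p * pderiv \<kappa>))" using \<rho>_\<kappa> p1(1) by (simp add: mult_ac)
  ultimately have "\<rho> * \<kappa> = p1 * (p ^ a * w)" by simp
  then have "p ^ a * (p * (r1 * u)) = p ^ a * (p1 * w)" using r1 a(1) by (simp add: algebra_simps)
  then have "p * (r1 * u) = p1 * w" using p(1) by auto
  then have "p dvd p1 * w" by (metis dvd_triv_left)
  then show False using p1(2) w(1) p(1) by (simp add: prime_elem_dvd_mult_iff)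
qed

lemma \<rho>_inverse_mod_\<kappa>: "\<exists>u v. u * \<kappa> + v * \<rho> = 1"
  using \<kappa>_nonzero prime_dvd_\<kappa>_not_dvd_\<rho> by (intro poly_coprime_bezout) auto

lemma T_\<kappa>: "T r * \<kappa> = - (ph * (\<kappa> * pderiv r - r * pderiv \<kappa>))"
proof -
  have "T r * \<kappa> = - (pderiv r * ph * \<kappa> + r * (\<rho> * \<kappa>))" by (simp add: T_def algebra_simps)
  also have "\<dots> = - (ph * (\<kappa> * pderiv r - r * pderiv \<kappa>))"
    unfolding \<rho>_\<kappa> by (simp add: algebra_simps)
  finally show ?thesis .
qed

text \<open>Let \<open>p\<close> have multiplicity a in \<open>\<kappa>\<close> and b < a in
  \<open>r\<close>. The Wronskian in \<open>T_\<kappa>\<close> has multiplicity a + b - 1,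
  \<open>ph\<close> adds one, and division by \<open>\<kappa>\<close> brings the multiplicity of
  \<open>T r\<close> back to b. So a defect of \<open>r\<close> against \<open>\<kappa>\<close> is a
  defect of \<open>T r\<close>.\<close>

lemma T_inj_mod_\<kappa>:
  assumes "\<kappa> dvd T r"
  shows "\<kappa> dvd r"
proof (cases "r = 0")
  case False
  obtain s where s: "T r = \<kappa> * s" using assms by blast
  show ?thesis
  proof (rule dvd_by_prime_powers[OF \<kappa>_nonzero False])
    fix p :: "'f poly" and k assume p: "prime_elem p" and k: "p ^ k dvd \<kappa>"
    obtain a u where a: "\<kappa> = p ^ a * u" "\<not> p dvd u" using prime_power_decomp p \<kappa>_nonzero by blast
    obtain b v where b: "r = p ^ b * v" "\<not> p dvd v" using prime_power_decomp p False by blast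
    show "p ^ k dvd r"
    proof (cases "k \<le> b")
      case True
      then show ?thesis using b by (simp add: le_imp_power_dvd)
    next
      case False
      have "k \<le> a"
      proof (rule ccontr)
        assume "\<not> k \<le> a"
        then have "p ^ Suc a dvd p ^ a * u" using k a(1) by (metis not_less_eq_eq power_le_dvd)
        then have "p dvd u" using p by (simp add: mult.commute)
        then show False using a by simp
      qed
      with False have ba: "b < a" by simp
      then have "p dvd p ^ a" by (simp add: dvd_power)
      then have "p dvd \<kappa>" using a by simp
      then obtain p1 where p1: "ph = p * p1" "\<not> p dvd p1" using ph_prime_decomp p by blast
      obtain w where w: "\<not> p dvd w"
        "p * (p ^ a * u * pderiv (p ^ b * v) - p ^ b * v * pderiv (p ^ a * u)) = p ^ (a + b) * w"
        using wronskian_prime_power[OF p a(2) b(2) less_imp_neq[OF ba, symmetric]] by blast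
      have "\<kappa> * s * \<kappa> = - (p1 * (p * (\<kappa> * pderiv r - r * pderiv \<kappa>)))"
        using T_\<kappa>[of r] s p1(1) by (simp add: mult_ac)
      then have "\<kappa> * s * \<kappa> = - (p1 * (p ^ (a + b) * w))"
        using w(2) by (simp only: a(1)[symmetric] b(1)[symmetric])
      then have "p1 * (p ^ (a + b) * w) = - (p ^ (a + a) * (u * u * s))"
        using a(1) by (simp add: power_add algebra_simps)
      also have "\<dots> = p ^ (a + b) * (- (p ^ (a - b) * (u * u * s)))"
        using ba by (simp add: power_add[symmetric] mult.assoc[symmetric])
      finally have "p ^ (a + b) * (p1 * w) = p ^ (a + b) * (- (p ^ (a - b) * (u * u * s)))"
        by (simp add: algebra_simps)
      moreover have "p ^ (a + b) \<noteq> 0" using p by auto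
      ultimately have "p1 * w = - (p ^ (a - b) * (u * u * s))" by (metis mult_left_cancel)
      moreover have "p dvd p ^ (a - b)" using ba by (simp add: dvd_power)
      ultimately have "p dvd p1 * w" by simp
      then show ?thesis using p1(2) w(1) p by (simp add: prime_elem_dvd_mult_iff)
    qed
  qed
qed simp

lemma T_add: "T (a + b) = T a + T b"
  by (simp add: T_def pderiv_add algebra_simps)

lemma T_\<kappa>_mult: "T (\<kappa> * r) = - (h * pderiv r)"
proof -
  have "T (\<kappa> * r) = - (\<kappa> * pderiv r * ph + r * pderiv \<kappa> * ph + r * (\<rho> * \<kappa>))"
    by (simp add: T_def pderiv_mult algebra_simps)
  also have "\<dots> = - (ph * \<kappa> * pderiv r)" unfolding \<rho>_\<kappa> by (simp add: algebra_simps)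
  finally show ?thesis unfolding ph_\<kappa> .
qed

text \<open>Hermite reduction: an element divisible by \<open>c\<close>, where \<open>c\<close> divides \<open>\<kappa>\<close>, is changed by an
  element \<open>T (c * _)\<close> into one divisible by \<open>c\<close> times a further prime factor of \<open>\<kappa>\<close>.\<close>

lemma T_decomposition_aux:
  assumes "c dvd \<kappa>" "c dvd d"
  shows "\<exists>r s. d = \<kappa> * s + T r"
  using assms
proof (induction "degree \<kappa> - degree c" arbitrary: c d rule: less_induct)
  case less
  obtain m where m: "\<kappa> = c * m" using less.prems(1) by blast
  have nz: "c \<noteq> 0" "m \<noteq> 0" using m \<kappa>_nonzero by auto
  show ?case
  proof (cases "is_unit m")
    case True
    then have "\<kappa> dvd d" using m less.prems(2) by (simp add: mult_unit_dvd_iff)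
    then obtain s where "d = \<kappa> * s" by blast
    then show ?thesis by (intro exI[of _ 0] exI[of _ s]) (simp add: T_def)
  next
    case False
    then obtain p where p: "prime_elem p" "p dvd m" using poly_prime_divisor nz by blast
    then obtain m' where m': "m = p * m'" by blast
    have cp: "c * p dvd \<kappa>" using m m' by simp
    have pk: "p dvd \<kappa>" using cp by (rule dvd_mult_right)
    have degp: "degree p > 0" using p(1) prime_elem_not_unit is_unit_iff_degree by (metis gr0I not_prime_elem_zero)
    have "degree (c * p) = degree c + degree p" using nz p by (intro degree_mult_eq) auto
    moreover have "degree (c * p) \<le> degree \<kappa>" using cp \<kappa>_nonzero by (rule dvd_imp_degree_le)
    ultimately have less': "degree \<kappa> - degree (c * p) < degree \<kappa> - degree c" using degp by simp
    obtain p1 where p1: "ph = p * p1" "\<not> p dvd p1" using ph_prime_decomp p pk by blast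
    obtain a u where a: "m = p ^ a * u" "\<not> p dvd u" using prime_power_decomp p nz by blast
    obtain b v where b: "c = p ^ b * v" "\<not> p dvd v" using prime_power_decomp p nz by blast
    have "a \<noteq> 0" using a p by (metis mult_1 power_0)
    have \<kappa>: "\<kappa> = p ^ (a + b) * (u * v)" using a b m by (simp add: power_add algebra_simps)
    have uv: "\<not> p dvd u * v" using a(2) b(2) p by (simp add: prime_elem_dvd_mult_iff)
    obtain w where w: "\<not> p dvd w" "p * (p ^ (a + b) * (u * v) * pderiv (p ^ b * v)
        - p ^ b * v * pderiv (p ^ (a + b) * (u * v))) = p ^ (a + b + b) * w"
      using wronskian_prime_power[OF p(1) uv b(2), of "a + b" b] \<open>a \<noteq> 0\<close> by auto
    \<comment> \<open>Every prime of \<open>c\<close> divides \<open>\<kappa>\<close> and hence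
      \<open>ph\<close>, which makes up for the factor lost by differentiation.\<close>
    have "c dvd pderiv c * ph"
    proof (cases "pderiv c = 0")
      case False
      show ?thesis
      proof (rule dvd_by_prime_powers)
        show "c \<noteq> 0" "pderiv c * ph \<noteq> 0" using nz False ph_nonzero by auto
        fix r :: "'f poly" and k assume r: "prime_elem r" "r ^ k dvd c"
        then obtain y where y: "c = r ^ k * y" by blast
        show "r ^ k dvd pderiv c * ph"
        proof (cases "k = 0")
          case False
          then have "r dvd r ^ k" by (simp add: dvd_power)
          then have "r dvd \<kappa>" using r(2) less.prems(1) by (meson dvd_trans)
          then obtain r1 where r1: "ph = r * r1" using ph_prime_decomp r by blast
          have "r * (pderiv c * r1) = r ^ k * ((of_nat k * pderiv r * y + r * pderiv y) * r1)"
            using pderiv_power_mult[of r k y] y by (simp add: mult.assoc[symmetric])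
          then have "pderiv c * ph = r ^ k * ((of_nat k * pderiv r * y + r * pderiv y) * r1)"
            using r1 by (simp add: algebra_simps)
          then show ?thesis by simp
        qed simp
      qed
    qed simp
    then obtain \<mu> where \<mu>: "pderiv c * ph = c * \<mu>" by blast
    \<comment> \<open>Modulo \<open>c * p\<close> only the term \<open>c * \<nu> * r0\<close> of
      \<open>T (c * r0)\<close> survives, up to sign, because \<open>pderiv r0\<close> is multiplied
      by \<open>ph\<close> and hence by \<open>p\<close>. The comparison of multiplicities that
      follows makes \<open>\<nu>\<close> prime to \<open>p\<close>.\<close>
    define \<nu> where "\<nu> = \<mu> + \<rho>"
    have "c * \<nu> * \<kappa> = (c * \<mu>) * \<kappa> + c * (\<rho> * \<kappa>)" by (simp add: \<nu>_def algebra_simps)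
    also have "\<dots> = pderiv c * ph * \<kappa> + c * (\<rho> * \<kappa>)" unfolding \<mu> ..
    also have "\<dots> = p1 * (p * (\<kappa> * pderiv c - c * pderiv \<kappa>))"
      unfolding \<rho>_\<kappa> by (simp add: p1(1) algebra_simps)
    also have "\<dots> = p ^ (a + b + b) * (p1 * w)" using w(2) by (simp add: \<kappa>[symmetric] b(1)[symmetric])
    also have "c * \<nu> * \<kappa> = p ^ (a + b + b) * (u * v * v * \<nu>)"
      by (subst \<kappa>, subst b(1)) (simp add: power_add algebra_simps)
    finally have *: "u * v * v * \<nu> = p1 * w" using p(1) by auto
    have "\<not> p dvd \<nu>"
    proof
      assume "p dvd \<nu>"
      then have "p dvd p1 * w" using * by (metis dvd_mult)
      then show False using p1(2) w(1) p(1) by (simp add: prime_elem_dvd_mult_iff)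
    qed
    then obtain x y where xy: "y * p + x * \<nu> = 1" using prime_bezout p(1) by blast
    obtain d1 where d1: "d = c * d1" using less.prems(2) by blast
    \<comment> \<open>\<open>x\<close> inverts \<open>\<nu>\<close> modulo \<open>p\<close>, and the
      minus sign cancels the one in \<open>T\<close>.\<close>
    define r0 where "r0 = - (x * d1)"
    have "T (c * r0) = - (c * \<nu> * r0 + c * ph * pderiv r0)"
    proof -
      have "T (c * r0) = - (r0 * (pderiv c * ph) + c * pderiv r0 * ph + c * r0 * \<rho>)"
        by (simp add: T_def pderiv_mult algebra_simps)
      then show ?thesis unfolding \<mu> \<nu>_def by (simp add: algebra_simps)
    qed
    also have "\<dots> = c * ((x * \<nu>) * d1) - c * p * (p1 * pderiv r0)"
      by (simp add: r0_def p1 algebra_simps)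
    also have "x * \<nu> = 1 - y * p" using xy by (simp add: algebra_simps)
    finally have "d - T (c * r0) = c * p * (y * d1 + p1 * pderiv r0)"
      by (simp add: d1 algebra_simps)
    then have "c * p dvd d - T (c * r0)" by simp
    from less.hyps[OF less' cp this] obtain r s where "d - T (c * r0) = \<kappa> * s + T r" by blast
    then have "d = \<kappa> * s + T (r + c * r0)" by (simp add: T_add algebra_simps)
    then show ?thesis by blast
  qed
qed

lemma T_decomposition: "\<exists>r s. d = \<kappa> * s + T r"
  using T_decomposition_aux[of 1 d] by simp

text \<open>A prime divides \<open>ph\<close> at most once, so a second factor of \<open>h\<close>
  sits in \<open>\<kappa>\<close>.\<close>

lemma prime_square_dvd_h_iff:
  assumes u: "prime_elem u"
  shows "u ^ 2 dvd h \<longleftrightarrow> u dvd q"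
proof
  assume *: "u ^ 2 dvd h"
  then have "u dvd h" by (metis dvd_mult_left power2_eq_square)
  then have "u dvd ph" using prime_dvd_ph u by simp
  then obtain p1 where p1: "ph = u * p1" by blast
  have np1: "\<not> u dvd p1"
    using pi_poly_prime_square[OF h_nonzero u] p1 by (auto simp: ph_def[symmetric] power2_eq_square)
  have "u * u dvd u * (p1 * \<kappa>)" using * ph_\<kappa> p1 by (simp add: power2_eq_square mult.assoc)
  then have "u dvd p1 * \<kappa>" using u by auto
  then show "u dvd q" using np1 u prime_dvd_q by (simp add: prime_elem_dvd_mult_iff)
next
  assume "u dvd q"
  then have "u dvd \<kappa>" "u dvd ph" using q_dvd_\<kappa> q_dvd_ph by (auto intro: dvd_trans)
  then show "u ^ 2 dvd h" using mult_dvd_mono[of u ph u \<kappa>] ph_\<kappa> by (simp add: power2_eq_square)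
qed

end

section \<open>Monic prime factors and Chinese remainders\<close>

lemma finite_monic_primes:
  fixes f :: "'f::field poly"
  assumes "f \<noteq> 0"
  shows "finite {u. lead_coeff u = 1 \<and> prime_elem u \<and> u dvd f}"
  using assms
proof (induction "degree f" arbitrary: f rule: less_induct)
  case less
  show ?case
  proof (cases "is_unit f")
    case True
    then have "{u. lead_coeff u = 1 \<and> prime_elem u \<and> u dvd f} = {}"
      using prime_elem_not_unit by (auto dest: dvd_unit_imp_unit)
    then show ?thesis by (simp only: finite.emptyI)
  next
    case False
    then obtain p where p: "prime_elem p" "p dvd f" using poly_prime_divisor less.prems by blast
    then obtain g where g: "f = p * g" by blast
    have nz: "p \<noteq> 0" "g \<noteq> 0" using g less.prems by auto
    have "degree p > 0" using p(1) nz prime_elem_not_unit is_unit_iff_degree by blast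
    then have "degree g < degree f" using g nz by (simp add: degree_mult_eq)
    from less.hyps[OF this nz(2)]
    have fin: "finite {u. lead_coeff u = 1 \<and> prime_elem u \<and> u dvd g}" .
    obtain p' where p': "lead_coeff p' = 1" "p dvd p'" "p' dvd p" using normalize_monic nz(1) by blast
    have "{u. lead_coeff u = 1 \<and> prime_elem u \<and> u dvd f}
      \<subseteq> insert p' {u. lead_coeff u = 1 \<and> prime_elem u \<and> u dvd g}"
    proof
      fix u assume u: "u \<in> {u. lead_coeff u = 1 \<and> prime_elem u \<and> u dvd f}"
      then have "u dvd p \<or> u dvd g" using g by (auto simp: prime_elem_dvd_mult_iff)
      moreover have "u = p'" if "u dvd p"
      proof (rule monic_associated_eq)
        show "lead_coeff u = 1" "lead_coeff p' = 1" using u p' by auto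
        have "p dvd u" using irreducibleD'[OF prime_elem_imp_irreducible[OF p(1)] that] u
            prime_elem_not_unit by blast
        then show "u dvd p'" "p' dvd u" using that p' by (auto intro: dvd_trans)
      qed
      ultimately show "u \<in> insert p' {u. lead_coeff u = 1 \<and> prime_elem u \<and> u dvd g}"
        using u by blast
    qed
    then show ?thesis using fin by (meson finite_insert finite_subset)
  qed
qed

lemma squarefree_dvd_iff_monic_primes:
  fixes f r :: "'f::field poly"
  assumes "f \<noteq> 0" "\<And>p. prime_elem p \<Longrightarrow> \<not> p ^ 2 dvd f"
  shows "f dvd r \<longleftrightarrow> (\<forall>u. lead_coeff u = 1 \<and> prime_elem u \<and> u dvd f \<longrightarrow> u dvd r)"
proof
  assume *: "\<forall>u. lead_coeff u = 1 \<and> prime_elem u \<and> u dvd f \<longrightarrow> u dvd r"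
  show "f dvd r"
  proof (cases "r = 0")
    case False
    show ?thesis
    proof (rule squarefree_dvd[OF assms(1) False assms(2)])
      fix p assume p: "prime_elem p" "p dvd f"
      then obtain p' where p': "lead_coeff p' = 1" "p dvd p'" "p' dvd p"
        using normalize_monic[of p] by auto
      have "prime_elem p'"
      proof (rule field_poly_irreducible_imp_prime, rule irreducibleI)
        show "p' \<noteq> 0" using p'(1) by auto
        show "\<not> is_unit p'" using p p'(2) by (meson dvd_trans prime_elem_not_unit)
        fix a b assume ab: "p' = a * b"
        then have "p dvd a \<or> p dvd b" using p'(2) p(1) by (simp add: prime_elem_dvd_mult_iff)
        then have "p' dvd a \<or> p' dvd b" using p'(3) by (blast intro: dvd_trans)
        then show "is_unit a \<or> is_unit b" using ab \<open>p' \<noteq> 0\<close>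
          by (metis dvd_mult_cancel_left dvd_mult_cancel_right mult.right_neutral mult_1)
      qed
      then have "p' dvd r" using * p' p by (meson dvd_trans)
      then show "p dvd r" using p' by (meson dvd_trans)
    qed
  qed simp
qed (auto intro: dvd_trans)

lemma prime_elem_dvd_prod:
  assumes "finite A" "prime_elem u" "u dvd \<Prod>A"
  shows "\<exists>v\<in>A. u dvd v"
  using assms(1,3)
proof (induction A rule: finite_induct)
  case empty
  then show ?case using assms(2) prime_elem_not_unit by auto
next
  case (insert x A)
  then show ?case using assms(2) by (auto simp: prime_elem_dvd_mult_iff)
qed

text \<open>\<open>u\<close> does not divide the product of the other monic primes, so Bezout's
  identity splits 1 between the two.\<close>

lemma crt_idempotent:
  fixes u :: "'f::field poly"
  assumes "finite U" "u \<in> U" "\<And>v. v \<in> U \<Longrightarrow> lead_coeff v = 1 \<and> prime_elem v"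
  shows "\<exists>e. u dvd e - 1 \<and> (\<forall>v\<in>U - {u}. v dvd e)"
proof -
  define m where "m = \<Prod>(U - {u})"
  have "\<not> u dvd m"
  proof
    assume "u dvd m"
    then obtain v where v: "v \<in> U - {u}" "u dvd v"
      using prime_elem_dvd_prod[of "U - {u}" u] assms unfolding m_def by blast
    then have "v dvd u" using irreducibleD'[OF prime_elem_imp_irreducible[of v] v(2)] assms
        prime_elem_not_unit by blast
    then have "u = v" using v assms by (intro monic_associated_eq) auto
    then show False using v by simp
  qed
  then obtain x y where xy: "x * u + y * m = 1" using prime_bezout assms by blast
  then have "y * m - 1 = u * (- x)" by (simp add: algebra_simps)
  then have "u dvd y * m - 1" by simp
  moreover have "\<forall>v\<in>U - {u}. v dvd y * m"
    unfolding m_def using assms(1) by (auto intro: dvd_mult dvd_prodI)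
  ultimately show ?thesis by blast
qed

text \<open>Solvability in the coefficients is a hypothesis so that the lemma applies both over the
  field and to polynomials in t with coefficients in R.\<close>

lemma pderiv_surj:
  fixes f :: "'a::{comm_ring_1, semiring_no_zero_divisors} poly"
  assumes "\<And>n c. \<exists>d::'a. of_nat (Suc n) * d = c"
  shows "\<exists>g. pderiv g = f"
proof -
  obtain D where D: "of_nat (Suc n) * D n c = (c::'a)" for n c using assms by metis
  let ?g = "\<Sum>i\<le>degree f. monom (D i (coeff f i)) (Suc i)"
  have "pderiv ?g = f"
  proof (rule poly_eqI)
    fix n
    have "coeff ?g (Suc n) = (\<Sum>i\<le>degree f. if i = n then D i (coeff f i) else 0)"
      by (simp add: coeff_sum)
    also have "\<dots> = (if n \<le> degree f then D n (coeff f n) else 0)" by simp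
    finally show "coeff (pderiv ?g) n = coeff f n"
      unfolding coeff_pderiv using D by (auto simp: coeff_eq_0 simp del: of_nat_Suc)
  qed
  then show ?thesis ..
qed

lemma of_nat_mult_surj_poly: "\<exists>d::'f::field_char_0 poly. of_nat (Suc n) * d = c"
  by (rule exI[of _ "smult (1 / of_nat (Suc n)) c"]) (simp add: of_nat_poly del: of_nat_Suc)

section \<open>Homomorphisms and quotients of algebras\<close>

context f_algebra
begin

lemma pls_zer: "a \<in> carr A \<Longrightarrow> a \<oplus> \<zero> = a"
  using pls_comm zer_closed zer_pls by metis

lemma zero_scl: "a \<in> carr A \<Longrightarrow> 0 \<odot> a = \<zero>"
  using add_scl[of a 1 "-1"] one_scl[of a] mns_self[of a] by (simp add: mns_def)

lemma scl_zer: "c \<odot> \<zero> = \<zero>"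
  using scl_scl[OF zer_closed, of c 0] zero_scl[OF zer_closed] by simp

lemma mns_closed: "\<lbrakk>a \<in> carr A; b \<in> carr A\<rbrakk> \<Longrightarrow> a \<ominus> b \<in> carr A"
  by (simp add: mns_def pls_closed scl_closed)

lemma pls_left_comm: "\<lbrakk>a \<in> carr A; b \<in> carr A; d \<in> carr A\<rbrakk> \<Longrightarrow> a \<oplus> (b \<oplus> d) = b \<oplus> (a \<oplus> d)"
  by (metis pls_assoc pls_comm)

lemmas pls_ac = pls_assoc pls_comm pls_left_comm

lemma zer_mlt: "a \<in> carr A \<Longrightarrow> \<zero> \<star> a = \<zero>"
  using scl_mlt[OF zer_closed, of a 0] zero_scl mlt_closed zer_closed by metis

lemma mlt_zer: "a \<in> carr A \<Longrightarrow> a \<star> \<zero> = \<zero>"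
  using mlt_scl[OF _ zer_closed, of a 0] zero_scl mlt_closed zer_closed by metis

lemma mns_pls_cancel: "\<lbrakk>a \<in> carr A; b \<in> carr A\<rbrakk> \<Longrightarrow> (a \<ominus> b) \<oplus> b = a"
proof -
  assume ab: "a \<in> carr A" "b \<in> carr A"
  have "(a \<ominus> b) \<oplus> b = a \<oplus> (b \<ominus> b)" using ab unfolding mns_def by (simp add: pls_ac scl_closed)
  then show ?thesis using ab mns_self pls_zer by simp
qed

lemma pls_mns_cancel: "\<lbrakk>a \<in> carr A; b \<in> carr A\<rbrakk> \<Longrightarrow> (b \<oplus> a) \<ominus> b = a"
proof -
  assume ab: "a \<in> carr A" "b \<in> carr A"
  have "(b \<oplus> a) \<ominus> b = a \<oplus> (b \<ominus> b)" using ab unfolding mns_def by (simp add: pls_ac scl_closed pls_closed)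
  then show ?thesis using ab mns_self pls_zer by simp
qed

lemma mns_eq_zer: "\<lbrakk>a \<in> carr A; b \<in> carr A\<rbrakk> \<Longrightarrow> a \<ominus> b = \<zero> \<longleftrightarrow> a = b"
  by (metis mns_pls_cancel mns_self zer_pls)

lemma carr_subspace: "subspace A (carr A)"
  by (simp add: subspace_def zer_closed pls_closed scl_closed)

lemma subspace_mns: "\<lbrakk>subspace A S; a \<in> S; b \<in> S\<rbrakk> \<Longrightarrow> a \<ominus> b \<in> S"
  by (simp add: subspace_def mns_def)

lemma lspan_subspace: "S \<subseteq> carr A \<Longrightarrow> subspace A (lspan A S)"
  using carr_subspace unfolding lspan_def subspace_def by blast

end

lemma UN_eq_const: "x0 \<in> M \<Longrightarrow> (\<And>x. x \<in> M \<Longrightarrow> F x = C) \<Longrightarrow> (\<Union>x\<in>M. F x) = C"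
  by auto

lemma UN_eq_const2:
  "x0 \<in> M \<Longrightarrow> y0 \<in> N \<Longrightarrow> (\<And>x y. x \<in> M \<Longrightarrow> y \<in> N \<Longrightarrow> F x y = C) \<Longrightarrow> (\<Union>x\<in>M. \<Union>y\<in>N. F x y) = C"
  by (rule UN_eq_const) (auto intro: UN_eq_const)

lemma lspan_base: "S \<subseteq> lspan A S"
  by (auto simp: lspan_def)

lemma lspan_minimal: "subspace A T \<Longrightarrow> S \<subseteq> T \<Longrightarrow> lspan A S \<subseteq> T"
  by (auto simp: lspan_def)

lemma restr_simps [simp]:
  "carr (restr A S) = S" "zer (restr A S) = zer A" "pls (restr A S) = pls A"
  "scl (restr A S) = scl A" "mlt (restr A S) = mlt A"
  by (simp_all add: restr_def)

lemma coset_restr: "coset (restr A S) I = coset A I"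
  by (simp add: coset_def fun_eq_iff)

section \<open>Homomorphisms and surjective images\<close>

definition alg_hom :: "('v \<Rightarrow> 'w) \<Rightarrow> ('f, 'v) alg \<Rightarrow> ('f, 'w) alg \<Rightarrow> bool" where
  "alg_hom f A B \<longleftrightarrow> f ` carr A \<subseteq> carr B \<and> f \<zero>\<^bsub>A\<^esub> = \<zero>\<^bsub>B\<^esub>
    \<and> (\<forall>a\<in>carr A. \<forall>b\<in>carr A. f (a \<oplus>\<^bsub>A\<^esub> b) = f a \<oplus>\<^bsub>B\<^esub> f b \<and> f (a \<star>\<^bsub>A\<^esub> b) = f a \<star>\<^bsub>B\<^esub> f b)
    \<and> (\<forall>c. \<forall>a\<in>carr A. f (c \<odot>\<^bsub>A\<^esub> a) = c \<odot>\<^bsub>B\<^esub> f a)"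

lemma alg_homD:
  assumes "alg_hom f A B"
  shows "a \<in> carr A \<Longrightarrow> f a \<in> carr B" "f \<zero>\<^bsub>A\<^esub> = \<zero>\<^bsub>B\<^esub>"
    "\<lbrakk>a \<in> carr A; b \<in> carr A\<rbrakk> \<Longrightarrow> f (a \<oplus>\<^bsub>A\<^esub> b) = f a \<oplus>\<^bsub>B\<^esub> f b"
    "\<lbrakk>a \<in> carr A; b \<in> carr A\<rbrakk> \<Longrightarrow> f (a \<star>\<^bsub>A\<^esub> b) = f a \<star>\<^bsub>B\<^esub> f b"
    "a \<in> carr A \<Longrightarrow> f (c \<odot>\<^bsub>A\<^esub> a) = c \<odot>\<^bsub>B\<^esub> f a"
  using assms unfolding alg_hom_def by blast+

lemma alg_hom_comp: "alg_hom f A B \<Longrightarrow> alg_hom g B C \<Longrightarrow> alg_hom (\<lambda>a. g (f a)) A C"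
  unfolding alg_hom_def by (simp add: image_subset_iff)

lemma (in f_algebra) alg_hom_mns:
  assumes "alg_hom f A B" "a \<in> carr A" "b \<in> carr A"
  shows "f (a \<ominus> b) = f a \<ominus>\<^bsub>B\<^esub> f b"
  using assms(2,3) by (simp add: mns_def alg_homD[OF assms(1)] scl_closed)

text \<open>The axioms are equations, so they pass along a surjection that respects the operations.
  Quotients, derivation algebras and hence \<open>HH1\<close> obtain their laws in this way.\<close>

lemma f_algebra_image:
  assumes "f_algebra A" and f: "alg_hom f A B" "f ` carr A = carr B"
  shows "f_algebra B"
proof -
  interpret f_algebra A by fact
  note h = alg_homD[OF f(1)]
  have ex: "b \<in> carr B \<Longrightarrow> \<exists>a\<in>carr A. b = f a" for b using f(2) by blast
  show ?thesis
  proof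
    show "\<zero>\<^bsub>B\<^esub> \<in> carr B" using h(1)[OF zer_closed] h(2) by simp
  next
    fix x y assume "x \<in> carr B" "y \<in> carr B"
    then obtain a b where ab: "a \<in> carr A" "b \<in> carr A" "x = f a" "y = f b" using ex by blast
    show "x \<oplus>\<^bsub>B\<^esub> y \<in> carr B" "x \<star>\<^bsub>B\<^esub> y \<in> carr B" "x \<oplus>\<^bsub>B\<^esub> y = y \<oplus>\<^bsub>B\<^esub> x"
      using ab h(1)[OF pls_closed] h(1)[OF mlt_closed] pls_comm[of a b]
      by (simp_all add: h(3)[symmetric] h(4)[symmetric])
    fix c
    show "c \<odot>\<^bsub>B\<^esub> (x \<oplus>\<^bsub>B\<^esub> y) = c \<odot>\<^bsub>B\<^esub> x \<oplus>\<^bsub>B\<^esub> c \<odot>\<^bsub>B\<^esub> y"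
      "(c \<odot>\<^bsub>B\<^esub> x) \<star>\<^bsub>B\<^esub> y = c \<odot>\<^bsub>B\<^esub> (x \<star>\<^bsub>B\<^esub> y)"
      "x \<star>\<^bsub>B\<^esub> (c \<odot>\<^bsub>B\<^esub> y) = c \<odot>\<^bsub>B\<^esub> (x \<star>\<^bsub>B\<^esub> y)"
      using ab scl_pls[of a b c] scl_mlt[of a b c] mlt_scl[of a b c]
      by (simp_all add: h(3,4,5)[symmetric] pls_closed mlt_closed scl_closed)
  next
    fix x y z assume "x \<in> carr B" "y \<in> carr B" "z \<in> carr B"
    then obtain a b d where ab: "a \<in> carr A" "b \<in> carr A" "d \<in> carr A" "x = f a" "y = f b" "z = f d"
      using ex by metis
    show "x \<oplus>\<^bsub>B\<^esub> y \<oplus>\<^bsub>B\<^esub> z = x \<oplus>\<^bsub>B\<^esub> (y \<oplus>\<^bsub>B\<^esub> z)"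
      "(x \<oplus>\<^bsub>B\<^esub> y) \<star>\<^bsub>B\<^esub> z = x \<star>\<^bsub>B\<^esub> z \<oplus>\<^bsub>B\<^esub> y \<star>\<^bsub>B\<^esub> z"
      "x \<star>\<^bsub>B\<^esub> (y \<oplus>\<^bsub>B\<^esub> z) = x \<star>\<^bsub>B\<^esub> y \<oplus>\<^bsub>B\<^esub> x \<star>\<^bsub>B\<^esub> z"
      using ab pls_assoc[of a b d] pls_mlt[of a b d] mlt_pls[of a b d]
      by (simp_all add: h(3,4)[symmetric] pls_closed mlt_closed)
  next
    fix x c c' assume "x \<in> carr B"
    then obtain a where a: "a \<in> carr A" "x = f a" using ex by blast
    show "c \<odot>\<^bsub>B\<^esub> x \<in> carr B" using a h(1)[OF scl_closed] by (simp add: h(5)[symmetric])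
    show "\<zero>\<^bsub>B\<^esub> \<oplus>\<^bsub>B\<^esub> x = x" "x \<ominus>\<^bsub>B\<^esub> x = \<zero>\<^bsub>B\<^esub>" "1 \<odot>\<^bsub>B\<^esub> x = x"
      using a zer_pls[of a] mns_self[of a] one_scl[of a] zer_closed
      by (simp_all add: h(2)[symmetric] h(3,5)[symmetric] mns_def scl_closed)
    show "(c + c') \<odot>\<^bsub>B\<^esub> x = c \<odot>\<^bsub>B\<^esub> x \<oplus>\<^bsub>B\<^esub> c' \<odot>\<^bsub>B\<^esub> x" "c \<odot>\<^bsub>B\<^esub> c' \<odot>\<^bsub>B\<^esub> x = (c * c') \<odot>\<^bsub>B\<^esub> x"
      using a add_scl[of a c c'] scl_scl[of a c c']
      by (simp_all add: h(3,5)[symmetric] scl_closed)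
  qed
qed

text \<open>The isomorphism theorem in symmetric form. Comparing two surjections from one concrete
  polynomial algebra avoids maps defined on cosets or tensors.\<close>

lemma same_kernel_alg_iso:
  assumes "f_algebra A" and f: "alg_hom f A B" "f ` carr A = carr B"
    and g: "alg_hom g A C" "g ` carr A = carr C"
    and ker: "\<And>a. a \<in> carr A \<Longrightarrow> f a = \<zero>\<^bsub>B\<^esub> \<longleftrightarrow> g a = \<zero>\<^bsub>C\<^esub>"
  obtains \<phi> where "alg_iso \<phi> B C" "\<And>a. a \<in> carr A \<Longrightarrow> \<phi> (f a) = g a"
proof -
  interpret f_algebra A by fact
  interpret B: f_algebra B using f_algebra_image[OF assms(1) f] .
  interpret C: f_algebra C using f_algebra_image[OF assms(1) g] .
  note hf = alg_homD[OF f(1)] and hg = alg_homD[OF g(1)]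
  \<comment> \<open>Any preimage will do, because \<open>f\<close> and \<open>g\<close> identify the
    same elements.\<close>
  define \<phi> where "\<phi> b = g (SOME a. a \<in> carr A \<and> f a = b)" for b
  have eq: "f a = f b \<longleftrightarrow> g a = g b" if "a \<in> carr A" "b \<in> carr A" for a b
  proof -
    have "f a = f b \<longleftrightarrow> f (a \<ominus>\<^bsub>A\<^esub> b) = \<zero>\<^bsub>B\<^esub>"
      using that by (simp add: alg_hom_mns[OF f(1)] B.mns_eq_zer hf(1))
    also have "\<dots> \<longleftrightarrow> g (a \<ominus>\<^bsub>A\<^esub> b) = \<zero>\<^bsub>C\<^esub>" using that by (intro ker mns_closed)
    also have "\<dots> \<longleftrightarrow> g a = g b"
      using that by (simp add: alg_hom_mns[OF g(1)] C.mns_eq_zer hg(1))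
    finally show ?thesis .
  qed
  have \<phi>: "\<phi> (f a) = g a" if "a \<in> carr A" for a
  proof -
    have "(SOME a'. a' \<in> carr A \<and> f a' = f a) \<in> carr A \<and> f (SOME a'. a' \<in> carr A \<and> f a' = f a) = f a"
      by (rule someI[of _ a]) (use that in simp)
    then show ?thesis unfolding \<phi>_def using eq that by blast
  qed
  have "alg_iso \<phi> B C"
    unfolding alg_iso_def
  proof (intro conjI ballI allI)
    show "bij_betw \<phi> (carr B) (carr C)"
    proof (rule bij_betw_imageI)
      show "inj_on \<phi> (carr B)"
        unfolding f(2)[symmetric] by (rule inj_onI) (auto simp: \<phi> eq)
      show "\<phi> ` carr B = carr C"
        unfolding f(2)[symmetric] g(2)[symmetric] image_image using \<phi> by (rule image_cong[OF refl])
    qed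
  next
    fix x y assume "x \<in> carr B" "y \<in> carr B"
    then obtain a b where ab: "a \<in> carr A" "b \<in> carr A" "x = f a" "y = f b" using f(2) by blast
    show "\<phi> (x \<oplus>\<^bsub>B\<^esub> y) = \<phi> x \<oplus>\<^bsub>C\<^esub> \<phi> y" "\<phi> (x \<star>\<^bsub>B\<^esub> y) = \<phi> x \<star>\<^bsub>C\<^esub> \<phi> y"
      using ab by (simp_all add: hf(3,4)[symmetric] \<phi> hg(3,4) pls_closed mlt_closed)
  next
    fix c x assume "x \<in> carr B"
    then obtain a where a: "a \<in> carr A" "x = f a" using f(2) by blast
    show "\<phi> (c \<odot>\<^bsub>B\<^esub> x) = c \<odot>\<^bsub>C\<^esub> \<phi> x"
      using a by (simp add: hf(5)[symmetric] \<phi> hg(5) scl_closed)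
  qed
  with \<phi> show ?thesis using that by blast
qed

section \<open>Cosets, ideals and quotients\<close>

context f_algebra
begin

lemma ideal_subset: "ideal A I \<Longrightarrow> i \<in> I \<Longrightarrow> i \<in> carr A"
  by (auto simp: ideal_def subspace_def)

lemma coset_self: "ideal A I \<Longrightarrow> a \<in> carr A \<Longrightarrow> a \<in> coset A I a"
  unfolding coset_def ideal_def subspace_def using pls_zer by (metis imageI)

lemma mem_coset_iff:
  assumes "ideal A I" "a \<in> carr A"
  shows "b \<in> coset A I a \<longleftrightarrow> b \<in> carr A \<and> b \<ominus> a \<in> I"
proof
  assume "b \<in> coset A I a"
  then obtain i where i: "i \<in> I" "b = a \<oplus> i" by (auto simp: coset_def)
  then show "b \<in> carr A \<and> b \<ominus> a \<in> I"
    using assms ideal_subset by (simp add: pls_closed pls_mns_cancel)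
next
  assume *: "b \<in> carr A \<and> b \<ominus> a \<in> I"
  then have "b = a \<oplus> (b \<ominus> a)" using assms mns_pls_cancel[of b a] pls_comm[of a "b \<ominus> a"] mns_closed by simp
  then show "b \<in> coset A I a" using * unfolding coset_def by blast
qed

lemma coset_eq_of_mem:
  assumes I: "ideal A I" and a: "a \<in> carr A" and b: "b \<in> coset A I a"
  shows "coset A I b = coset A I a"
proof -
  have S: "subspace A I" using I by (simp add: ideal_def)
  have b': "b \<in> carr A" "b \<ominus> a \<in> I" using mem_coset_iff[OF I a] b by auto
  have swap: "a \<ominus> b = (-1) \<odot> (b \<ominus> a)" if "a \<in> carr A" "b \<in> carr A" for a b
    using that by (simp add: mns_def scl_pls scl_scl one_scl scl_closed pls_comm)
  have tri: "(x \<ominus> y) \<oplus> (y \<ominus> z) = x \<ominus> z" if "x \<in> carr A" "y \<in> carr A" "z \<in> carr A" for x y z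
  proof -
    have "(x \<ominus> y) \<oplus> (y \<ominus> z) = ((x \<ominus> y) \<oplus> y) \<oplus> (-1) \<odot> z"
      unfolding mns_def using that by (simp add: pls_assoc pls_closed scl_closed)
    then show ?thesis using that by (simp add: mns_pls_cancel) (simp add: mns_def)
  qed
  have ab: "a \<ominus> b \<in> I" using b' a S by (simp add: swap[of a b] subspace_def)
  show ?thesis
  proof (intro set_eqI iffI)
    fix x assume "x \<in> coset A I b"
    then have x: "x \<in> carr A" "x \<ominus> b \<in> I" using mem_coset_iff[OF I b'(1)] by auto
    have "(x \<ominus> b) \<oplus> (b \<ominus> a) \<in> I" using x b' S by (simp add: subspace_def)
    then show "x \<in> coset A I a" using x a b' by (simp add: tri mem_coset_iff[OF I a])
  next
    fix x assume "x \<in> coset A I a"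
    then have x: "x \<in> carr A" "x \<ominus> a \<in> I" using mem_coset_iff[OF I a] by auto
    have "(x \<ominus> a) \<oplus> (a \<ominus> b) \<in> I" using x ab S by (simp add: subspace_def)
    then show "x \<in> coset A I b" using x a b' by (simp add: tri mem_coset_iff[OF I b'(1)])
  qed
qed

lemma coset_eq_iff:
  assumes "ideal A I" "a \<in> carr A" "b \<in> carr A"
  shows "coset A I a = coset A I b \<longleftrightarrow> a \<ominus> b \<in> I"
  using assms coset_eq_of_mem[OF assms(1,3)] coset_self[OF assms(1,2)] mem_coset_iff[OF assms(1,3)]
  by metis

lemma coset_eq_zer_iff:
  assumes "ideal A I" "a \<in> carr A"
  shows "coset A I a = \<zero>\<^bsub>quot A I\<^esub> \<longleftrightarrow> a \<in> I"
proof -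
  have "a \<ominus> \<zero> = a" using assms by (simp add: mns_def scl_zer pls_zer)
  then show ?thesis using coset_eq_iff[OF assms zer_closed] by (simp add: quot_def)
qed

text \<open>In \<open>quot\<close> an operation is a union over all representatives. All members of
  that union are one and the same coset, so it collapses.\<close>

lemma coset_hom:
  assumes I: "ideal A I"
  shows "alg_hom (coset A I) A (quot A I)"
proof -
  have S: "subspace A I" using I by (simp add: ideal_def)
  have c: "i \<in> I \<Longrightarrow> i \<in> carr A" for i using I by (rule ideal_subset)
  have pls: "pls (quot A I) (coset A I a) (coset A I b) = coset A I (a \<oplus> b)"
    if ab: "a \<in> carr A" "b \<in> carr A" for a b
  proof -
    have *: "coset A I (x \<oplus> y) = coset A I (a \<oplus> b)" if xy: "x \<in> coset A I a" "y \<in> coset A I b" for x y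
    proof (rule coset_eq_of_mem[OF I])
      from xy obtain i j where ij: "i \<in> I" "j \<in> I" "x = a \<oplus> i" "y = b \<oplus> j" by (auto simp: coset_def)
      then have "x \<oplus> y = (a \<oplus> b) \<oplus> (i \<oplus> j)" using ab c by (simp add: pls_ac pls_closed)
      moreover have "i \<oplus> j \<in> I" using ij S by (simp add: subspace_def)
      ultimately show "x \<oplus> y \<in> coset A I (a \<oplus> b)" by (simp add: coset_def)
    qed (use ab pls_closed in simp)
    show ?thesis
      by (simp add: quot_def) (rule UN_eq_const2[OF coset_self[OF I ab(1)] coset_self[OF I ab(2)] *])
  qed
  have mlt: "mlt (quot A I) (coset A I a) (coset A I b) = coset A I (a \<star> b)"
    if ab: "a \<in> carr A" "b \<in> carr A" for a b
  proof -
    have *: "coset A I (x \<star> y) = coset A I (a \<star> b)" if xy: "x \<in> coset A I a" "y \<in> coset A I b" for x y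
    proof (rule coset_eq_of_mem[OF I])
      from xy obtain i j where ij: "i \<in> I" "j \<in> I" "x = a \<oplus> i" "y = b \<oplus> j" by (auto simp: coset_def)
      then have "x \<star> y = (a \<star> b) \<oplus> (i \<star> b \<oplus> (a \<star> j \<oplus> i \<star> j))"
        using ab c by (simp add: pls_mlt mlt_pls pls_ac pls_closed mlt_closed)
      moreover have "i \<star> b \<oplus> (a \<star> j \<oplus> i \<star> j) \<in> I"
        using ij I ab c by (simp add: subspace_def ideal_def)
      ultimately show "x \<star> y \<in> coset A I (a \<star> b)" by (simp add: coset_def)
    qed (use ab mlt_closed in simp)
    show ?thesis
      by (simp add: quot_def) (rule UN_eq_const2[OF coset_self[OF I ab(1)] coset_self[OF I ab(2)] *])
  qed
  have scl: "scl (quot A I) k (coset A I a) = coset A I (k \<odot> a)" if a: "a \<in> carr A" for k a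
  proof -
    have *: "coset A I (k \<odot> x) = coset A I (k \<odot> a)" if x: "x \<in> coset A I a" for x
    proof (rule coset_eq_of_mem[OF I])
      from x obtain i where i: "i \<in> I" "x = a \<oplus> i" by (auto simp: coset_def)
      then have "k \<odot> x = k \<odot> a \<oplus> k \<odot> i" using a c by (simp add: scl_pls)
      moreover have "k \<odot> i \<in> I" using i S by (simp add: subspace_def)
      ultimately show "k \<odot> x \<in> coset A I (k \<odot> a)" by (simp add: coset_def)
    qed (use a scl_closed in simp)
    show ?thesis by (simp add: quot_def) (rule UN_eq_const[OF coset_self[OF I a] *])
  qed
  show ?thesis unfolding alg_hom_def by (simp add: pls mlt scl) (simp add: quot_def)
qed

lemma carr_quot: "carr (quot A I) = coset A I ` carr A"
  by (simp add: quot_def)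

lemma quot_f_algebra: "ideal A I \<Longrightarrow> f_algebra (quot A I)"
  using f_algebra_image[OF f_algebra_axioms coset_hom] carr_quot by metis

lemma kernel_ideal:
  assumes f: "alg_hom f A B" and B: "f_algebra B"
  shows "ideal A {a \<in> carr A. f a = \<zero>\<^bsub>B\<^esub>}"
proof -
  interpret B: f_algebra B by fact
  note h = alg_homD[OF f]
  show ?thesis unfolding ideal_def subspace_def
    by (auto simp: zer_closed pls_closed scl_closed mlt_closed h B.zer_pls B.scl_zer B.mlt_zer B.zer_mlt B.zer_closed)
qed

lemma quot_kernel_alg_iso:
  assumes f: "alg_hom f A B" "f ` carr A = carr B" and I: "I = {a \<in> carr A. f a = \<zero>\<^bsub>B\<^esub>}"
  obtains \<phi> where "alg_iso \<phi> (quot A I) B" "\<And>a. a \<in> carr A \<Longrightarrow> \<phi> (coset A I a) = f a"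
proof -
  have id: "ideal A I" unfolding I using f f_algebra_image[OF f_algebra_axioms f] by (intro kernel_ideal)
  show ?thesis
  proof (rule same_kernel_alg_iso[OF f_algebra_axioms coset_hom[OF id] _ f])
    show "coset A I ` carr A = carr (quot A I)" by (simp add: carr_quot)
    show "coset A I a = \<zero>\<^bsub>quot A I\<^esub> \<longleftrightarrow> f a = \<zero>\<^bsub>B\<^esub>" if "a \<in> carr A" for a
      using that coset_eq_zer_iff[OF id that] I by simp
  qed (rule that)
qed

lemma ideal_image:
  assumes f: "alg_hom f A B" "f ` carr A = carr B" and I: "ideal A I"
  shows "ideal B (f ` I)"
proof -
  note h = alg_homD[OF f(1)]
  have c: "i \<in> I \<Longrightarrow> i \<in> carr A" for i using I by (rule ideal_subset)
  show ?thesis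
    unfolding ideal_def subspace_def
  proof (intro conjI allI ballI)
    show "f ` I \<subseteq> carr B" using c h(1) by blast
    show "\<zero>\<^bsub>B\<^esub> \<in> f ` I" using I h(2) by (auto simp: ideal_def subspace_def intro!: image_eqI[of _ _ "\<zero>"])
    fix x assume "x \<in> f ` I"
    then obtain a where a: "a \<in> I" "x = f a" by blast
    {
      fix y assume "y \<in> f ` I"
      then obtain b where b: "b \<in> I" "y = f b" by blast
      have "a \<oplus> b \<in> I" using I a b by (simp add: ideal_def subspace_def)
      then show "x \<oplus>\<^bsub>B\<^esub> y \<in> f ` I" using a b h(3)[of a b] c by force
    next
      fix k
      have "k \<odot> a \<in> I" using I a by (simp add: ideal_def subspace_def)
      then show "k \<odot>\<^bsub>B\<^esub> x \<in> f ` I" using a h(5)[of a k] c by force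
    }
  next
    fix y x assume "x \<in> f ` I" and y: "y \<in> carr B"
    then obtain a where a: "a \<in> I" "x = f a" by blast
    from y obtain b where b: "b \<in> carr A" "y = f b" using f(2) by blast
    have "b \<star> a \<in> I" "a \<star> b \<in> I" using I a b by (simp_all add: ideal_def)
    then show "y \<star>\<^bsub>B\<^esub> x \<in> f ` I" "x \<star>\<^bsub>B\<^esub> y \<in> f ` I"
      using a b h(4)[of a b] h(4)[of b a] c by force+
  qed
qed

end

lemma alg_iso_inv:
  assumes "f_algebra A" and f: "alg_iso f A B"
  shows "alg_iso (inv_into (carr A) f) B A"
proof -
  interpret f_algebra A by fact
  have b: "bij_betw f (carr A) (carr B)" using f by (simp add: alg_iso_def)
  let ?g = "inv_into (carr A) f"
  have g: "?g (f a) = a" if "a \<in> carr A" for a using b that by (simp add: bij_betw_def)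
  show ?thesis
    unfolding alg_iso_def
  proof (intro conjI ballI allI)
    show "bij_betw ?g (carr B) (carr A)" using b by (rule bij_betw_inv_into)
  next
    fix x y assume "x \<in> carr B" "y \<in> carr B"
    then obtain a b where ab: "a \<in> carr A" "b \<in> carr A" "x = f a" "y = f b"
      using bij_betw_imp_surj_on[OF b] by blast
    have "f (a \<oplus>\<^bsub>A\<^esub> b) = x \<oplus>\<^bsub>B\<^esub> y" "f (a \<star>\<^bsub>A\<^esub> b) = x \<star>\<^bsub>B\<^esub> y" using f ab by (simp_all add: alg_iso_def)
    then show "?g (x \<oplus>\<^bsub>B\<^esub> y) = ?g x \<oplus>\<^bsub>A\<^esub> ?g y" "?g (x \<star>\<^bsub>B\<^esub> y) = ?g x \<star>\<^bsub>A\<^esub> ?g y"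
      using ab g pls_closed mlt_closed by metis+
  next
    fix c x assume "x \<in> carr B"
    then obtain a where a: "a \<in> carr A" "x = f a" using bij_betw_imp_surj_on[OF b] by blast
    have "f (c \<odot>\<^bsub>A\<^esub> a) = c \<odot>\<^bsub>B\<^esub> x" using f a by (simp add: alg_iso_def)
    then show "?g (c \<odot>\<^bsub>B\<^esub> x) = c \<odot>\<^bsub>A\<^esub> ?g x" using a g scl_closed by metis
  qed
qed

lemma isomorphic_sym: "f_algebra A \<Longrightarrow> isomorphic A B \<Longrightarrow> isomorphic B A"
  unfolding isomorphic_def using alg_iso_inv by blast

section \<open>The Poisson-type bracket and its quotients\<close>

lemma monom_sum_induct:
  fixes f :: "'a::comm_monoid_add poly"
  assumes "Q 0" "\<And>n. Q (monom (coeff f n) n)" "\<And>g h. Q g \<Longrightarrow> Q h \<Longrightarrow> Q (g + h)"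
  shows "Q f"
proof -
  have "Q (\<Sum>i\<le>k. monom (coeff f i) i)" for k
    by (induction k) (use assms in \<open>auto\<close>)
  then show ?thesis by (metis poly_as_sum_of_monoms)
qed

lemma
  fixes f :: "'f::comm_ring_1 poly poly"
  shows smult_const_add: "smult [:c + d:] f = smult [:c:] f + smult [:d:] f"
    and smult_const_uminus: "smult [:- c:] f = - smult [:c:] f"
    and smult_const_1: "smult [:1:] f = f"
  using smult_add_left[of "[:c:]" "[:d:]" f] smult_minus_left[of "[:c:]" f] by (simp_all flip: one_pCons)

text \<open>In \<open>'f poly poly\<close> the outer variable is t and the coefficients lie in R =
  F[x]; so \<open>pderiv\<close> is d/dt, and this is d/dx.\<close>

definition dx :: "'f::field poly poly \<Rightarrow> 'f poly poly" where
  "dx = map_poly pderiv"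

lemma coeff_dx [simp]: "coeff (dx f) n = pderiv (coeff f n)"
  by (simp add: dx_def coeff_map_poly)

lemma dx_0 [simp]: "dx 0 = 0"
  by (simp add: poly_eq_iff)

lemma dx_add: "dx (f + g) = dx f + dx g"
  by (simp add: poly_eq_iff pderiv_add)

lemma dx_pCons: "dx (pCons r f) = pCons (pderiv r) (dx f)"
  by (simp add: poly_eq_iff coeff_pCons split: nat.split)

lemma dx_smult: "dx (smult r f) = smult (pderiv r) f + smult r (dx f)"
  by (simp add: poly_eq_iff pderiv_mult mult.commute)

lemma dx_1 [simp]: "dx 1 = 0"
  by (simp add: one_pCons dx_pCons)

lemma const_dvd_iff: "[:c:] dvd f \<longleftrightarrow> (\<forall>n. c dvd coeff f n)" for c :: "'a::{comm_semiring_1, semiring_no_zero_divisors}"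
  by (rule const_poly_dvd_iff)

lemma const_dvd_pCons: "[:c:] dvd pCons a f \<longleftrightarrow> c dvd a \<and> [:c:] dvd f" for c :: "'a::{comm_semiring_1, semiring_no_zero_divisors}"
  unfolding const_dvd_iff coeff_pCons by (auto split: nat.splits)

lemma const_dvd_const_iff: "[:c:] dvd [:a:] \<longleftrightarrow> c dvd a" for c :: "'a::{comm_semiring_1, semiring_no_zero_divisors}"
  by (simp add: const_dvd_pCons)

text \<open>Look at the highest coefficient that \<open>u\<close> does not divide. Differentiation
  moves it down by one place and, with the factor \<open>\<nu>\<close> and in characteristic 0,
  keeps it outside the multiples of \<open>u\<close>; repetition leaves a constant. This serves
  nilpotent ideals, with \<open>\<nu>\<close> equal to \<open>\<rho>\<close>, and simplicity, with
  \<open>\<nu>\<close> equal to 1.\<close>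

lemma pderiv_descent:
  fixes u \<nu> :: "'f::field_char_0 poly"
  assumes \<nu>: "\<And>r. u dvd \<nu> * r \<Longrightarrow> u dvd r" and step: "\<And>f. Q f \<Longrightarrow> Q ([:\<nu>:] * pderiv f)"
    and f: "Q f" "\<not> [:u:] dvd f"
  shows "\<exists>g r. Q g \<and> [:u:] dvd g - [:r:] \<and> \<not> u dvd r"
proof -
  have "\<exists>g r. Q g \<and> [:u:] dvd g - [:r:] \<and> \<not> u dvd r"
    if "Q f" "\<not> [:u:] dvd f" "\<forall>i>n. u dvd coeff f i" for n f
    using that
  proof (induction n arbitrary: f)
    case 0
    have "[:u:] dvd f - [:coeff f 0:]"
      unfolding const_dvd_iff using 0(3) by (auto simp: coeff_pCons split: nat.split)
    moreover have "\<not> u dvd coeff f 0"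
    proof
      assume "u dvd coeff f 0"
      then have "u dvd coeff f i" for i using 0(3) by (cases i) auto
      then show False using 0(2) by (simp add: const_dvd_iff)
    qed
    ultimately show ?case using 0(1) by blast
  next
    case (Suc n)
    have co: "coeff ([:\<nu>:] * pderiv f) i = \<nu> * (of_nat (Suc i) * coeff f (Suc i))" for i
      by (simp add: coeff_pderiv del: of_nat_Suc)
    show ?case
    proof (cases "u dvd coeff f (Suc n)")
      case True
      then have "\<forall>i>n. u dvd coeff f i" using Suc.prems(3) by (metis Suc_lessI)
      then show ?thesis using Suc.IH Suc.prems by blast
    next
      case False
      have "\<not> [:u:] dvd [:\<nu>:] * pderiv f"
      proof
        assume "[:u:] dvd [:\<nu>:] * pderiv f"
        then have "u dvd \<nu> * (of_nat (Suc n) * coeff f (Suc n))" by (metis co const_dvd_iff)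
        then show False using False \<nu> dvd_of_nat_Suc_mult_iff by blast
      qed
      moreover have "\<forall>i>n. u dvd coeff ([:\<nu>:] * pderiv f) i"
        unfolding co using Suc.prems(3) by simp
      ultimately show ?thesis by (rule Suc.IH[OF step[OF Suc.prems(1)]])
    qed
  qed
  moreover have "\<forall>i>degree f. u dvd coeff f i" by (simp add: coeff_eq_0)
  ultimately show ?thesis using f by blast
qed

section \<open>The bracket on R[t]\<close>

context poly_data
begin

text \<open>The bracket of \<open>\<Sum> ad\<^bsub>r\<^sub>m a\<^sub>m\<^esub>\<close> and \<open>\<Sum> ad\<^bsub>s\<^sub>n a\<^sub>n\<^esub>\<close> modulo inner derivations, where the families are
  encoded as the polynomials \<open>\<Sum> r\<^sub>m t\<^sup>m\<close> and \<open>\<Sum> s\<^sub>n t\<^sup>n\<close>.\<close>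

definition br :: "'f poly poly \<Rightarrow> 'f poly poly \<Rightarrow> 'f poly poly" where
  "br f g = [:ph:] * (pderiv f * dx g - pderiv g * dx f) + [:\<rho>:] * (g * pderiv f - f * pderiv g)"

definition br_alg :: "('f, 'f poly poly) alg" where
  "br_alg = \<lparr>carr = UNIV, zer = 0, pls = (+), scl = (\<lambda>c. smult [:c:]), mlt = br\<rparr>"

text \<open>The first component stands for the multiple of 1 / pi_h that is integrated to give
  \<sigma>, the second for a family as in \<open>br\<close>. The first component is central.\<close>

definition pr_alg :: "('f, 'f poly \<times> 'f poly poly) alg" where
  "pr_alg = \<lparr>carr = UNIV, zer = (0, 0), pls = (\<lambda>x y. (fst x + fst y, snd x + snd y)),
     scl = (\<lambda>c x. (smult c (fst x), smult [:c:] (snd x))), mlt = (\<lambda>x y. (0, br (snd x) (snd y)))\<rparr>"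

lemma br_add_left: "br (f + g) k = br f k + br g k"
  by (simp add: br_def pderiv_add dx_add algebra_simps)

lemma br_add_right: "br k (f + g) = br k f + br k g"
  by (simp add: br_def pderiv_add dx_add algebra_simps)

lemma br_smult_left: "br (smult [:c:] f) g = smult [:c:] (br f g)"
  by (simp add: br_def pderiv_smult dx_smult pderiv_pCons algebra_simps smult_add_right smult_diff_right)

lemma br_smult_right: "br f (smult [:c:] g) = smult [:c:] (br f g)"
  by (simp add: br_def pderiv_smult dx_smult pderiv_pCons algebra_simps smult_add_right smult_diff_right)

lemma br_0_left [simp]: "br 0 g = 0"
  by (simp add: br_def)

lemma br_0_right [simp]: "br g 0 = 0"
  by (simp add: br_def)

lemma br_algebra: "f_algebra br_alg"
  by unfold_locales
    (simp_all add: br_alg_def mns_def br_add_left br_add_right br_smult_left br_smult_right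
      smult_add_right smult_add_left smult_const_add smult_const_uminus smult_const_1 mult.commute add.assoc add.commute)

lemma pr_algebra: "f_algebra pr_alg"
  by unfold_locales
    (simp_all add: pr_alg_def mns_def br_add_left br_add_right br_smult_left br_smult_right
      smult_add_right smult_add_left smult_const_add smult_const_uminus smult_const_1 mult.commute add.assoc add.commute)

lemma br_1_left: "br 1 g = - ([:\<rho>:] * pderiv g)"
  by (simp add: br_def)

text \<open>Bracketing with 1 is - \<rho> d/dt; here \<rho> is a unit modulo
  \<open>\<kappa>\<close>, and d/dt is onto in characteristic 0.\<close>

lemma br_surj_mod_\<kappa>: "\<exists>g. [:\<kappa>:] dvd f - br 1 g"
proof -
  obtain u v where uv: "u * \<kappa> + v * \<rho> = 1" using \<rho>_inverse_mod_\<kappa> by blast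
  obtain g where g: "pderiv g = - ([:v:] * f)"
    using pderiv_surj[OF of_nat_mult_surj_poly] by blast
  have "f - br 1 g = ([:1:] - [:v * \<rho>:]) * f" by (simp add: br_1_left g left_diff_distrib smult_diff_left)
  also have "[:1:] - [:v * \<rho>:] = [:\<kappa>:] * [:u:]" using uv by (simp add: algebra_simps)
  finally show ?thesis by (metis dvd_mult2 dvd_triv_left)
qed

lemma ph_pderiv_q_power: "\<exists>a. ph * pderiv (q ^ i) = q ^ i * a"
proof -
  obtain m where m: "ph = q * m" using q_dvd_ph by blast
  have "ph * pderiv (q ^ i) = m * (q * pderiv (q ^ i * 1))" using m by simp
  also have "\<dots> = q ^ i * (m * (of_nat i * pderiv q))" unfolding pderiv_power_mult by simp
  finally show ?thesis ..
qed

text \<open>Powers of \<open>q\<close> are constants for d/dt, and d/dx occurs only together with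
  \<open>ph\<close>, which makes up for the factor of \<open>q\<close> that differentiation
  loses.\<close>

lemma br_q_power:
  assumes "[:q ^ i:] dvd f" "[:q ^ j:] dvd g"
  shows "[:q ^ (i + j):] dvd br f g"
proof -
  obtain f1 where f1: "f = smult (q ^ i) f1" using assms(1) by (auto elim!: dvdE)
  obtain g1 where g1: "g = smult (q ^ j) g1" using assms(2) by (auto elim!: dvdE)
  obtain a where a: "ph * pderiv (q ^ i) = q ^ i * a" using ph_pderiv_q_power by blast
  obtain b where b: "ph * pderiv (q ^ j) = q ^ j * b" using ph_pderiv_q_power by blast
  have "br f g = smult (q ^ j) (smult (ph * pderiv (q ^ i)) (- (pderiv g1 * f1)))
     + smult (q ^ i) (smult (ph * pderiv (q ^ j)) (pderiv f1 * g1))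
     + smult (q ^ i * q ^ j) (br f1 g1)"
    by (simp add: br_def f1 g1 dx_smult pderiv_smult algebra_simps smult_add_right smult_diff_right)
  also have "\<dots> = smult (q ^ (i + j)) (smult a (- (pderiv g1 * f1)) + smult b (pderiv f1 * g1) + br f1 g1)"
    unfolding a b by (simp add: power_add algebra_simps smult_add_right smult_diff_right)
  finally show ?thesis by (simp add: const_dvd_iff)
qed

lemma br_mod_q: "[:q:] dvd br f g - [:\<rho>:] * (g * pderiv f - f * pderiv g)"
  using q_dvd_ph by (simp add: br_def const_dvd_const_iff dvd_mult2 del: mult_pCons_left)

text \<open>This brings \<open>T\<close> into the bracket and controls the constant coefficient of a
  central element, which brackets with 1 do not see.\<close>

lemma br_t: "coeff (br f [:0, 1:]) 0 = T (coeff f 0)"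
  by (simp add: br_def dx_pCons pderiv_pCons T_def coeff_mult algebra_simps)

lemma q_dvd_power_mult_\<rho>:
  assumes "q dvd r ^ m * \<rho> ^ k"
  shows "q dvd r"
proof (cases "r = 0")
  case False
  show ?thesis
  proof (rule squarefree_dvd[OF q_nonzero False q_prime_square])
    fix p assume p: "prime_elem p" "p dvd q"
    then have "p dvd r ^ m * \<rho> ^ k" using assms by (meson dvd_trans)
    then have "p dvd r ^ m \<or> p dvd \<rho> ^ k" using p(1) by (simp add: prime_elem_dvd_mult_iff)
    then show "p dvd r"
      using prime_dvd_\<kappa>_not_dvd_\<rho>[OF p(1)] p prime_dvd_q prime_elem_dvd_power by blast
  qed
qed simp

end

text \<open>The structure of \<open>H\<close> follows from a surjection with this kernel alone,
  which separates it from the algebra of A_h. The locale is later interpreted with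
  \<open>HH1\<close>.\<close>

locale bracket_quotient = poly_data h for h :: "'f::field_char_0 poly" +
  fixes H :: "('f, 'v) alg" and \<Psi> :: "'f poly \<times> 'f poly poly \<Rightarrow> 'v"
  assumes hom_\<Psi>: "alg_hom \<Psi> pr_alg H"
    and surj_\<Psi>: "range \<Psi> = carr H"
    and ker_\<Psi>: "\<Psi> (s, f) = zer H \<longleftrightarrow> ph dvd s \<and> [:\<kappa>:] dvd f"
begin

text \<open>In that interpretation \<open>M (monom r n)\<close> is the class of ad_u for u = r
  a_n.\<close>

definition "M f = \<Psi> (0, f)"
definition "N = M ` {f. [:q:] dvd f}"
definition "L = restr H (derived H)"

sublocale H: f_algebra H
  using f_algebra_image[OF pr_algebra hom_\<Psi>] surj_\<Psi> by (simp add: pr_alg_def)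

lemma \<Psi>_closed: "\<Psi> x \<in> carr H"
  using surj_\<Psi> by auto

lemma
  shows \<Psi>_add: "\<Psi> (s, f) \<oplus>\<^bsub>H\<^esub> \<Psi> (t, g) = \<Psi> (s + t, f + g)"
    and \<Psi>_scl: "c \<odot>\<^bsub>H\<^esub> \<Psi> (s, f) = \<Psi> (smult c s, smult [:c:] f)"
    and \<Psi>_mlt: "\<Psi> (s, f) \<star>\<^bsub>H\<^esub> \<Psi> (t, g) = \<Psi> (0, br f g)"
  using alg_homD(3)[OF hom_\<Psi>, of "(s, f)" "(t, g)"] alg_homD(4)[OF hom_\<Psi>, of "(s, f)" "(t, g)"]
    alg_homD(5)[OF hom_\<Psi>, of "(s, f)" c]
  by (simp_all add: pr_alg_def)

lemma \<Psi>_mns: "\<Psi> (s, f) \<ominus>\<^bsub>H\<^esub> \<Psi> (t, g) = \<Psi> (s - t, f - g)"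
  unfolding mns_def \<Psi>_scl \<Psi>_add by (simp add: smult_const_uminus smult_const_1)

lemma \<Psi>_0: "\<Psi> (0, 0) = zer H"
  by (simp add: ker_\<Psi>)

lemma \<Psi>_eq_iff: "\<Psi> (s, f) = \<Psi> (t, g) \<longleftrightarrow> ph dvd s - t \<and> [:\<kappa>:] dvd f - g"
  unfolding ker_\<Psi>[symmetric] \<Psi>_mns[symmetric] by (rule H.mns_eq_zer[symmetric]) (rule \<Psi>_closed)+

lemma M_eq_iff: "M f = M g \<longleftrightarrow> [:\<kappa>:] dvd f - g"
  by (simp add: M_def \<Psi>_eq_iff)

lemma M_add: "M f \<oplus>\<^bsub>H\<^esub> M g = M (f + g)"
  and M_scl: "c \<odot>\<^bsub>H\<^esub> M f = M (smult [:c:] f)"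
  and M_mlt: "M f \<star>\<^bsub>H\<^esub> M g = M (br f g)"
  and M_mns: "M f \<ominus>\<^bsub>H\<^esub> M g = M (f - g)"
  and M_0: "M 0 = zer H"
  and M_closed: "M f \<in> carr H"
  by (simp_all add: M_def \<Psi>_add \<Psi>_scl \<Psi>_mlt \<Psi>_0 \<Psi>_closed \<Psi>_mns)

lemma zer_in_M_image: "0 \<in> F \<Longrightarrow> zer H \<in> M ` F"
  using M_0 by (metis imageI)

lemma zer_in_range_\<Psi>: "zer H \<in> range (\<lambda>s. \<Psi> (s, 0))"
  using \<Psi>_0 by (metis rangeI)

lemma M_eq_zer_iff: "M f = zer H \<longleftrightarrow> [:\<kappa>:] dvd f"
  by (simp add: M_def ker_\<Psi>)

lemma carr_cases:
  assumes "x \<in> carr H"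
  obtains s f where "x = \<Psi> (s, f)"
  using assms surj_\<Psi> by (metis imageE surj_pair)

text \<open>Brackets have first component zero; conversely every \<open>M f\<close> is already a
  single bracket with \<open>M 1\<close>.\<close>

lemma derived_H: "derived H = range M"
proof
  have "subspace H (range M)"
    unfolding subspace_def
    by (auto simp: M_closed M_add M_scl intro!: zer_in_M_image)
  then show "derived H \<subseteq> range M"
    unfolding derived_def
    by (rule lspan_minimal) (auto elim!: carr_cases simp: \<Psi>_mlt M_def)
  show "range M \<subseteq> derived H"
  proof
    fix x assume "x \<in> range M"
    then obtain f where f: "x = M f" by blast
    obtain g where "[:\<kappa>:] dvd f - br 1 g" using br_surj_mod_\<kappa> by blast
    then have "x = M 1 \<star>\<^bsub>H\<^esub> M g" unfolding f M_mlt by (simp add: M_eq_iff)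
    then have "x \<in> {a \<star>\<^bsub>H\<^esub> b | a b. a \<in> carr H \<and> b \<in> carr H}" using M_closed by blast
    then show "x \<in> derived H" unfolding derived_def by (rule subsetD[OF lspan_base])
  qed
qed

text \<open>Bracketing with 1 forces the positive coefficients of \<open>f\<close> to be multiples
  of \<open>\<kappa>\<close>, as \<rho> is a unit there; bracketing with t and the injectivity of
  \<open>T\<close> modulo \<open>\<kappa>\<close> do the same for the constant coefficient.\<close>

lemma center_H: "center H = range (\<lambda>s. \<Psi> (s, 0))"
proof (intro set_eqI iffI)
  fix z assume z: "z \<in> center H"
  then obtain s f where sf: "z = \<Psi> (s, f)" unfolding center_def by (auto elim: carr_cases)
  have *: "[:\<kappa>:] dvd br f g" for g
  proof -
    have "z \<star>\<^bsub>H\<^esub> M g = zer H" using z M_closed by (simp add: center_def)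
    then show ?thesis by (simp add: sf M_def \<Psi>_mlt ker_\<Psi>)
  qed
  have "\<kappa> dvd T (coeff f 0)" using *[of "[:0, 1:]"] by (metis br_t const_dvd_iff)
  then have c0: "\<kappa> dvd coeff f 0" by (rule T_inj_mod_\<kappa>)
  obtain u v where uv: "u * \<kappa> + v * \<rho> = 1" using \<rho>_inverse_mod_\<kappa> by blast
  have "\<kappa> dvd coeff f (Suc n)" for n
  proof -
    have "br f 1 = [:\<rho>:] * pderiv f" by (simp add: br_def)
    then have "\<kappa> dvd \<rho> * (of_nat (Suc n) * coeff f (Suc n))"
      using *[of 1] by (simp add: const_dvd_iff coeff_pderiv del: of_nat_Suc)
    then have "\<kappa> dvd v * \<rho> * (of_nat (Suc n) * coeff f (Suc n))" by (simp add: mult.assoc del: of_nat_Suc)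
    also have "v * \<rho> = 1 - u * \<kappa>" using uv by (simp add: algebra_simps)
    finally have "\<kappa> dvd of_nat (Suc n) * coeff f (Suc n) - \<kappa> * (u * (of_nat (Suc n) * coeff f (Suc n)))"
      by (simp add: algebra_simps del: of_nat_Suc)
    then have "\<kappa> dvd of_nat (Suc n) * coeff f (Suc n)"
      by (metis dvd_diff_right_iff dvd_triv_left dvd_add_left_iff diff_add_cancel)
    then show ?thesis by (simp only: dvd_of_nat_Suc_mult_iff)
  qed
  then have "\<kappa> dvd coeff f n" for n using c0 by (cases n) auto
  then have "[:\<kappa>:] dvd f" by (simp add: const_dvd_iff)
  then have "z = \<Psi> (s, 0)" by (simp add: sf \<Psi>_eq_iff)
  then show "z \<in> range (\<lambda>s. \<Psi> (s, 0))" by blast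
next
  fix z assume "z \<in> range (\<lambda>s. \<Psi> (s, 0))"
  then obtain s where "z = \<Psi> (s, 0)" by blast
  then show "z \<in> center H" unfolding center_def by (auto elim!: carr_cases simp: \<Psi>_mlt \<Psi>_0 \<Psi>_closed)
qed

lemma ideal_center: "ideal H (center H)"
  unfolding center_H ideal_def subspace_def
  by (auto simp: \<Psi>_closed \<Psi>_add \<Psi>_scl \<Psi>_mlt intro!: zer_in_range_\<Psi> elim!: carr_cases)

lemma ideal_M_image:
  assumes "\<And>f g. f \<in> F \<Longrightarrow> g \<in> F \<Longrightarrow> f + g \<in> F" "\<And>c f. f \<in> F \<Longrightarrow> smult [:c:] f \<in> F" "0 \<in> F"
    "\<And>f g. f \<in> F \<Longrightarrow> br f g \<in> F \<and> br g f \<in> F"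
  shows "ideal H (M ` F)"
proof -
  have m: "f \<in> F \<Longrightarrow> \<Psi> (0, f) \<in> M ` F" for f by (auto simp: M_def)
  show ?thesis
    unfolding ideal_def subspace_def
    using zer_in_M_image[OF assms(3)] m assms
    by (auto simp: M_def \<Psi>_mlt \<Psi>_add \<Psi>_scl \<Psi>_closed elim!: carr_cases)
qed

lemma ideal_derived: "ideal H (derived H)"
  unfolding derived_H by (rule ideal_M_image) auto

lemma ideal_N: "ideal H N"
  unfolding N_def
proof (rule ideal_M_image)
  fix f g assume "f \<in> {f. [:q:] dvd f}"
  then have "[:q ^ 1:] dvd f" "[:q ^ 0:] dvd g" by (auto simp flip: one_pCons)
  from br_q_power[OF this] br_q_power[OF this(2,1)]
  show "br f g \<in> {f. [:q:] dvd f} \<and> br g f \<in> {f. [:q:] dvd f}" by simp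
qed (auto simp: dvd_smult)

lemma direct_sum_H: "is_direct_sum H (center H) (derived H)"
proof -
  have "center H \<inter> derived H = {zer H}"
  proof (intro set_eqI iffI)
    fix x assume "x \<in> center H \<inter> derived H"
    then obtain s f where x: "x = \<Psi> (s, 0)" "x = M f" unfolding center_H derived_H by blast
    then have "[:\<kappa>:] dvd f" by (simp add: M_def \<Psi>_eq_iff)
    then show "x \<in> {zer H}" using x(2) by (simp add: M_eq_zer_iff)
  qed (simp add: center_H derived_H zer_in_M_image zer_in_range_\<Psi>)
  moreover have "carr H = {s \<oplus>\<^bsub>H\<^esub> t | s t. s \<in> center H \<and> t \<in> derived H}"
  proof (intro set_eqI iffI)
    fix x assume "x \<in> carr H"
    then obtain s f where "x = \<Psi> (s, f)" by (rule carr_cases)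
    then have "x = \<Psi> (s, 0) \<oplus>\<^bsub>H\<^esub> M f" by (simp add: M_def \<Psi>_add)
    then show "x \<in> {s \<oplus>\<^bsub>H\<^esub> t | s t. s \<in> center H \<and> t \<in> derived H}"
      unfolding center_H derived_H by blast
  qed (auto simp: center_H derived_H M_def \<Psi>_add \<Psi>_closed)
  ultimately show ?thesis using ideal_center ideal_derived by (simp add: is_direct_sum_def)
qed

lemma N_subset: "N \<subseteq> derived H"
  unfolding N_def derived_H by blast

lemma M_mem_N_iff: "M f \<in> N \<longleftrightarrow> [:q:] dvd f"
proof
  assume "M f \<in> N"
  then obtain g where g: "[:q:] dvd g" "M f = M g" unfolding N_def by blast
  have "[:q:] dvd [:\<kappa>:]" using q_dvd_\<kappa> by (simp add: const_dvd_const_iff)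
  then have "[:q:] dvd f - g" using g(2) by (meson M_eq_iff dvd_trans)
  then show "[:q:] dvd f" using g(1) by (metis diff_add_cancel dvd_add)
qed (auto simp: N_def)

lemma hom_M: "alg_hom M br_alg L"
  unfolding alg_hom_def L_def
  by (auto simp: br_alg_def M_add M_mlt M_scl M_0 derived_H)

lemma L_algebra: "f_algebra L"
  using f_algebra_image[OF br_algebra hom_M] by (simp add: L_def derived_H br_alg_def)

lemma ideal_L_N: "ideal L N"
  using ideal_N N_subset ideal_derived
  unfolding ideal_def subspace_def L_def by auto

lemma coset_L: "coset L I = coset H I"
  unfolding L_def by (rule coset_restr)

lemma inj_coset_center: "inj_on (coset H N) (center H)"
proof (rule inj_onI)
  fix x y assume "x \<in> center H" "y \<in> center H" and eq: "coset H N x = coset H N y"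
  then obtain s t where st: "x = \<Psi> (s, 0)" "y = \<Psi> (t, 0)" unfolding center_H by blast
  then have "\<Psi> (s - t, 0) \<in> N"
    using eq H.coset_eq_iff[OF ideal_N, of x y] \<Psi>_closed by (simp add: \<Psi>_mns)
  then show "x = y" unfolding N_def M_def st by (auto simp: \<Psi>_eq_iff)
qed

lemma direct_sum_quot: "is_direct_sum (quot H N) (coset H N ` center H) (carr (quot L N))"
proof -
  note hom = H.coset_hom[OF ideal_N]
  have c: "carr (quot L N) = coset H N ` derived H"
    by (simp add: quot_def coset_L) (simp add: L_def)
  have surj: "coset H N ` carr H = carr (quot H N)" by (simp add: H.carr_quot)
  have sub: "center H \<subseteq> carr H" "derived H \<subseteq> carr H"
    by (auto simp: center_def derived_H M_closed)
  have "coset H N ` center H \<inter> coset H N ` derived H = {zer (quot H N)}"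
  proof (intro set_eqI iffI)
    fix x assume "x \<in> coset H N ` center H \<inter> coset H N ` derived H"
    then obtain s f where x: "x = coset H N (\<Psi> (s, 0))" "x = coset H N (M f)"
      unfolding center_H derived_H by blast
    then have "\<Psi> (s, - f) \<in> N"
      using H.coset_eq_iff[OF ideal_N, of "\<Psi> (s, 0)" "M f"] \<Psi>_closed M_closed by (simp add: M_def \<Psi>_mns)
    then have "ph dvd s" unfolding N_def M_def by (auto simp: \<Psi>_eq_iff)
    then have "\<Psi> (s, 0) = zer H" by (simp add: ker_\<Psi>)
    then show "x \<in> {zer (quot H N)}" using x(1) alg_homD(2)[OF hom] by simp
  next
    fix x assume "x \<in> {zer (quot H N)}"
    then have "x = coset H N (\<Psi> (0, 0))" using alg_homD(2)[OF hom] by (simp add: \<Psi>_0)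
    then show "x \<in> coset H N ` center H \<inter> coset H N ` derived H"
      unfolding center_H derived_H M_def by blast
  qed
  moreover have "carr (quot H N)
    = {s \<oplus>\<^bsub>quot H N\<^esub> t | s t. s \<in> coset H N ` center H \<and> t \<in> coset H N ` derived H}"
  proof -
    have "carr (quot H N) = coset H N ` {s \<oplus>\<^bsub>H\<^esub> t | s t. s \<in> center H \<and> t \<in> derived H}"
      using direct_sum_H surj by (simp add: is_direct_sum_def)
    also have "\<dots> = {s \<oplus>\<^bsub>quot H N\<^esub> t | s t. s \<in> coset H N ` center H \<and> t \<in> coset H N ` derived H}"
    proof -
      have "coset H N (s \<oplus>\<^bsub>H\<^esub> t) = coset H N s \<oplus>\<^bsub>quot H N\<^esub> coset H N t"
        if "s \<in> center H" "t \<in> derived H" for s t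
        using that sub by (intro alg_homD(3)[OF hom]) auto
      then show ?thesis by (auto simp: image_iff) metis+
    qed
    finally show ?thesis .
  qed
  ultimately show ?thesis
    using H.ideal_image[OF hom surj ideal_center] H.ideal_image[OF hom surj ideal_derived]
    by (simp add: is_direct_sum_def c)
qed

text \<open>Term \<open>n\<close> of the lower central series consists of multiples of
  \<open>q ^ Suc n\<close>. At \<open>n = degree \<kappa>\<close> these are multiples of
  \<open>\<kappa>\<close>, which \<open>M\<close> sends to zero.\<close>

lemma nilpotent_N: "nilpotent (restr L N)"
proof -
  have lc: "lower_central (restr L N) n \<subseteq> M ` {f. [:q ^ Suc n:] dvd f}" for n
  proof (induction n)
    case 0
    show ?case by (simp add: N_def)
  next
    case (Suc n)
    have dvd: "[:q ^ Suc (Suc n):] dvd f \<Longrightarrow> [:q:] dvd f" for f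
      by (rule dvd_trans[of _ "[:q ^ Suc (Suc n):]"]) (simp add: const_dvd_const_iff)
    show ?case
      unfolding lower_central.simps
    proof (rule lspan_minimal)
      show "subspace (restr L N) (M ` {f. [:q ^ Suc (Suc n):] dvd f})"
        unfolding subspace_def L_def
        by (auto simp: M_add M_scl M_mem_N_iff dvd_smult
          simp del: power_Suc intro: dvd intro!: zer_in_M_image)
      show "{a \<star>\<^bsub>restr L N\<^esub> b | a b. a \<in> carr (restr L N) \<and> b \<in> lower_central (restr L N) n}
        \<subseteq> M ` {f. [:q ^ Suc (Suc n):] dvd f}"
      proof
        fix x assume "x \<in> {a \<star>\<^bsub>restr L N\<^esub> b | a b. a \<in> carr (restr L N) \<and> b \<in> lower_central (restr L N) n}"
        then obtain a b where x: "x = a \<star>\<^bsub>H\<^esub> b" "a \<in> N" "b \<in> lower_central (restr L N) n"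
          by (auto simp: L_def)
        then obtain f g where fg: "a = M f" "[:q:] dvd f" "b = M g" "[:q ^ Suc n:] dvd g"
          using Suc.IH unfolding N_def by blast
        have "[:q ^ (1 + Suc n):] dvd br f g" using fg by (intro br_q_power) auto
        then show "x \<in> M ` {f. [:q ^ Suc (Suc n):] dvd f}" using x(1) fg by (simp add: M_mlt)
      qed
    qed
  qed
  \<comment> \<open>\<open>nilpotent\<close> asks for equality with the zero subspace, so each term
    must also contain zero.\<close>
  have zero: "zer H \<in> lower_central (restr L N) n" for n
  proof (cases n)
    case 0
    then show ?thesis using ideal_N by (simp add: ideal_def subspace_def)
  next
    case (Suc m)
    have "zer H \<in> lspan (restr L N) S" for S by (auto simp: lspan_def subspace_def L_def)
    then show ?thesis using Suc by simp
  qed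
  have "[:\<kappa>:] dvd f" if "[:q ^ Suc (degree \<kappa>):] dvd f" for f
  proof -
    have "\<kappa> dvd q ^ Suc (degree \<kappa>)" using \<kappa>_dvd_q_power by (simp add: dvd_mult)
    then show ?thesis using that by (meson const_dvd_const_iff dvd_trans)
  qed
  then have "lower_central (restr L N) (degree \<kappa>) \<subseteq> {zer H}"
    using lc[of "degree \<kappa>"] by (auto simp: M_eq_zer_iff)
  then have "lower_central (restr L N) (degree \<kappa>) = {zer (restr L N)}"
    using zero[of "degree \<kappa>"] by (auto simp: L_def)
  then show ?thesis unfolding nilpotent_def by blast
qed

text \<open>Modulo \<open>N\<close>, bracketing with \<open>a_0\<close> differentiates in \<open>t\<close>; this produces from an element outside
  \<open>N\<close> a nonzero multiple of \<open>a_0\<close> and then one of \<open>a_1\<close>, which together span a non-nilpotent algebra.\<close>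

lemma nilpotent_ideal_subset:
  assumes J: "ideal L J" and nil: "nilpotent (restr L J)"
  shows "J \<subseteq> N"
proof (rule ccontr)
  assume "\<not> J \<subseteq> N"
  have JL: "J \<subseteq> range M" using J by (auto simp: ideal_def subspace_def L_def derived_H)
  have brJ: "M (br f g) \<in> J" "M (br g f) \<in> J" if "M f \<in> J" for f g
    using J that unfolding ideal_def L_def derived_H by (auto simp: M_mlt[symmetric])
  obtain f where f: "M f \<in> J" "\<not> [:q:] dvd f"
    using \<open>\<not> J \<subseteq> N\<close> JL M_mem_N_iff by blast
  have "\<exists>g r. M g \<in> J \<and> [:q:] dvd g - [:r:] \<and> \<not> q dvd r"
  proof (rule pderiv_descent[where Q = "\<lambda>f. M f \<in> J", OF _ _ f])
    show "q dvd r" if "q dvd \<rho> * r" for r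
      using that q_dvd_power_mult_\<rho>[of r 1 1] by (simp add: mult.commute)
    have "br f 1 = [:\<rho>:] * pderiv f" for f by (simp add: br_def)
    then show "M ([:\<rho>:] * pderiv f) \<in> J" if "M f \<in> J" for f using brJ(1)[OF that, of 1] by simp
  qed
  then obtain f0 r where f0: "M f0 \<in> J" "[:q:] dvd f0 - [:r:]" "\<not> q dvd r" by blast
  \<comment> \<open>The t-derivative of - t^2 / 2 is - t. As \<open>f0\<close> is congruent to the
    constant \<open>r\<close> modulo \<open>q\<close>, this makes \<open>e\<close> congruent to
    \<open>\<rho> * r\<close> times t.\<close>
  define e where "e = br f0 [:0, 0, [:- 1 / 2:]:]"
  have e: "M e \<in> J" unfolding e_def using brJ f0(1) by blast
  have "pderiv [:0, 0, [:- 1 / 2:]:] = - [:0, 1 :: 'f poly:]" by (simp add: pderiv_pCons one_pCons)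
  then have e1: "[:q:] dvd e - [:\<rho>:] * ([:0, 0, [:- 1 / 2:]:] * pderiv f0 + f0 * [:0, 1:])"
    using br_mod_q[of f0 "[:0, 0, [:- 1 / 2:]:]"] by (simp add: e_def)
  obtain f1 where f1: "f0 = [:r:] + [:q:] * f1" using f0(2) by (metis add_diff_cancel_left' diff_add_cancel dvdE)
  obtain e2 where e2: "e = [:\<rho>:] * ([:0, 0, [:- 1 / 2:]:] * pderiv f0 + f0 * [:0, 1:]) + [:q:] * e2"
    using e1 by (metis add.commute diff_add_cancel dvdE)
  have "e - [:\<rho> * r:] * [:0, 1:] = [:q:] * ([:\<rho>:] * ([:0, 0, [:- 1 / 2:]:] * pderiv f1 + f1 * [:0, 1:]) + e2)"
    unfolding e2 f1 by (simp add: pderiv_add pderiv_mult pderiv_smult pderiv_pCons algebra_simps smult_add_right)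
  then obtain e3 where e3: "e = [:\<rho> * r:] * [:0, 1:] + [:q:] * e3" by (metis add.commute diff_add_cancel)
  have "\<exists>g. M g \<in> lower_central (restr L J) k \<and> [:q:] dvd g - [:r * (r * \<rho> ^ 2) ^ k:]" for k
  proof (induction k)
    case 0
    then show ?case using f0 by auto
  next
    case (Suc k)
    then obtain g where g: "M g \<in> lower_central (restr L J) k" "[:q:] dvd g - [:r * (r * \<rho> ^ 2) ^ k:]"
      by blast
    obtain g1 where g1: "g = [:r * (r * \<rho> ^ 2) ^ k:] + [:q:] * g1"
      using g(2) by (metis add.commute diff_add_cancel dvdE)
    have "M e \<star>\<^bsub>restr L J\<^esub> M g \<in> lower_central (restr L J) (Suc k)"
      unfolding lower_central.simps using e g(1) lspan_base by fastforce
    then have "M (br e g) \<in> lower_central (restr L J) (Suc k)" by (simp add: L_def M_mlt)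
    moreover have "[:q:] dvd br e g - [:r * (r * \<rho> ^ 2) ^ Suc k:]"
    proof -
      let ?c = "r * (r * \<rho> ^ 2) ^ k"
      have pe: "pderiv e = [:\<rho> * r:] + [:q:] * pderiv e3"
        unfolding e3 by (simp add: pderiv_add pderiv_smult pderiv_pCons one_pCons)
      have pg: "pderiv g = [:q:] * pderiv g1"
        unfolding g1 by (simp add: pderiv_add pderiv_smult pderiv_pCons)
      have "[:\<rho>:] * (g * pderiv e - e * pderiv g) - [:r * (r * \<rho> ^ 2) ^ Suc k:]
        = [:q:] * ([:\<rho>:] * (g1 * pderiv e + [:?c:] * pderiv e3 - e * pderiv g1))"
        unfolding pg unfolding pe g1 by (simp add: algebra_simps power2_eq_square smult_add_right smult_diff_right)
      then have "[:q:] dvd [:\<rho>:] * (g * pderiv e - e * pderiv g) - [:r * (r * \<rho> ^ 2) ^ Suc k:]"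
        by (metis dvd_triv_left)
      from dvd_add[OF br_mod_q[of e g] this] show ?thesis
        by (simp only: add_diff_eq diff_add_cancel)
    qed
    ultimately show ?case by blast
  qed
  moreover obtain k where k: "lower_central (restr L J) k = {zer H}"
    using nil unfolding nilpotent_def by (auto simp: L_def)
  ultimately obtain g where g: "M g = zer H" "[:q:] dvd g - [:r * (r * \<rho> ^ 2) ^ k:]" by blast
  then have "[:\<kappa>:] dvd g" by (simp add: M_eq_zer_iff)
  then have "[:q:] dvd g" using q_dvd_\<kappa> by (meson const_dvd_const_iff dvd_trans)
  then have "[:q:] dvd [:r * (r * \<rho> ^ 2) ^ k:]"
    using g(2) by (metis dvd_diff diff_diff_eq2 add_diff_cancel_left')
  then have "q dvd r * (r * \<rho> ^ 2) ^ k" by (simp add: const_dvd_const_iff)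
  then have "q dvd r ^ Suc k * \<rho> ^ (2 * k)" by (simp only: power_mult_distrib power_mult power_Suc mult.assoc)
  then have "q dvd r" by (rule q_dvd_power_mult_\<rho>)
  then show False using f0(3) by simp
qed

text \<open>\<open>N\<close> contains every nilpotent ideal, so it is the largest one, and no other
  can be maximal.\<close>

lemma maximal_N:
  "maximal_nilpotent_ideal L N \<and> (\<forall>I. maximal_nilpotent_ideal L I \<longrightarrow> I = N)"
proof -
  have N: "nilpotent_ideal L N" using ideal_L_N nilpotent_N by (simp add: nilpotent_ideal_def)
  have "I \<subseteq> N" if "nilpotent_ideal L I" for I
    using that nilpotent_ideal_subset by (simp add: nilpotent_ideal_def)
  then show ?thesis using N unfolding maximal_nilpotent_ideal_def by blast
qed

text \<open>Connects the spanning set in the theorem with the coefficientwise description of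
  \<open>N\<close>.\<close>

lemma lspan_N: "lspan H {M (monom r n) | r n. r \<in> range (\<lambda>s. s * q)} = N"
proof
  have sub: "subspace H N" using ideal_N by (simp add: ideal_def)
  then show "lspan H {M (monom r n) | r n. r \<in> range (\<lambda>s. s * q)} \<subseteq> N"
    by (rule lspan_minimal) (auto simp: M_mem_N_iff const_dvd_iff)
  show "N \<subseteq> lspan H {M (monom r n) | r n. r \<in> range (\<lambda>s. s * q)}"
  proof
    fix x assume "x \<in> N"
    then obtain f where f: "x = M f" "[:q:] dvd f" unfolding N_def by blast
    let ?S = "{M (monom r n) | r n. r \<in> range (\<lambda>s. s * q)}"
    have ss: "subspace H (lspan H ?S)" by (rule H.lspan_subspace) (auto simp: M_closed)
    have "M f \<in> lspan H ?S"
    proof (rule monom_sum_induct[of "\<lambda>f. M f \<in> lspan H ?S"])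
      show "M 0 \<in> lspan H ?S" using ss by (simp add: M_0 subspace_def)
      show "M (monom (coeff f n) n) \<in> lspan H ?S" for n
      proof -
        have "q dvd coeff f n" using f(2) by (simp add: const_dvd_iff)
        then obtain s where "coeff f n = q * s" ..
        then have "coeff f n \<in> range (\<lambda>s. s * q)" by (metis mult.commute rangeI)
        then have "M (monom (coeff f n) n) \<in> ?S" by blast
        then show ?thesis by (rule subsetD[OF lspan_base])
      qed
      show "M (g + k) \<in> lspan H ?S" if "M g \<in> lspan H ?S" "M k \<in> lspan H ?S" for g k
        using ss that by (simp add: M_add[symmetric] subspace_def)
    qed
    then show "x \<in> lspan H ?S" using f by simp
  qed
qed

lemma coset_M_hom:
  "alg_hom (\<lambda>f. coset L N (M f)) br_alg (quot L N)"
  "range (\<lambda>f. coset L N (M f)) = carr (quot L N)"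
  "coset L N (M f) = zer (quot L N) \<longleftrightarrow> [:q:] dvd f"
proof -
  interpret L: f_algebra L by (rule L_algebra)
  show "alg_hom (\<lambda>f. coset L N (M f)) br_alg (quot L N)"
    by (rule alg_hom_comp[OF hom_M L.coset_hom[OF ideal_L_N]])
  show "range (\<lambda>f. coset L N (M f)) = carr (quot L N)"
    by (simp add: quot_def L_def derived_H image_image)
  show "coset L N (M f) = zer (quot L N) \<longleftrightarrow> [:q:] dvd f"
    using L.coset_eq_zer_iff[OF ideal_L_N, of "M f"] M_mem_N_iff by (simp add: L_def derived_H)
qed

end

section \<open>Tensor products\<close>

text \<open>The common form of the product in \<open>pair_algebra\<close>, the evaluation of tensors
  and the evaluation of free algebras.\<close>

definition pm_sum :: "('k \<Rightarrow> 'c::zero \<Rightarrow> 'm::comm_monoid_add) \<Rightarrow> ('k \<Rightarrow>\<^sub>0 'c) \<Rightarrow> 'm" where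
  "pm_sum \<phi> p = (\<Sum>k\<in>Poly_Mapping.keys p. \<phi> k (Poly_Mapping.lookup p k))"

lemma pm_sum_superset:
  assumes "\<And>k. \<phi> k 0 = 0" "finite K" "Poly_Mapping.keys p \<subseteq> K"
  shows "pm_sum \<phi> p = (\<Sum>k\<in>K. \<phi> k (Poly_Mapping.lookup p k))"
  unfolding pm_sum_def using assms
  by (intro sum.mono_neutral_left) (auto simp: in_keys_iff)

lemma pm_sum_0 [simp]: "pm_sum \<phi> 0 = 0"
  by (simp add: pm_sum_def)

lemma pm_sum_single: "\<phi> k 0 = 0 \<Longrightarrow> pm_sum \<phi> (Poly_Mapping.single k c) = \<phi> k c"
  by (simp add: pm_sum_def)

lemma pm_sum_add:
  fixes p q :: "'k \<Rightarrow>\<^sub>0 'c::monoid_add"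
  assumes "\<And>k. \<phi> k 0 = 0" "\<And>k x y. \<phi> k (x + y) = \<phi> k x + \<phi> k y"
  shows "pm_sum \<phi> (p + q) = pm_sum \<phi> p + pm_sum \<phi> q"
proof -
  let ?K = "Poly_Mapping.keys p \<union> Poly_Mapping.keys q"
  have "Poly_Mapping.keys (p + q) \<subseteq> ?K" by (rule Poly_Mapping.keys_add)
  then show ?thesis
    using pm_sum_superset[of \<phi> ?K p] pm_sum_superset[of \<phi> ?K q] pm_sum_superset[of \<phi> ?K "p + q"] assms
    by (simp add: lookup_add sum.distrib)
qed

lemma pm_sum_expand: "pm_sum Poly_Mapping.single p = p"
  unfolding pm_sum_def by (rule poly_mapping_eqI)
    (simp add: lookup_sum lookup_single when_def in_keys_iff)

lemma lookup_map_mult: "Poly_Mapping.lookup (Poly_Mapping.map ((*) c) p) k = c * Poly_Mapping.lookup p k"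
  for c :: "'c::mult_zero"
  by (simp add: map.rep_eq when_def)

lemma keys_map_mult: "Poly_Mapping.keys (Poly_Mapping.map ((*) c) p) \<subseteq> Poly_Mapping.keys p"
  for c :: "'c::mult_zero"
  by (auto simp: in_keys_iff lookup_map_mult)

lemma map_mult_single: "Poly_Mapping.map ((*) c) (Poly_Mapping.single k d) = Poly_Mapping.single k (c * d)"
  for c :: "'c::mult_zero"
  by (rule poly_mapping_eqI) (simp add: lookup_map_mult lookup_single when_def)

lemma map_mult_add: "Poly_Mapping.map ((*) c) (p + q) = Poly_Mapping.map ((*) c) p + Poly_Mapping.map ((*) c) q"
  for c :: "'c::ring"
  by (rule poly_mapping_eqI) (simp add: lookup_map_mult lookup_add distrib_left)

lemma map_mult_sum:
  "Poly_Mapping.map ((*) c) (sum f A) = (\<Sum>i\<in>A. Poly_Mapping.map ((*) c) (f i))"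
  for c :: "'c::ring"
  by (rule poly_mapping_eqI) (simp add: lookup_map_mult lookup_sum sum_distrib_left)

lemma map_mult_uminus_1: "p + Poly_Mapping.map ((*) (- 1)) q = p - q"
  for p q :: "'k \<Rightarrow>\<^sub>0 'c::ring_1"
  by (rule poly_mapping_eqI) (simp add: lookup_map_mult lookup_add lookup_minus)

lemma pm_sum_map_mult:
  fixes c :: "'c::mult_zero"
  assumes "\<And>k. \<phi> k 0 = 0"
  shows "pm_sum \<phi> (Poly_Mapping.map ((*) c) p) = pm_sum (\<lambda>k x. \<phi> k (c * x)) p"
proof -
  have "pm_sum (\<lambda>k x. \<phi> k (c * x)) p
      = (\<Sum>k\<in>Poly_Mapping.keys p. \<phi> k (Poly_Mapping.lookup (Poly_Mapping.map ((*) c) p) k))"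
    by (simp add: pm_sum_def lookup_map_mult)
  then show ?thesis
    using pm_sum_superset[of \<phi>, OF assms finite_keys keys_map_mult[of c p]] by simp
qed

lemma additive_sum:
  assumes "f 0 = (0 :: 'b::comm_monoid_add)" "\<And>x y. f (x + y) = f x + f y"
  shows "f (sum g A) = (\<Sum>i\<in>A. f (g i))"
  by (induction A rule: infinite_finite_induct) (use assms in auto)

section \<open>The pair algebra and its evaluation in a model\<close>

lemma pair_mlt:
  "mlt (pair_algebra A B) p q = pm_sum (\<lambda>x c. pm_sum (\<lambda>y d.
     Poly_Mapping.single (fst x \<star>\<^bsub>A\<^esub> fst y, snd x \<star>\<^bsub>B\<^esub> snd y) (c * d)) q) p"
  by (simp add: pair_algebra_def pm_sum_def case_prod_unfold)

lemma pair_algebra_simps: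
  "carr (pair_algebra A B) = {p. Poly_Mapping.keys p \<subseteq> carr A \<times> carr B}"
  "zer (pair_algebra A B) = 0" "pls (pair_algebra A B) = (+)"
  "scl (pair_algebra A B) = (\<lambda>c. Poly_Mapping.map ((*) c))"
  by (simp_all add: pair_algebra_def)

lemma pair_algebra_f_algebra:
  assumes "f_algebra A" "f_algebra B"
  shows "f_algebra (pair_algebra A B)"
proof -
  interpret A: f_algebra A by fact
  interpret B: f_algebra B by fact
  let ?m = "mlt (pair_algebra A B)"
  have add_l: "?m (p + p') q = ?m p q + ?m p' q" for p p' q
    unfolding pair_mlt
    by (rule pm_sum_add) (simp_all add: distrib_right single_add pm_sum_def sum.distrib)
  have add_r: "?m p (q + q') = ?m p q + ?m p q'" for p q q'
  proof -
    have "pm_sum (\<lambda>y d. Poly_Mapping.single (fst x \<star>\<^bsub>A\<^esub> fst y, snd x \<star>\<^bsub>B\<^esub> snd y) (c * d)) (q + q')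
      = pm_sum (\<lambda>y d. Poly_Mapping.single (fst x \<star>\<^bsub>A\<^esub> fst y, snd x \<star>\<^bsub>B\<^esub> snd y) (c * d)) q
      + pm_sum (\<lambda>y d. Poly_Mapping.single (fst x \<star>\<^bsub>A\<^esub> fst y, snd x \<star>\<^bsub>B\<^esub> snd y) (c * d)) q'" for x c
      by (rule pm_sum_add) (simp_all add: distrib_left single_add)
    then show ?thesis unfolding pair_mlt by (simp add: pm_sum_def sum.distrib)
  qed
  have scl_l: "?m (Poly_Mapping.map ((*) c) p) q = Poly_Mapping.map ((*) c) (?m p q)" for c p q
    unfolding pair_mlt
    by (subst pm_sum_map_mult)
      (simp_all add: pm_sum_def map_mult_sum map_mult_single mult.assoc)
  have scl_r: "?m p (Poly_Mapping.map ((*) c) q) = Poly_Mapping.map ((*) c) (?m p q)" for c p q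
    unfolding pair_mlt
    by (subst pm_sum_map_mult)
      (simp_all add: pm_sum_def map_mult_sum map_mult_single mult.left_commute)
  have closed: "Poly_Mapping.keys (?m p q) \<subseteq> carr A \<times> carr B"
    if "Poly_Mapping.keys p \<subseteq> carr A \<times> carr B" "Poly_Mapping.keys q \<subseteq> carr A \<times> carr B" for p q
  proof -
    have "Poly_Mapping.keys (Poly_Mapping.single (fst x \<star>\<^bsub>A\<^esub> fst y, snd x \<star>\<^bsub>B\<^esub> snd y) d) \<subseteq> carr A \<times> carr B"
      if "x \<in> Poly_Mapping.keys p" "y \<in> Poly_Mapping.keys q" for x y and d :: 'a
    proof -
      have "x \<in> carr A \<times> carr B" "y \<in> carr A \<times> carr B"
        using that \<open>Poly_Mapping.keys p \<subseteq> _\<close> \<open>Poly_Mapping.keys q \<subseteq> _\<close> by blast+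
      then show ?thesis by (auto simp: A.mlt_closed B.mlt_closed)
    qed
    then show ?thesis
      unfolding pair_mlt pm_sum_def
      by (intro order_trans[OF keys_sum] UN_least) blast
  qed
  show ?thesis
  proof (unfold_locales, unfold mns_def pair_algebra_simps mem_Collect_eq)
    fix p q :: "('b \<times> 'c) \<Rightarrow>\<^sub>0 'a" and c
    assume p: "Poly_Mapping.keys p \<subseteq> carr A \<times> carr B"
    show "Poly_Mapping.keys (Poly_Mapping.map ((*) c) p) \<subseteq> carr A \<times> carr B"
      using keys_map_mult p by (rule order_trans)
    assume q: "Poly_Mapping.keys q \<subseteq> carr A \<times> carr B"
    show "Poly_Mapping.keys (p + q) \<subseteq> carr A \<times> carr B"
      using Poly_Mapping.keys_add[of p q] p q by blast
    show "Poly_Mapping.keys (?m p q) \<subseteq> carr A \<times> carr B" using p q by (rule closed)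
  qed (simp_all add: add_l add_r scl_l scl_r map_mult_add map_mult_uminus_1 add.assoc add.commute
      poly_mapping_eq_iff fun_eq_iff lookup_map_mult lookup_add algebra_simps)
qed

text \<open>A bilinear \<open>\<beta>\<close> that is multiplicative and for which every element of \<open>C\<close> is uniquely
  \<open>\<Sum> \<beta> x\<^sub>n b\<^sub>n\<close> identifies \<open>C\<close> with the tensor product, \<open>b\<close> being a basis of \<open>B\<close>.\<close>

locale tensor_model =
  A: f_algebra A + B: f_algebra B + C: f_algebra C
  for A :: "('f::field, 'v) alg" and B :: "('f, 'w) alg" and C :: "('f, 'm::ab_group_add) alg" +
  fixes \<beta> :: "'v \<Rightarrow> 'w \<Rightarrow> 'm" and b :: "nat \<Rightarrow> 'w"
  assumes zer_C: "zer C = 0" and pls_C: "pls C = (+)"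
    and scl_add_C: "\<And>c d x. scl C (c + d) x = scl C c x + scl C d x"
    and \<beta>_closed: "\<lbrakk>x \<in> carr A; y \<in> carr B\<rbrakk> \<Longrightarrow> \<beta> x y \<in> carr C"
    and \<beta>_add_left: "\<lbrakk>x \<in> carr A; x' \<in> carr A; y \<in> carr B\<rbrakk> \<Longrightarrow> \<beta> (x \<oplus>\<^bsub>A\<^esub> x') y = \<beta> x y + \<beta> x' y"
    and \<beta>_add_right: "\<lbrakk>x \<in> carr A; y \<in> carr B; y' \<in> carr B\<rbrakk> \<Longrightarrow> \<beta> x (y \<oplus>\<^bsub>B\<^esub> y') = \<beta> x y + \<beta> x y'"
    and \<beta>_scl_left: "\<lbrakk>x \<in> carr A; y \<in> carr B\<rbrakk> \<Longrightarrow> \<beta> (c \<odot>\<^bsub>A\<^esub> x) y = c \<odot>\<^bsub>C\<^esub> \<beta> x y"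
    and \<beta>_scl_right: "\<lbrakk>x \<in> carr A; y \<in> carr B\<rbrakk> \<Longrightarrow> \<beta> x (c \<odot>\<^bsub>B\<^esub> y) = c \<odot>\<^bsub>C\<^esub> \<beta> x y"
    and \<beta>_mlt: "\<lbrakk>x \<in> carr A; x' \<in> carr A; y \<in> carr B; y' \<in> carr B\<rbrakk> \<Longrightarrow>
      \<beta> (x \<star>\<^bsub>A\<^esub> x') (y \<star>\<^bsub>B\<^esub> y') = \<beta> x y \<star>\<^bsub>C\<^esub> \<beta> x' y'"
    and b_closed: "b n \<in> carr B"
    and b_span: "\<And>S. \<lbrakk>\<And>n c. c \<odot>\<^bsub>B\<^esub> b n \<in> S; \<zero>\<^bsub>B\<^esub> \<in> S;
      \<And>y y'. \<lbrakk>y \<in> S; y \<in> carr B; y' \<in> S; y' \<in> carr B\<rbrakk> \<Longrightarrow> y \<oplus>\<^bsub>B\<^esub> y' \<in> S\<rbrakk> \<Longrightarrow> carr B \<subseteq> S"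
    and \<beta>_indep: "\<And>N x. (\<And>n. x n \<in> carr A) \<Longrightarrow> (\<Sum>n\<le>N. \<beta> (x n) (b n)) = 0 \<Longrightarrow>
      (\<forall>n\<le>N. x n = \<zero>\<^bsub>A\<^esub>)"
    and \<beta>_span: "z \<in> carr C \<Longrightarrow> \<exists>N x. (\<forall>n. x n \<in> carr A) \<and> z = (\<Sum>n\<le>N. \<beta> (x n) (b n))"
begin

abbreviation "PA \<equiv> pair_algebra A B"
abbreviation "rels \<equiv> lspan PA (bilinear_rels A B)"

definition ev :: "(('v \<times> 'w) \<Rightarrow>\<^sub>0 'f) \<Rightarrow> 'm" where
  "ev = pm_sum (\<lambda>x c. if x \<in> carr A \<times> carr B then c \<odot>\<^bsub>C\<^esub> \<beta> (fst x) (snd x) else 0)"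

sublocale P: f_algebra PA
  by (rule pair_algebra_f_algebra) unfold_locales

lemma scl_0_C: "0 \<odot>\<^bsub>C\<^esub> x = 0"
  using scl_add_C[of 0 0 x] by simp

lemma ev_add: "ev (p + q) = ev p + ev q"
  unfolding ev_def by (rule pm_sum_add) (simp_all add: scl_0_C scl_add_C)

lemma ev_0: "ev 0 = 0"
  by (simp add: ev_def)

lemma ev_diff: "ev (p - q) = ev p - ev q"
  using ev_add[of "p - q" q] by simp

lemma ev_single: "\<lbrakk>x \<in> carr A; y \<in> carr B\<rbrakk> \<Longrightarrow> ev (Poly_Mapping.single (x, y) c) = c \<odot>\<^bsub>C\<^esub> \<beta> x y"
  unfolding ev_def by (subst pm_sum_single) (simp_all add: scl_0_C)

lemma sum_closed_C: "(\<And>i. i \<in> I \<Longrightarrow> g i \<in> carr C) \<Longrightarrow> sum g I \<in> carr C"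
  by (induction I rule: infinite_finite_induct)
    (use C.zer_closed C.pls_closed in \<open>auto simp: zer_C pls_C\<close>)

lemma scl_sum_C: "(\<And>i. i \<in> I \<Longrightarrow> g i \<in> carr C) \<Longrightarrow> c \<odot>\<^bsub>C\<^esub> sum g I = (\<Sum>i\<in>I. c \<odot>\<^bsub>C\<^esub> g i)"
proof (induction I rule: infinite_finite_induct)
  case (insert i I)
  then show ?case using C.scl_pls[of "g i" "sum g I" c] sum_closed_C[of I g] by (simp add: pls_C)
qed (use C.scl_zer in \<open>auto simp: zer_C\<close>)

lemma mlt_sum_C:
  "z \<in> carr C \<Longrightarrow> (\<And>i. i \<in> I \<Longrightarrow> g i \<in> carr C) \<Longrightarrow> z \<star>\<^bsub>C\<^esub> sum g I = (\<Sum>i\<in>I. z \<star>\<^bsub>C\<^esub> g i)"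
proof (induction I rule: infinite_finite_induct)
  case (insert i I)
  then show ?case using C.mlt_pls[of z "g i" "sum g I"] sum_closed_C[of I g] by (simp add: pls_C)
qed (use C.mlt_zer in \<open>auto simp: zer_C\<close>)

lemma sum_mlt_C:
  "z \<in> carr C \<Longrightarrow> (\<And>i. i \<in> I \<Longrightarrow> g i \<in> carr C) \<Longrightarrow> sum g I \<star>\<^bsub>C\<^esub> z = (\<Sum>i\<in>I. g i \<star>\<^bsub>C\<^esub> z)"
proof (induction I rule: infinite_finite_induct)
  case (insert i I)
  then show ?case using C.pls_mlt[of "g i" "sum g I" z] sum_closed_C[of I g] by (simp add: pls_C)
qed (use C.zer_mlt in \<open>auto simp: zer_C\<close>)

lemma ev_alt:
  assumes "p \<in> carr PA"
  shows "ev p = (\<Sum>x\<in>Poly_Mapping.keys p. Poly_Mapping.lookup p x \<odot>\<^bsub>C\<^esub> \<beta> (fst x) (snd x))"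
  using assms unfolding ev_def pm_sum_def by (intro sum.cong) (auto simp: pair_algebra_simps)

lemma term_closed: "x \<in> carr A \<times> carr B \<Longrightarrow> c \<odot>\<^bsub>C\<^esub> \<beta> (fst x) (snd x) \<in> carr C"
  by (auto intro!: C.scl_closed \<beta>_closed)

lemma ev_hom: "alg_hom ev PA C"
  unfolding alg_hom_def
proof (intro conjI ballI allI subsetI)
  fix z assume "z \<in> ev ` carr PA"
  then obtain p where p: "p \<in> carr PA" "z = ev p" by blast
  then show "z \<in> carr C" by (auto simp: ev_alt pair_algebra_simps intro!: sum_closed_C term_closed)
next
  show "ev \<zero>\<^bsub>PA\<^esub> = \<zero>\<^bsub>C\<^esub>" by (simp add: pair_algebra_simps ev_0 zer_C)
next
  fix p q assume pq: "p \<in> carr PA" "q \<in> carr PA"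
  show "ev (p \<oplus>\<^bsub>PA\<^esub> q) = ev p \<oplus>\<^bsub>C\<^esub> ev q" by (simp add: pair_algebra_simps ev_add pls_C)
  have k: "x \<in> Poly_Mapping.keys p \<Longrightarrow> x \<in> carr A \<times> carr B"
    "x \<in> Poly_Mapping.keys q \<Longrightarrow> x \<in> carr A \<times> carr B" for x
    using pq by (auto simp: pair_algebra_simps)
  let ?P = "Poly_Mapping.lookup p" and ?Q = "Poly_Mapping.lookup q"
  have "ev (p \<star>\<^bsub>PA\<^esub> q) = (\<Sum>x\<in>Poly_Mapping.keys p. \<Sum>y\<in>Poly_Mapping.keys q.
      ev (Poly_Mapping.single (fst x \<star>\<^bsub>A\<^esub> fst y, snd x \<star>\<^bsub>B\<^esub> snd y) (?P x * ?Q y)))"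
    unfolding pair_mlt pm_sum_def by (simp add: additive_sum[of ev, OF ev_0 ev_add])
  also have "\<dots> = (\<Sum>x\<in>Poly_Mapping.keys p. \<Sum>y\<in>Poly_Mapping.keys q.
      (?P x \<odot>\<^bsub>C\<^esub> \<beta> (fst x) (snd x)) \<star>\<^bsub>C\<^esub> (?Q y \<odot>\<^bsub>C\<^esub> \<beta> (fst y) (snd y)))"
  proof (intro sum.cong refl)
    fix x y assume "x \<in> Poly_Mapping.keys p" "y \<in> Poly_Mapping.keys q"
    then have xy: "fst x \<in> carr A" "snd x \<in> carr B" "fst y \<in> carr A" "snd y \<in> carr B"
      using k[of x] k[of y] by auto
    have "(?P x \<odot>\<^bsub>C\<^esub> \<beta> (fst x) (snd x)) \<star>\<^bsub>C\<^esub> (?Q y \<odot>\<^bsub>C\<^esub> \<beta> (fst y) (snd y))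
      = (?P x * ?Q y) \<odot>\<^bsub>C\<^esub> (\<beta> (fst x) (snd x) \<star>\<^bsub>C\<^esub> \<beta> (fst y) (snd y))"
      using xy by (simp add: C.scl_mlt C.mlt_scl C.scl_scl \<beta>_closed C.scl_closed C.mlt_closed mult.commute)
    then show "ev (Poly_Mapping.single (fst x \<star>\<^bsub>A\<^esub> fst y, snd x \<star>\<^bsub>B\<^esub> snd y) (?P x * ?Q y)) =
      (?P x \<odot>\<^bsub>C\<^esub> \<beta> (fst x) (snd x)) \<star>\<^bsub>C\<^esub> (?Q y \<odot>\<^bsub>C\<^esub> \<beta> (fst y) (snd y))"
      using xy by (simp add: ev_single A.mlt_closed B.mlt_closed \<beta>_mlt)
  qed
  also have "\<dots> = (\<Sum>x\<in>Poly_Mapping.keys p. (?P x \<odot>\<^bsub>C\<^esub> \<beta> (fst x) (snd x)) \<star>\<^bsub>C\<^esub> ev q)"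
    unfolding ev_alt[OF pq(2)] using k term_closed by (intro sum.cong refl mlt_sum_C[symmetric]) auto
  also have "\<dots> = ev p \<star>\<^bsub>C\<^esub> ev q"
    unfolding ev_alt[OF pq(1)] using k term_closed
    by (intro sum_mlt_C[symmetric]) (auto simp: ev_alt[OF pq(2)] intro!: sum_closed_C)
  finally show "ev (p \<star>\<^bsub>PA\<^esub> q) = ev p \<star>\<^bsub>C\<^esub> ev q" .
next
  fix c p assume p: "p \<in> carr PA"
  have k: "x \<in> Poly_Mapping.keys p \<Longrightarrow> x \<in> carr A \<times> carr B" for x
    using p by (auto simp: pair_algebra_simps)
  have "ev (c \<odot>\<^bsub>PA\<^esub> p) = (\<Sum>x\<in>Poly_Mapping.keys p. (c * Poly_Mapping.lookup p x) \<odot>\<^bsub>C\<^esub> \<beta> (fst x) (snd x))"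
    unfolding ev_def pair_algebra_simps by (subst pm_sum_map_mult) (auto simp: scl_0_C pm_sum_def k)
  also have "\<dots> = c \<odot>\<^bsub>C\<^esub> ev p"
    unfolding ev_alt[OF p] using k term_closed
    by (subst scl_sum_C) (auto intro!: sum.cong simp: C.scl_scl \<beta>_closed)
  finally show "ev (c \<odot>\<^bsub>PA\<^esub> p) = c \<odot>\<^bsub>C\<^esub> ev p" .
qed

lemma b_term: "x \<in> carr A \<Longrightarrow> ev (Poly_Mapping.single (x, b n) 1) = \<beta> x (b n)"
  by (simp add: ev_single b_closed C.one_scl \<beta>_closed)

lemma sum_closed_PA: "(\<And>i. i \<in> I \<Longrightarrow> g i \<in> carr PA) \<Longrightarrow> sum g I \<in> carr PA"
  by (induction I rule: infinite_finite_induct)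
    (use P.zer_closed P.pls_closed in \<open>auto simp: pair_algebra_simps\<close>)

lemma single_closed: "x \<in> carr A \<Longrightarrow> y \<in> carr B \<Longrightarrow> Poly_Mapping.single (x, y) c \<in> carr PA"
  by (auto simp: pair_algebra_simps)

lemma ev_surj: "ev ` carr PA = carr C"
proof
  show "ev ` carr PA \<subseteq> carr C" using alg_homD(1)[OF ev_hom] by blast
  show "carr C \<subseteq> ev ` carr PA"
  proof
    fix z assume "z \<in> carr C"
    then obtain N x where x: "\<forall>n. x n \<in> carr A" "z = (\<Sum>n\<le>N. \<beta> (x n) (b n))" using \<beta>_span by blast
    then have "z = ev (\<Sum>n\<le>N. Poly_Mapping.single (x n, b n) 1)"
      by (simp add: additive_sum[of ev, OF ev_0 ev_add] b_term)
    moreover have "(\<Sum>n\<le>N. Poly_Mapping.single (x n, b n) 1) \<in> carr PA"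
      using x(1) by (intro sum_closed_PA single_closed) (auto simp: b_closed)
    ultimately show "z \<in> ev ` carr PA" by blast
  qed
qed

lemma rels_base:
  assumes "x \<in> carr A" "x' \<in> carr A" "y \<in> carr B" "y' \<in> carr B"
  shows "Poly_Mapping.single (x \<oplus>\<^bsub>A\<^esub> x', y) 1 - Poly_Mapping.single (x, y) 1
      - Poly_Mapping.single (x', y) 1 \<in> bilinear_rels A B" (is ?a)
    and "Poly_Mapping.single (x, y \<oplus>\<^bsub>B\<^esub> y') 1 - Poly_Mapping.single (x, y) 1
      - Poly_Mapping.single (x, y') 1 \<in> bilinear_rels A B" (is ?b)
    and "Poly_Mapping.single (c \<odot>\<^bsub>A\<^esub> x, y) 1 - Poly_Mapping.single (x, y) c \<in> bilinear_rels A B" (is ?c)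
    and "Poly_Mapping.single (x, c \<odot>\<^bsub>B\<^esub> y) 1 - Poly_Mapping.single (x, y) c \<in> bilinear_rels A B" (is ?d)
proof -
  show ?a unfolding bilinear_rels_def Let_def using assms(1-3) by blast
  show ?b unfolding bilinear_rels_def Let_def using assms(1,3,4) by blast
  show ?c unfolding bilinear_rels_def Let_def using assms(1,3) by blast
  show ?d unfolding bilinear_rels_def Let_def using assms(1,3) by blast
qed

lemma rels_closed: "bilinear_rels A B \<subseteq> carr PA"
proof -
  have d: "p - q \<in> carr PA" if "p \<in> carr PA" "q \<in> carr PA" for p q
    using P.mns_closed[OF that] by (simp add: mns_def pair_algebra_simps map_mult_uminus_1)
  show ?thesis
    unfolding bilinear_rels_def Let_def
    by (auto intro!: d single_closed A.pls_closed B.pls_closed A.scl_closed B.scl_closed)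
qed

lemma rels_subspace: "subspace PA rels"
  using rels_closed by (rule P.lspan_subspace)

lemma
  shows rels_0: "0 \<in> rels" and rels_add: "p \<in> rels \<Longrightarrow> q \<in> rels \<Longrightarrow> p + q \<in> rels"
    and rels_diff: "p \<in> rels \<Longrightarrow> q \<in> rels \<Longrightarrow> p - q \<in> rels"
    and rels_scl: "p \<in> rels \<Longrightarrow> Poly_Mapping.map ((*) c) p \<in> rels"
  using rels_subspace P.subspace_mns[OF rels_subspace, of p q]
  by (auto simp: subspace_def pair_algebra_simps mns_def map_mult_uminus_1)

lemma rels_sum: "(\<And>i. i \<in> I \<Longrightarrow> g i \<in> rels) \<Longrightarrow> sum g I \<in> rels"
  by (induction I rule: infinite_finite_induct) (auto simp: rels_0 rels_add)

lemma rels_ev: "p \<in> rels \<Longrightarrow> ev p = 0"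
proof -
  have "subspace PA {p \<in> carr PA. ev p = zer C}"
    using P.kernel_ideal[OF ev_hom C.f_algebra_axioms] by (simp add: ideal_def)
  moreover have "bilinear_rels A B \<subseteq> {p \<in> carr PA. ev p = zer C}"
  proof
    fix p assume p: "p \<in> bilinear_rels A B"
    have "ev p = 0"
      using p unfolding bilinear_rels_def Let_def
      by (auto simp: ev_diff ev_single A.pls_closed B.pls_closed A.scl_closed B.scl_closed
          \<beta>_add_left \<beta>_add_right \<beta>_scl_left \<beta>_scl_right C.one_scl \<beta>_closed C.scl_closed
          C.pls_closed[unfolded pls_C])
    then show "p \<in> {p \<in> carr PA. ev p = zer C}" using p rels_closed by (auto simp: zer_C)
  qed
  ultimately have "rels \<subseteq> {p \<in> carr PA. ev p = zer C}" by (rule lspan_minimal)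
  then show "p \<in> rels \<Longrightarrow> ev p = 0" by (auto simp: zer_C)
qed

lemma zer_term: "y \<in> carr B \<Longrightarrow> Poly_Mapping.single (\<zero>\<^bsub>A\<^esub>, y) 1 \<in> rels"
  using rels_base(3)[OF A.zer_closed A.zer_closed _ _, of y y 0] lspan_base[of "bilinear_rels A B" PA]
  by (auto simp: A.scl_zer)

definition nf :: "nat \<Rightarrow> (nat \<Rightarrow> 'v) \<Rightarrow> ('v \<times> 'w) \<Rightarrow>\<^sub>0 'f" where
  "nf N x = (\<Sum>n\<le>N. Poly_Mapping.single (x n, b n) 1)"

text \<open>The elements congruent to a normal form. One family \<open>x\<close> has to work for all
  large \<open>N\<close>, so that two elements can be added at a common length.\<close>

definition E :: "(('v \<times> 'w) \<Rightarrow>\<^sub>0 'f) set" where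
  "E = {p. \<exists>x N0. (\<forall>n. x n \<in> carr A) \<and> (\<forall>N\<ge>N0. p - nf N x \<in> rels)}"

lemma E_add: "p \<in> E \<Longrightarrow> q \<in> E \<Longrightarrow> p + q \<in> E"
proof -
  assume "p \<in> E" "q \<in> E"
  then obtain x y K L where xy: "\<forall>n. x n \<in> carr A" "\<forall>N\<ge>K. p - nf N x \<in> rels"
    "\<forall>n. y n \<in> carr A" "\<forall>N\<ge>L. q - nf N y \<in> rels" unfolding E_def by blast
  have "p + q - nf N (\<lambda>n. x n \<oplus>\<^bsub>A\<^esub> y n) \<in> rels" if N: "N \<ge> max K L" for N
  proof -
    have "nf N (\<lambda>n. x n \<oplus>\<^bsub>A\<^esub> y n) - nf N x - nf N y \<in> rels"
      unfolding nf_def sum_subtractf[symmetric]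
      by (intro rels_sum subsetD[OF lspan_base] rels_base(1)[OF _ _ b_closed b_closed] xy(1,3)[rule_format])
    moreover have "(p - nf N x) + (q - nf N y) \<in> rels" using xy N by (intro rels_add) auto
    ultimately have "(p - nf N x) + (q - nf N y) - (nf N (\<lambda>n. x n \<oplus>\<^bsub>A\<^esub> y n) - nf N x - nf N y) \<in> rels"
      by (rule rels_diff[rotated])
    then show ?thesis by (simp add: algebra_simps)
  qed
  then show "p + q \<in> E" unfolding E_def using xy A.pls_closed
    by (intro CollectI exI[of _ "\<lambda>n. x n \<oplus>\<^bsub>A\<^esub> y n"] exI[of _ "max K L"]) auto
qed

lemma E_rels: "p - q \<in> rels \<Longrightarrow> q \<in> E \<Longrightarrow> p \<in> E"
proof -
  assume pq: "p - q \<in> rels" and "q \<in> E"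
  then obtain x K where x: "\<forall>n. x n \<in> carr A" "\<forall>N\<ge>K. q - nf N x \<in> rels" unfolding E_def by blast
  have "p - nf N x \<in> rels" if "N \<ge> K" for N
    using rels_add[OF pq x(2)[rule_format, OF that]] by (simp add: algebra_simps)
  then show "p \<in> E" unfolding E_def using x(1) by blast
qed

lemma rels_in_E: "p \<in> rels \<Longrightarrow> p \<in> E"
proof -
  assume "p \<in> rels"
  then have "p - nf N (\<lambda>_. \<zero>\<^bsub>A\<^esub>) \<in> rels" for N
    unfolding nf_def by (intro rels_diff rels_sum zer_term b_closed)
  then show "p \<in> E" unfolding E_def using A.zer_closed
    by (intro CollectI exI[of _ "\<lambda>_. \<zero>\<^bsub>A\<^esub>"]) auto
qed

lemma E_basis: "x \<in> carr A \<Longrightarrow> Poly_Mapping.single (x, b n) 1 \<in> E"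
proof -
  assume x: "x \<in> carr A"
  let ?x = "\<lambda>k. if k = n then x else \<zero>\<^bsub>A\<^esub>"
  have "Poly_Mapping.single (x, b n) 1 - nf N ?x \<in> rels" if N: "N \<ge> n" for N
  proof -
    have "nf N ?x = Poly_Mapping.single (x, b n) 1 + (\<Sum>k\<in>{..N} - {n}. Poly_Mapping.single (?x k, b k) 1)"
      unfolding nf_def using N by (subst sum.remove[of _ n]) auto
    then have "Poly_Mapping.single (x, b n) 1 - nf N ?x
        = 0 - (\<Sum>k\<in>{..N} - {n}. Poly_Mapping.single (?x k, b k) 1)" by simp
    also have "\<dots> \<in> rels" by (intro rels_diff rels_0 rels_sum) (auto intro: zer_term b_closed)
    finally show ?thesis .
  qed
  then show ?thesis unfolding E_def using x A.zer_closed
    by (intro CollectI exI[of _ ?x] exI[of _ n]) auto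
qed

lemma E_single_1: "x \<in> carr A \<Longrightarrow> y \<in> carr B \<Longrightarrow> Poly_Mapping.single (x, y) 1 \<in> E"
proof -
  assume x: "x \<in> carr A" and y: "y \<in> carr B"
  note base = subsetD[OF lspan_base[of "bilinear_rels A B" PA]]
  have "carr B \<subseteq> {y \<in> carr B. Poly_Mapping.single (x, y) 1 \<in> E}"
  proof (rule b_span)
    fix n c
    \<comment> \<open>The difference of two relations moves the scalar from the right factor to the
      left one, where a normal form can absorb it.\<close>
    have "Poly_Mapping.single (x, c \<odot>\<^bsub>B\<^esub> b n) 1 - Poly_Mapping.single (x, b n) c
      - (Poly_Mapping.single (c \<odot>\<^bsub>A\<^esub> x, b n) 1 - Poly_Mapping.single (x, b n) c) \<in> rels"
      using base[OF rels_base(4)[OF x x b_closed b_closed]] base[OF rels_base(3)[OF x x b_closed b_closed]]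
      by (rule rels_diff)
    then have "Poly_Mapping.single (x, c \<odot>\<^bsub>B\<^esub> b n) 1 - Poly_Mapping.single (c \<odot>\<^bsub>A\<^esub> x, b n) 1 \<in> rels"
      by simp
    then show "c \<odot>\<^bsub>B\<^esub> b n \<in> {y \<in> carr B. Poly_Mapping.single (x, y) 1 \<in> E}"
      using E_rels E_basis A.scl_closed x B.scl_closed b_closed by blast
  next
    have "Poly_Mapping.single (x, 0 \<odot>\<^bsub>B\<^esub> \<zero>\<^bsub>B\<^esub>) 1 - Poly_Mapping.single (x, \<zero>\<^bsub>B\<^esub>) 0 \<in> rels"
      using base[OF rels_base(4)[OF x x B.zer_closed B.zer_closed]] .
    then show "\<zero>\<^bsub>B\<^esub> \<in> {y \<in> carr B. Poly_Mapping.single (x, y) 1 \<in> E}"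
      using B.zer_closed rels_in_E by (simp add: B.scl_zer)
  next
    fix y y' assume y: "y \<in> {y \<in> carr B. Poly_Mapping.single (x, y) 1 \<in> E}"
      "y' \<in> {y \<in> carr B. Poly_Mapping.single (x, y) 1 \<in> E}"
    then have "Poly_Mapping.single (x, y) 1 + Poly_Mapping.single (x, y') 1 \<in> E" by (auto intro: E_add)
    moreover have "Poly_Mapping.single (x, y \<oplus>\<^bsub>B\<^esub> y') 1
        - (Poly_Mapping.single (x, y) 1 + Poly_Mapping.single (x, y') 1) \<in> rels"
      using base[OF rels_base(2)[OF x x, of y y']] y by (simp add: diff_diff_eq)
    ultimately show "y \<oplus>\<^bsub>B\<^esub> y' \<in> {y \<in> carr B. Poly_Mapping.single (x, y) 1 \<in> E}"
      using E_rels B.pls_closed y by blast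
  qed
  then show ?thesis using y by blast
qed

lemma E_single: "x \<in> carr A \<Longrightarrow> y \<in> carr B \<Longrightarrow> Poly_Mapping.single (x, y) c \<in> E"
proof -
  assume x: "x \<in> carr A" and y: "y \<in> carr B"
  have "Poly_Mapping.single (c \<odot>\<^bsub>A\<^esub> x, y) 1 - Poly_Mapping.single (x, y) c \<in> rels"
    using rels_base(3)[OF x x y y] by (rule subsetD[OF lspan_base])
  then have "0 - (Poly_Mapping.single (c \<odot>\<^bsub>A\<^esub> x, y) 1 - Poly_Mapping.single (x, y) c) \<in> rels"
    by (rule rels_diff[OF rels_0])
  then have "Poly_Mapping.single (x, y) c - Poly_Mapping.single (c \<odot>\<^bsub>A\<^esub> x, y) 1 \<in> rels" by simp
  then show ?thesis using E_single_1[OF A.scl_closed[OF x] y] by (rule E_rels)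
qed

lemma carr_subset_E: "carr PA \<subseteq> E"
proof
  fix p assume p: "p \<in> carr PA"
  have "sum (\<lambda>k. Poly_Mapping.single k (Poly_Mapping.lookup p k)) K \<in> E"
    if "finite K" "K \<subseteq> carr A \<times> carr B" for K
    using that
  proof (induction K rule: finite_induct)
    case empty
    then show ?case using rels_in_E[OF rels_0] by simp
  next
    case (insert k K)
    then show ?case by (cases k) (auto intro: E_add E_single)
  qed
  then have "pm_sum Poly_Mapping.single p \<in> E"
    unfolding pm_sum_def using p by (simp add: pair_algebra_simps)
  then show "p \<in> E" by (simp add: pm_sum_expand)
qed

text \<open>Modulo the relations an element is a normal form. If its value is zero, independence
  makes the coefficients zero, and the normal form is itself a sum of relations.\<close>

lemma kernel_ev: "rels = {p \<in> carr PA. ev p = zer C}"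
proof (intro set_eqI iffI)
  fix p assume "p \<in> rels"
  then show "p \<in> {p \<in> carr PA. ev p = zer C}"
    using rels_ev rels_subspace by (auto simp: zer_C subspace_def)
next
  fix p assume "p \<in> {p \<in> carr PA. ev p = zer C}"
  then have p: "p \<in> E" "ev p = 0" using carr_subset_E by (auto simp: zer_C)
  then obtain x N where x: "\<forall>n. x n \<in> carr A" "p - nf N x \<in> rels" unfolding E_def by blast
  have "ev (nf N x) = 0" using rels_ev[OF x(2)] p(2) by (simp add: ev_diff)
  then have "(\<Sum>n\<le>N. \<beta> (x n) (b n)) = 0"
    using x(1) by (simp add: nf_def additive_sum[of ev, OF ev_0 ev_add] b_term)
  then have "\<forall>n\<le>N. x n = \<zero>\<^bsub>A\<^esub>" using \<beta>_indep x(1) by blast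
  then have "nf N x \<in> rels" unfolding nf_def by (intro rels_sum) (simp add: zer_term b_closed)
  from rels_add[OF x(2) this] show "p \<in> rels" by simp
qed

lemma tensor_iso: "isomorphic (tensor A B) C" and tensor_f_algebra: "f_algebra (tensor A B)"
proof -
  show "isomorphic (tensor A B) C"
    unfolding tensor_def isomorphic_def
    using P.quot_kernel_alg_iso[OF ev_hom ev_surj kernel_ev] by metis
  have "ideal PA rels" unfolding kernel_ev by (rule P.kernel_ideal[OF ev_hom C.f_algebra_axioms])
  then show "f_algebra (tensor A B)" unfolding tensor_def by (rule P.quot_f_algebra)
qed

end

section \<open>The Witt algebra and its extensions\<close>

lemma R_alg_simps:
  "carr R_alg = UNIV" "zer R_alg = 0" "pls R_alg = (+)" "scl R_alg = smult" "mlt R_alg = (*)"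
  "mns R_alg = (-)"
  by (simp_all add: R_alg_def mns_def fun_eq_iff)

lemma R_alg_f_algebra: "f_algebra (R_alg :: ('f::field, 'f poly) alg)"
  by unfold_locales
    (simp_all add: R_alg_simps smult_add_left smult_add_right algebra_simps)

lemma ideal_multiples: "ideal R_alg (range (\<lambda>r. r * u))"
  unfolding ideal_def subspace_def R_alg_simps
proof (intro conjI ballI allI)
  show "0 \<in> range (\<lambda>r. r * u)" by (metis mult_zero_left rangeI)
  fix c a b assume "a \<in> range (\<lambda>r. r * u)"
  then obtain r where r: "a = r * u" by blast
  show "smult c a \<in> range (\<lambda>r. r * u)" unfolding r by (metis mult_smult_left rangeI)
  show "b * a \<in> range (\<lambda>r. r * u)" unfolding r by (metis mult.assoc rangeI)
  then show "a * b \<in> range (\<lambda>r. r * u)" by (simp add: mult.commute)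
  assume "b \<in> range (\<lambda>r. r * u)"
  then obtain s where "b = s * u" by blast
  then show "a + b \<in> range (\<lambda>r. r * u)" unfolding r by (metis distrib_right rangeI)
qed simp

definition rcls :: "'f::field poly \<Rightarrow> 'f poly \<Rightarrow> 'f poly set" where
  "rcls u = coset R_alg (range (\<lambda>r. r * u))"

lemma rcls_hom: "alg_hom (rcls u) R_alg (R_mod u)"
  unfolding rcls_def R_mod_def by (rule f_algebra.coset_hom[OF R_alg_f_algebra ideal_multiples])

lemma carr_R_mod: "carr (R_mod u) = range (rcls u)"
  by (simp add: R_mod_def quot_def rcls_def R_alg_simps)

lemma R_mod_f_algebra: "f_algebra (R_mod u)"
  unfolding R_mod_def by (rule f_algebra.quot_f_algebra[OF R_alg_f_algebra ideal_multiples])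

lemma rcls_zer_iff: "rcls u r = zer (R_mod u) \<longleftrightarrow> u dvd r"
proof -
  have "rcls u r = zer (R_mod u) \<longleftrightarrow> r \<in> range (\<lambda>r. r * u)"
    unfolding rcls_def R_mod_def
    by (rule f_algebra.coset_eq_zer_iff[OF R_alg_f_algebra ideal_multiples]) (simp add: R_alg_simps)
  also have "\<dots> \<longleftrightarrow> u dvd r" by (auto simp: dvd_def mult.commute)
  finally show ?thesis .
qed

lemma rcls_eq_iff: "rcls u r = rcls u s \<longleftrightarrow> u dvd r - s"
proof -
  have "rcls u r = rcls u s \<longleftrightarrow> r - s \<in> range (\<lambda>r. r * u)"
    using f_algebra.coset_eq_iff[OF R_alg_f_algebra ideal_multiples, of r s u]
    by (simp add: rcls_def R_alg_simps)
  also have "\<dots> \<longleftrightarrow> u dvd r - s" by (auto simp: dvd_def mult.commute)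
  finally show ?thesis .
qed

lemmas rcls_homD = alg_homD[OF rcls_hom, unfolded R_alg_simps, simplified]

lemma R_mod_field_algebra:
  assumes u: "prime_elem u"
  shows "field_algebra (R_mod u)"
proof -
  interpret f_algebra "R_mod u" by (rule R_mod_f_algebra)
  note h = rcls_homD(3)[symmetric]
  have mlt: "mlt (R_mod u) (rcls u a) (rcls u b) = rcls u (a * b)" for a b
    by (rule rcls_homD(4)[symmetric])
  show ?thesis
  proof
    show "\<exists>e\<in>carr (R_mod u). e \<noteq> zer (R_mod u) \<and> (\<forall>a\<in>carr (R_mod u). mlt (R_mod u) e a = a)
      \<and> (\<forall>a\<in>carr (R_mod u). a \<noteq> zer (R_mod u) \<longrightarrow> (\<exists>b\<in>carr (R_mod u). mlt (R_mod u) a b = e))"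
    proof (rule bexI[of _ "rcls u 1"], intro conjI ballI impI)
      show "rcls u 1 \<noteq> zer (R_mod u)" using u prime_elem_not_unit by (simp add: rcls_zer_iff)
      show "mlt (R_mod u) (rcls u 1) a = a" if "a \<in> carr (R_mod u)" for a
        using that by (auto simp: carr_R_mod mlt)
      show "\<exists>b\<in>carr (R_mod u). mlt (R_mod u) a b = rcls u 1"
        if a: "a \<in> carr (R_mod u)" "a \<noteq> zer (R_mod u)" for a
      proof -
        obtain r where r: "a = rcls u r" using a by (auto simp: carr_R_mod)
        then have "\<not> u dvd r" using a by (simp add: rcls_zer_iff)
        then obtain x y where xy: "x * u + y * r = 1" using prime_bezout[OF u] by blast
        then have "r * y - 1 = u * (- x)" by (simp add: algebra_simps)
        then have "mlt (R_mod u) a (rcls u y) = rcls u 1" by (simp add: r mlt rcls_eq_iff)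
        then show ?thesis by (auto simp: carr_R_mod)
      qed
    qed (simp add: carr_R_mod)
  qed (auto simp: carr_R_mod mlt mult_ac)
qed

section \<open>Vector fields on the line; \<open>wbr\<close> is the bracket of f d/dt and g
  d/dt\<close>

definition wbr :: "'a::idom poly \<Rightarrow> 'a poly \<Rightarrow> 'a poly" where
  "wbr f g = f * pderiv g - g * pderiv f"

definition vf_alg :: "('f::field, 'f poly) alg" where
  "vf_alg = \<lparr>carr = UNIV, zer = 0, pls = (+), scl = smult, mlt = wbr\<rparr>"

definition wd :: "'f::field poly \<Rightarrow> 'f poly \<Rightarrow> 'f poly" where
  "wd a = (\<lambda>p. a * pderiv p)"

lemma Witt_simps:
  "carr Witt = {d. (\<forall>a b. d (a + b) = d a + d b) \<and> (\<forall>c a. d (smult c a) = smult c (d a))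
      \<and> (\<forall>a b. d (a * b) = d a * b + a * d b)}"
  "zer Witt = (\<lambda>_. 0)" "pls Witt = (\<lambda>d e p. d p + e p)" "scl Witt = (\<lambda>c d p. smult c (d p))"
  "mlt Witt = (\<lambda>d e p. d (e p) - e (d p))"
  by (simp_all add: Witt_def Der_def R_alg_simps restrict_def fun_eq_iff)

lemma wd_t: "wd a [:0, 1:] = a"
  by (simp add: wd_def pderiv_pCons)

text \<open>A derivation annihilates the constants and is determined by its value at t.\<close>

lemma carr_Witt: "carr Witt = range wd"
proof (intro set_eqI iffI)
  fix d :: "'a poly \<Rightarrow> 'a poly" assume "d \<in> range wd"
  then show "d \<in> carr Witt"
    by (auto simp: Witt_simps wd_def pderiv_add pderiv_mult pderiv_smult algebra_simps)
next
  fix d :: "'a poly \<Rightarrow> 'a poly" assume "d \<in> carr Witt"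
  then have d: "d (a + b) = d a + d b" "d (smult c a) = smult c (d a)" "d (a * b) = d a * b + a * d b"
    for a b c by (simp_all add: Witt_simps)
  have "d 1 = 0" using d(3)[of 1 1] by (metis add_cancel_right_right mult_1 mult_1_right)
  have "d p = wd (d [:0, 1:]) p" for p
  proof (induction p)
    case 0
    then show ?case using d(2)[of 0 0] by (simp add: wd_def)
  next
    case (pCons c p)
    have "pCons c p = smult c 1 + [:0, 1:] * p" by simp
    then have "d (pCons c p) = d (smult c 1) + d ([:0, 1:] * p)" by (simp only: d(1))
    then have "d (pCons c p) = d [:0, 1:] * p + [:0, 1:] * d p"
      by (simp only: d(2,3) \<open>d 1 = 0\<close> smult_0_right add_0)
    then show ?case using pCons(2) by (simp add: wd_def pderiv_pCons algebra_simps)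
  qed
  then show "d \<in> range wd" by blast
qed

lemma vf_f_algebra: "f_algebra vf_alg"
  by unfold_locales
    (simp_all add: vf_alg_def mns_def wbr_def smult_add_left smult_add_right pderiv_add pderiv_smult
      smult_diff_right algebra_simps)

lemma wd_hom: "alg_hom wd vf_alg Witt"
  unfolding alg_hom_def carr_Witt
  by (auto simp: vf_alg_def Witt_simps(2-) wd_def wbr_def fun_eq_iff pderiv_mult algebra_simps)

lemma Witt_f_algebra: "f_algebra Witt"
  using f_algebra_image[OF vf_f_algebra wd_hom] by (simp add: carr_Witt vf_alg_def)

lemma Witt_span:
  assumes "\<And>n c. c \<odot>\<^bsub>Witt\<^esub> wd (monom 1 n) \<in> S" "zer Witt \<in> S"
    "\<And>y y'. \<lbrakk>y \<in> S; y \<in> carr Witt; y' \<in> S; y' \<in> carr Witt\<rbrakk> \<Longrightarrow> y \<oplus>\<^bsub>Witt\<^esub> y' \<in> S"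
  shows "carr Witt \<subseteq> S"
proof -
  note h = alg_homD[OF wd_hom, unfolded vf_alg_def, simplified]
  have "wd a \<in> S" for a
  proof (rule monom_sum_induct[of "\<lambda>a. wd a \<in> S"])
    show "wd 0 \<in> S" unfolding h(2) by (rule assms(2))
    show "wd (monom (coeff a n) n) \<in> S" for n
      using assms(1)[of "coeff a n" n] by (simp add: h(5)[symmetric] smult_monom)
    show "wd (x + y) \<in> S" if "wd x \<in> S" "wd y \<in> S" for x y
      using assms(3)[of "wd x" "wd y"] that by (simp add: h(1,3))
  qed
  then show ?thesis by (auto simp: carr_Witt)
qed

lemma carr_Witt_lspan: "carr (Witt :: ('f::field, _) alg) = lspan Witt (witt_w ` {-1..})"
proof -
  interpret f_algebra "Witt :: ('f, _) alg" by (rule Witt_f_algebra)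
  have w: "wd (monom 1 n) = witt_w (int n - 1)" for n
    by (simp add: wd_def witt_w_def)
  have sub: "witt_w ` {-1..} \<subseteq> carr (Witt :: ('f, _) alg)"
    by (auto simp: carr_Witt witt_w_def wd_def)
  note ss = lspan_subspace[OF sub]
  have "c \<odot>\<^bsub>Witt\<^esub> wd (monom 1 n) \<in> lspan Witt (witt_w ` {-1..})" for n and c :: 'f
  proof -
    have "(witt_w (int n - 1) :: 'f poly \<Rightarrow> _) \<in> witt_w ` {-1..}" by simp
    then have "wd (monom 1 n) \<in> lspan Witt (witt_w ` {-1..} :: ('f poly \<Rightarrow> _) set)"
      unfolding w by (rule subsetD[OF lspan_base])
    then show ?thesis using ss by (simp add: subspace_def)
  qed
  then have "carr Witt \<subseteq> lspan Witt (witt_w ` {-1..} :: ('f poly \<Rightarrow> _) set)"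
    by (rule Witt_span) (use ss in \<open>auto simp: subspace_def\<close>)
  moreover have "lspan Witt (witt_w ` {-1..}) \<subseteq> carr (Witt :: ('f, _) alg)"
    using ss by (simp add: subspace_def)
  ultimately show ?thesis by (rule equalityI)
qed

text \<open>Vector fields with coefficients in R[t]. Each tensor product of R / R u with the Witt
  algebra is a quotient of this algebra.\<close>

definition xvf_alg :: "('f::field, 'f poly poly) alg" where
  "xvf_alg = \<lparr>carr = UNIV, zer = 0, pls = (+), scl = (\<lambda>c. smult [:c:]), mlt = wbr\<rparr>"

text \<open>Reduced coefficients are canonical representatives. They give the quotient by
  \<open>u\<close> a carrier inside \<open>'f poly poly\<close>, as \<open>tensor_model\<close>
  demands the addition of the type itself.\<close>

definition red :: "'f::field poly \<Rightarrow> 'f poly poly \<Rightarrow> 'f poly poly" where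
  "red u = map_poly (\<lambda>r. r mod u)"

definition red_alg :: "'f::field poly \<Rightarrow> ('f, 'f poly poly) alg" where
  "red_alg u = \<lparr>carr = range (red u), zer = 0, pls = (+), scl = (\<lambda>c. smult [:c:]),
     mlt = (\<lambda>f g. red u (wbr f g))\<rparr>"

lemma coeff_red [simp]: "coeff (red u f) n = coeff f n mod u"
  by (simp add: red_def coeff_map_poly)

lemma xvf_f_algebra: "f_algebra xvf_alg"
  by unfold_locales
    (simp_all add: xvf_alg_def mns_def wbr_def smult_add_right pderiv_add pderiv_smult
      smult_diff_right smult_const_add smult_const_uminus smult_const_1 algebra_simps)

lemma red_eq_iff: "red u f = red u g \<longleftrightarrow> [:u:] dvd f - g"
proof -
  have "red u f = red u g \<longleftrightarrow> (\<forall>n. coeff f n mod u = coeff g n mod u)"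
    by (metis coeff_red poly_eqI)
  then show ?thesis by (simp add: const_dvd_iff mod_eq_dvd_iff)
qed

lemma red_red [simp]: "red u (red u f) = red u f"
  by (rule poly_eqI) simp

lemma red_zero: "red u 0 = 0"
  by (simp add: red_def)

lemma red_add: "red u (f + g) = red u f + red u g"
  by (rule poly_eqI) (simp add: poly_mod_add_left)

lemma red_smult: "red u (smult [:c:] f) = smult [:c:] (red u f)"
  by (rule poly_eqI) (simp add: mod_smult_left)

lemma wbr_cong:
  assumes "[:u:] dvd f - f'" "[:u:] dvd g - g'"
  shows "[:u:] dvd wbr f g - wbr f' g'"
proof -
  obtain a where a: "f = f' + [:u:] * a" using assms(1) by (metis add.commute diff_add_cancel dvdE)
  obtain b where b: "g = g' + [:u:] * b" using assms(2) by (metis add.commute diff_add_cancel dvdE)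
  have "wbr f g - wbr f' g' = [:u:] * (a * pderiv g + f' * pderiv b - b * pderiv f - g' * pderiv a)"
    unfolding wbr_def a b by (simp add: pderiv_add pderiv_smult algebra_simps smult_add_right smult_diff_right)
  then show ?thesis by (simp add: const_dvd_iff)
qed

lemma red_hom: "alg_hom (red u) xvf_alg (red_alg u)"
proof -
  have "red u (wbr f g) = red u (wbr (red u f) (red u g))" for f g
    unfolding red_eq_iff by (rule wbr_cong) (simp_all flip: red_eq_iff)
  then show ?thesis
    by (auto simp: alg_hom_def xvf_alg_def red_alg_def red_add red_smult red_zero)
qed

lemma red_surj: "red u ` carr xvf_alg = carr (red_alg u)"
  by (simp add: xvf_alg_def red_alg_def)

lemma red_zer_iff: "red u f = zer (red_alg u) \<longleftrightarrow> [:u:] dvd f"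
  using red_eq_iff[of u f 0] by (simp add: red_alg_def) (simp add: red_def)

lemma red_alg_f_algebra: "f_algebra (red_alg u)"
  using f_algebra_image[OF xvf_f_algebra red_hom red_surj] .

definition emb :: "'f::field poly \<Rightarrow> 'f poly poly" where
  "emb = map_poly (\<lambda>c. [:c:])"

lemma coeff_emb [simp]: "coeff (emb a) n = [:coeff a n:]"
  by (simp add: emb_def coeff_map_poly)

lemma emb_add: "emb (a + b) = emb a + emb b"
  by (rule poly_eqI) simp

lemma emb_diff: "emb (a - b) = emb a - emb b"
  by (rule poly_eqI) simp

lemma emb_smult: "emb (smult c a) = smult [:c:] (emb a)"
  by (rule poly_eqI) (simp add: mult.commute)

lemma emb_pCons: "emb (pCons c a) = pCons [:c:] (emb a)"
  by (rule poly_eqI) (simp add: coeff_pCons split: nat.split)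

lemma emb_0 [simp]: "emb 0 = 0"
  by (rule poly_eqI) simp

lemma emb_mult: "emb (a * b) = emb a * emb b"
  by (induction a) (simp_all add: emb_pCons emb_add emb_smult mult_pCons_left)

lemma emb_pderiv: "emb (pderiv a) = pderiv (emb a)"
  by (induction a) (simp_all add: emb_pCons pderiv_pCons emb_add)

lemma emb_monom_1: "emb (monom 1 n) = monom 1 n"
  by (rule poly_eqI) (simp add: one_pCons)

lemma wbr_smult_emb: "wbr (smult r (emb a)) (smult s (emb b)) = smult (r * s) (emb (wbr a b))"
  by (simp add: wbr_def emb_diff emb_mult emb_pderiv pderiv_smult smult_diff_right mult.commute)

lemma red_smult_emb: "red u (smult r (emb a)) = smult (r mod u) (emb a)"
  by (rule poly_eqI) (simp add: mod_smult_left)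

text \<open>The final reduction makes the value independent of the representative that is
  chosen.\<close>

definition rep :: "'f::field poly \<Rightarrow> 'f poly set \<Rightarrow> 'f poly" where
  "rep u C = (SOME r. C = rcls u r) mod u"

lemma rep_rcls: "rep u (rcls u r) = r mod u"
proof -
  have "rcls u r = rcls u (SOME s. rcls u r = rcls u s)" by (rule someI[of _ r]) (rule refl)
  from this[symmetric] show ?thesis by (simp only: rep_def rcls_eq_iff mod_eq_dvd_iff)
qed

text \<open>The value \<open>d [:0, 1:]\<close> recovers the coefficient a of a derivation a d/dt.
  Uniqueness of the expansion along the basis t^n d/dt is comparison of the coefficients of t^n,
  which are the reduced representatives.\<close>

lemma Witt_tensor_model:
  "tensor_model (R_mod u) Witt (red_alg u) (\<lambda>x d. smult (rep u x) (emb (d [:0, 1:]))) (\<lambda>n. wd (monom 1 n))"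
proof -
  note hr = rcls_homD(3-)[symmetric]
    and hw = alg_homD(3-)[OF wd_hom, unfolded vf_alg_def, simplified, symmetric]
  have closed: "smult (r mod u) (emb a) \<in> range (red u)" for r a
    by (metis red_smult_emb rangeI)
  show ?thesis
  proof (unfold tensor_model_def tensor_model_axioms_def, intro conjI allI impI)
    show "f_algebra (R_mod u)" "f_algebra Witt" "f_algebra (red_alg u)"
      by (rule R_mod_f_algebra Witt_f_algebra red_alg_f_algebra)+
    show "zer (red_alg u) = 0" "pls (red_alg u) = (+)" by (simp_all add: red_alg_def)
    show "scl (red_alg u) (c + d) x = scl (red_alg u) c x + scl (red_alg u) d x" for c d x
      by (simp add: red_alg_def smult_const_add)
    show "smult (rep u x) (emb (y [:0, 1:])) \<in> carr (red_alg u)"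
      if "x \<in> carr (R_mod u)" "y \<in> carr Witt" for x y
      using that closed by (auto simp: carr_R_mod rep_rcls red_alg_def)
    show "smult (rep u (x \<oplus>\<^bsub>R_mod u\<^esub> x')) (emb (y [:0, 1:]))
      = smult (rep u x) (emb (y [:0, 1:])) + smult (rep u x') (emb (y [:0, 1:]))"
      if "x \<in> carr (R_mod u)" "x' \<in> carr (R_mod u)" "y \<in> carr Witt" for x x' y
      using that by (auto simp: carr_R_mod hr rep_rcls poly_mod_add_left smult_add_left)
    show "smult (rep u x) (emb ((y \<oplus>\<^bsub>Witt\<^esub> y') [:0, 1:]))
      = smult (rep u x) (emb (y [:0, 1:])) + smult (rep u x) (emb (y' [:0, 1:]))"
      if "x \<in> carr (R_mod u)" "y \<in> carr Witt" "y' \<in> carr Witt" for x y y'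
      by (simp add: Witt_simps emb_add smult_add_right)
    show "smult (rep u (c \<odot>\<^bsub>R_mod u\<^esub> x)) (emb (y [:0, 1:])) = c \<odot>\<^bsub>red_alg u\<^esub> smult (rep u x) (emb (y [:0, 1:]))"
      if "x \<in> carr (R_mod u)" "y \<in> carr Witt" for x y c
      using that by (auto simp: carr_R_mod hr rep_rcls red_alg_def mod_smult_left)
    show "smult (rep u x) (emb ((c \<odot>\<^bsub>Witt\<^esub> y) [:0, 1:])) = c \<odot>\<^bsub>red_alg u\<^esub> smult (rep u x) (emb (y [:0, 1:]))"
      if "x \<in> carr (R_mod u)" "y \<in> carr Witt" for x y c
      by (simp add: Witt_simps emb_smult red_alg_def mult.commute)
    show "smult (rep u (x \<star>\<^bsub>R_mod u\<^esub> x')) (emb ((y \<star>\<^bsub>Witt\<^esub> y') [:0, 1:]))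
      = smult (rep u x) (emb (y [:0, 1:])) \<star>\<^bsub>red_alg u\<^esub> smult (rep u x') (emb (y' [:0, 1:]))"
      if xy: "x \<in> carr (R_mod u)" "x' \<in> carr (R_mod u)" "y \<in> carr Witt" "y' \<in> carr Witt" for x x' y y'
    proof -
      obtain r r' a a' where e: "x = rcls u r" "x' = rcls u r'" "y = wd a" "y' = wd a'"
        using xy by (auto simp: carr_R_mod carr_Witt)
      show ?thesis
        unfolding e hr hw rep_rcls wd_t
        by (simp add: red_alg_def wbr_smult_emb red_smult_emb mod_mult_eq)
    qed
    show "wd (monom 1 n) \<in> carr Witt" for n by (simp add: carr_Witt)
    show "carr Witt \<subseteq> S"
      if "\<forall>n c. c \<odot>\<^bsub>Witt\<^esub> wd (monom 1 n) \<in> S" "zer Witt \<in> S"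
        "\<forall>y y'. y \<in> S \<longrightarrow> y \<in> carr Witt \<longrightarrow> y' \<in> S \<longrightarrow> y' \<in> carr Witt \<longrightarrow> y \<oplus>\<^bsub>Witt\<^esub> y' \<in> S"
      for S :: "('a poly \<Rightarrow> 'a poly) set"
      using that by (intro Witt_span) auto
    have summand: "smult (rep u x) (emb (wd (monom 1 n) [:0, 1:])) = monom (rep u x) n" for x n
      unfolding wd_t emb_monom_1 by (simp add: smult_monom)
    show "x n = zer (R_mod u)"
      if x: "\<forall>n. x n \<in> carr (R_mod u)" and n: "n \<le> N"
        and sum: "(\<Sum>n\<le>N. smult (rep u (x n)) (emb (wd (monom 1 n) [:0, 1:]))) = 0" for N x n
    proof -
      have "coeff (\<Sum>n\<le>N. monom (rep u (x n)) n) n = 0" using sum by (simp only: summand coeff_0)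
      then have "rep u (x n) = 0" using n by (simp add: coeff_sum)
      moreover obtain r where "x n = rcls u r" using x by (metis carr_R_mod imageE)
      ultimately show ?thesis by (simp add: rep_rcls rcls_zer_iff mod_eq_0_iff_dvd)
    qed
    show "\<exists>N x. (\<forall>n. x n \<in> carr (R_mod u)) \<and> z = (\<Sum>n\<le>N. smult (rep u (x n)) (emb (wd (monom 1 n) [:0, 1:])))"
      if "z \<in> carr (red_alg u)" for z
    proof (intro exI conjI allI)
      show "rcls u (coeff z n) \<in> carr (R_mod u)" for n by (simp add: carr_R_mod)
      have "z \<in> range (red u)" using that by (simp add: red_alg_def)
      then obtain f where "z = red u f" by blast
      then have "rep u (rcls u (coeff z n)) = coeff z n" for n by (simp add: rep_rcls)
      then show "z = (\<Sum>n\<le>degree z. smult (rep u (rcls u (coeff z n))) (emb (wd (monom 1 n) [:0, 1:])))"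
        unfolding summand by (simp add: poly_as_sum_of_monoms)
    qed
  qed
qed

lemma alg_iso_hom:
  assumes "f_algebra A" "f_algebra B" "alg_iso f A B"
  shows "alg_hom f A B" "f ` carr A = carr B" "a \<in> carr A \<Longrightarrow> f a = zer B \<longleftrightarrow> a = zer A"
proof -
  interpret A: f_algebra A by fact
  interpret B: f_algebra B by fact
  show surj: "f ` carr A = carr B" using assms(3) by (simp add: alg_iso_def bij_betw_def)
  then have c: "a \<in> carr A \<Longrightarrow> f a \<in> carr B" for a by blast
  have "f (0 \<odot>\<^bsub>A\<^esub> zer A) = 0 \<odot>\<^bsub>B\<^esub> f (zer A)" using assms(3) A.zer_closed by (simp add: alg_iso_def)
  then have z: "f (zer A) = zer B" by (simp add: A.scl_zer B.zero_scl c A.zer_closed)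
  then show "alg_hom f A B" using assms(3) surj by (simp add: alg_iso_def alg_hom_def)
  have "inj_on f (carr A)" using assms(3) by (simp add: alg_iso_def bij_betw_def)
  then show "a \<in> carr A \<Longrightarrow> f a = zer B \<longleftrightarrow> a = zer A"
    using z A.zer_closed by (metis inj_onD)
qed

text \<open>The only property of the tensor products that simplicity, the decomposition and the
  comparison with \<open>quot L N\<close> use.\<close>

definition witt_cover :: "'f::field poly \<Rightarrow> ('f poly poly \<Rightarrow> 'v) \<Rightarrow> ('f, 'v) alg \<Rightarrow> bool" where
  "witt_cover u \<tau> B \<longleftrightarrow> alg_hom \<tau> xvf_alg B \<and> range \<tau> = carr B \<and> (\<forall>f. \<tau> f = zer B \<longleftrightarrow> [:u:] dvd f)"

lemma witt_coverD:
  assumes "witt_cover u \<tau> B"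
  shows "alg_hom \<tau> xvf_alg B" "range \<tau> = carr B" "\<tau> f = zer B \<longleftrightarrow> [:u:] dvd f"
  using assms by (simp_all add: witt_cover_def)

lemma witt_cover_tensor: "\<exists>\<tau>. witt_cover u \<tau> (tensor (R_mod u) Witt)"
proof -
  interpret tensor_model "R_mod u" Witt "red_alg u" "\<lambda>x d. smult (rep u x) (emb (d [:0, 1:]))" "\<lambda>n. wd (monom 1 n)"
    by (rule Witt_tensor_model)
  obtain \<phi> where \<phi>: "alg_iso \<phi> (red_alg u) (tensor (R_mod u) Witt)"
    using isomorphic_sym[OF tensor_f_algebra tensor_iso] unfolding isomorphic_def by blast
  note i = alg_iso_hom[OF C.f_algebra_axioms tensor_f_algebra \<phi>]
  have c: "red u f \<in> carr (red_alg u)" for f by (simp add: red_alg_def)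
  show ?thesis
  proof (unfold witt_cover_def, intro exI[of _ "\<lambda>f. \<phi> (red u f)"] conjI allI)
    show "alg_hom (\<lambda>f. \<phi> (red u f)) xvf_alg (tensor (R_mod u) Witt)"
      by (rule alg_hom_comp[OF red_hom i(1)])
    show "range (\<lambda>f. \<phi> (red u f)) = carr (tensor (R_mod u) Witt)"
      using i(2) by (simp add: red_alg_def image_image)
    show "\<phi> (red u f) = zer (tensor (R_mod u) Witt) \<longleftrightarrow> [:u:] dvd f" for f
      using i(3)[OF c] red_zer_iff by simp
  qed
qed

lemma wbr_jacobi: "wbr a (wbr b d) + wbr b (wbr d a) + wbr d (wbr a b) = 0"
  by (simp add: wbr_def pderiv_mult pderiv_diff algebra_simps)

text \<open>Bracketing with 1 is differentiation and brings an element outside the kernel down to a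
  constant \<open>r\<close> that \<open>u\<close> does not divide. That constant is invertible
  modulo \<open>u\<close>, and its brackets with antiderivatives reach everything.\<close>

lemma simple_quotient:
  fixes u :: "'f::field_char_0 poly"
  assumes u: "prime_elem u" and cover: "witt_cover u \<tau> B"
  shows "simple_lie_algebra B"
proof -
  note hom = witt_coverD(1)[OF cover] and surj = witt_coverD(2)[OF cover]
    and ker = witt_coverD(3)[OF cover]
  interpret f_algebra B
    using f_algebra_image[OF xvf_f_algebra hom] surj by (simp add: xvf_alg_def)
  note h = alg_homD[OF hom, unfolded xvf_alg_def, simplified]
  have ex: "a \<in> carr B \<Longrightarrow> \<exists>f. a = \<tau> f" for a using surj by blast
  have "lie_algebra B"
  proof
    fix a assume "a \<in> carr B"
    then obtain f where "a = \<tau> f" using ex by blast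
    then show "a \<star>\<^bsub>B\<^esub> a = zer B" by (simp add: h(4)[symmetric] ker) (simp add: wbr_def)
  next
    fix a b d assume "a \<in> carr B" "b \<in> carr B" "d \<in> carr B"
    then obtain f g k where "a = \<tau> f" "b = \<tau> g" "d = \<tau> k" using ex by meson
    then show "a \<star>\<^bsub>B\<^esub> (b \<star>\<^bsub>B\<^esub> d) \<oplus>\<^bsub>B\<^esub> b \<star>\<^bsub>B\<^esub> (d \<star>\<^bsub>B\<^esub> a) \<oplus>\<^bsub>B\<^esub> d \<star>\<^bsub>B\<^esub> (a \<star>\<^bsub>B\<^esub> b) = zer B"
      by (simp add: h(3)[symmetric] h(4)[symmetric] wbr_jacobi h(2))
  qed
  moreover have "\<tau> 1 \<star>\<^bsub>B\<^esub> \<tau> [:0, 1:] \<noteq> zer B"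
  proof -
    have "wbr 1 [:0, 1 :: 'f poly:] = [:1:]" by (simp add: wbr_def pderiv_pCons)
    moreover have "\<not> [:u:] dvd [:1:]" using u prime_elem_not_unit by (simp only: const_dvd_const_iff) blast
    ultimately show ?thesis by (simp add: h(4)[symmetric] ker)
  qed
  moreover have "I = {zer B} \<or> I = carr B" if I: "ideal B I" for I
  proof (cases "I \<subseteq> {zer B}")
    case True
    then show ?thesis using I by (auto simp: ideal_def subspace_def)
  next
    case False
    then obtain f where f: "\<tau> f \<in> I" "\<not> [:u:] dvd f"
      using I ex ker unfolding ideal_def subspace_def by (metis singletonI subsetD subsetI)
    have brI: "\<tau> (wbr g f) \<in> I" "\<tau> (wbr f g) \<in> I" if "\<tau> f \<in> I" for f g
      using I that surj by (auto simp: ideal_def h(4))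
    have eqI: "\<tau> f \<in> I \<longleftrightarrow> \<tau> g \<in> I" if "[:u:] dvd f - g" for f g
    proof -
      have "\<tau> (f - g) = zer B" using ker that by simp
      then have "\<tau> f = \<tau> g" using h(3)[of "f - g" g] h(1) by (simp add: zer_pls)
      then show ?thesis by simp
    qed
    have "\<exists>g r. \<tau> g \<in> I \<and> [:u:] dvd g - [:r:] \<and> \<not> u dvd r"
    proof (rule pderiv_descent[where Q = "\<lambda>f. \<tau> f \<in> I", OF _ _ f])
      show "u dvd r" if "u dvd 1 * r" for r using that by simp
      have "wbr 1 f = [:1:] * pderiv f" for f :: "'f poly poly" by (simp add: wbr_def smult_const_1)
      then show "\<tau> ([:1:] * pderiv f) \<in> I" if "\<tau> f \<in> I" for f using brI(1)[OF that, of 1] by simp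
    qed
    then obtain r where r: "\<tau> [:r:] \<in> I" "\<not> u dvd r" using eqI by blast
    obtain x y where xy: "x * u + y * r = 1" using prime_bezout[OF u r(2)] by blast
    have "\<tau> g \<in> I" for g
    proof -
      \<comment> \<open>\<open>y\<close> inverts \<open>r\<close> modulo \<open>u\<close>, so the
        bracket of the constant \<open>r\<close> with this antiderivative returns \<open>g\<close>
        modulo \<open>u\<close>.\<close>
      obtain k where k: "pderiv k = [:y:] * g" using pderiv_surj[OF of_nat_mult_surj_poly] by blast
      have "\<tau> (wbr [:r:] k) \<in> I" using brI r(1) by blast
      moreover have "wbr [:r:] k - g = [:u:] * (- ([:x:] * g))"
      proof -
        have "wbr [:r:] k - g = ([:r * y:] - [:1:]) * g" by (simp add: wbr_def k algebra_simps pderiv_pCons smult_diff_left)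
        also have "[:r * y:] - [:1:] = [:u:] * [:- x:]" using xy by (simp add: algebra_simps)
        finally show ?thesis by (simp add: algebra_simps)
      qed
      ultimately show ?thesis using eqI by (metis dvd_triv_left)
    qed
    then have "carr B \<subseteq> I" unfolding surj[symmetric] by auto
    then show ?thesis using I by (simp add: ideal_def subspace_def equalityI)
  qed
  ultimately show ?thesis unfolding simple_lie_algebra_def using h(1) by blast
qed

lemma tensor_Witt_simple:
  "prime_elem u \<Longrightarrow> simple_lie_algebra (tensor (R_mod u) Witt)" for u :: "'f::field_char_0 poly"
proof -
  assume u: "prime_elem u"
  obtain \<tau> where "witt_cover u \<tau> (tensor (R_mod u) Witt)" using witt_cover_tensor ..
  from simple_quotient[OF u this] show ?thesis .
qed

text \<open>Both sides are covered by \<open>xvf_alg\<close>. The kernels are the multiples of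
  \<open>q\<close> and the common multiples of all \<open>u\<close>, which the hypothesis on
  \<open>q\<close> identifies; surjectivity onto the sum is Chinese remaindering.\<close>

lemma tensor_Witt_direct_sum:
  fixes q :: "'f::field poly"
  assumes fin: "finite U" and U: "\<And>u. u \<in> U \<Longrightarrow> lead_coeff u = 1 \<and> prime_elem u"
    and q: "\<And>r. q dvd r \<longleftrightarrow> (\<forall>u\<in>U. u dvd r)"
  shows "isomorphic (tensor (R_mod q) Witt) (direct_sum U (\<lambda>u. tensor (R_mod u) Witt))"
proof -
  let ?T = "\<lambda>u::'f poly. tensor (R_mod u) Witt"
  obtain \<tau> where "\<forall>u. witt_cover u (\<tau> u) (?T u)" using choice[OF allI[OF witt_cover_tensor]] ..
  note \<tau> = witt_coverD[OF this[rule_format]]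
  note h = alg_homD[OF \<tau>(1), unfolded xvf_alg_def, simplified]
  define \<delta> where "\<delta> f = (\<lambda>u\<in>U. \<tau> u f)" for f
  have hom: "alg_hom \<delta> xvf_alg (direct_sum U ?T)"
    unfolding alg_hom_def direct_sum_def xvf_alg_def \<delta>_def using fin
    by (auto simp: h restrict_def fun_eq_iff)
  have surj: "\<delta> ` carr xvf_alg = carr (direct_sum U ?T)"
  proof
    show "\<delta> ` carr xvf_alg \<subseteq> carr (direct_sum U ?T)" using hom by (simp add: alg_hom_def)
    show "carr (direct_sum U ?T) \<subseteq> \<delta> ` carr xvf_alg"
    proof
      fix x assume "x \<in> carr (direct_sum U ?T)"
      then have x: "x \<in> (\<Pi>\<^sub>E u\<in>U. carr (?T u))" by (simp add: direct_sum_def)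
      have "\<forall>u\<in>U. \<exists>f. x u = \<tau> u f" using x \<tau>(2) by (metis PiE_mem imageE)
      then obtain F where F: "\<forall>u\<in>U. x u = \<tau> u (F u)" by metis
      have "\<forall>u\<in>U. \<exists>e. u dvd e - 1 \<and> (\<forall>v\<in>U - {u}. v dvd e)"
        using crt_idempotent[OF fin] U by blast
      then obtain e where e: "\<forall>u\<in>U. u dvd e u - 1 \<and> (\<forall>v\<in>U - {u}. v dvd e u)" by metis
      \<comment> \<open>\<open>e u\<close> is 1 modulo \<open>u\<close> and 0 modulo the other
        primes.\<close>
      define f where "f = (\<Sum>u\<in>U. [:e u:] * F u)"
      have "\<tau> u f = x u" if u: "u \<in> U" for u
      proof -
        have eq: "f - F u = [:e u - 1:] * F u + (\<Sum>v\<in>U - {u}. [:e v:] * F v)"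
          unfolding f_def using sum.remove[OF fin u, of "\<lambda>u. [:e u:] * F u"]
          by (simp add: smult_diff_left)
        have d1: "[:u:] dvd [:e u - 1:] * F u"
          using e u by (intro dvd_mult2) (simp add: const_dvd_const_iff)
        have d2: "[:u:] dvd (\<Sum>v\<in>U - {u}. [:e v:] * F v)"
          using e u by (intro dvd_sum dvd_mult2) (auto simp: const_dvd_const_iff)
        have "[:u:] dvd f - F u" unfolding eq using d1 d2 by (rule dvd_add)
        then have "\<tau> u (f - F u) = zer (?T u)" by (simp add: \<tau>(3))
        moreover have "\<tau> u f = \<tau> u (f - F u) \<oplus>\<^bsub>?T u\<^esub> \<tau> u (F u)" using h(3)[of u "f - F u" "F u"] by simp
        moreover have "f_algebra (?T u)"
          using f_algebra_image[OF xvf_f_algebra \<tau>(1)[of u]] \<tau>(2)[of u] by (simp add: xvf_alg_def)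
        ultimately show ?thesis using F u f_algebra.zer_pls h(1) by metis
      qed
      then have "x = \<delta> f" using x unfolding \<delta>_def by (intro ext) (auto simp: PiE_def extensional_def)
      then show "x \<in> \<delta> ` carr xvf_alg" by (simp add: xvf_alg_def)
    qed
  qed
  have ker: "\<tau> q f = zer (?T q) \<longleftrightarrow> \<delta> f = zer (direct_sum U ?T)" for f
  proof -
    have "\<delta> f = zer (direct_sum U ?T) \<longleftrightarrow> (\<forall>u\<in>U. [:u:] dvd f)"
      unfolding \<delta>_def direct_sum_def using \<tau>(3) by (simp add: restrict_def fun_eq_iff) metis
    also have "\<dots> \<longleftrightarrow> [:q:] dvd f" using q by (auto simp: const_dvd_iff)
    finally show ?thesis by (simp add: \<tau>(3))
  qed
  have "\<tau> q ` carr xvf_alg = carr (?T q)" using \<tau>(2) by (simp add: xvf_alg_def)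
  from same_kernel_alg_iso[OF xvf_f_algebra \<tau>(1) this hom surj ker]
  show ?thesis unfolding isomorphic_def by metis
qed

context bracket_quotient
begin

text \<open>Modulo \<open>q\<close> the bracket is - \<rho> times \<open>wbr\<close>. Multiplication
  by - \<rho>, which is constant in t, turns it into \<open>wbr\<close> itself; invertibility of
  \<rho> makes that map bijective modulo \<open>q\<close>.\<close>

lemma quot_L_N_iso: "isomorphic (quot L N) (tensor (R_mod q) Witt)"
proof -
  let ?T = "tensor (R_mod q) Witt :: ('f, _) alg"
  obtain \<tau> where "witt_cover q \<tau> ?T" using witt_cover_tensor ..
  note \<tau> = witt_coverD[OF this]
  note h = alg_homD[OF \<tau>(1), unfolded xvf_alg_def, simplified]
  interpret T: f_algebra ?T
    using f_algebra_image[OF xvf_f_algebra \<tau>(1)] \<tau>(2) by (simp add: xvf_alg_def)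
  have eq: "\<tau> f = \<tau> g" if "[:q:] dvd f - g" for f g
  proof -
    have "\<tau> (f - g) = zer ?T" using \<tau>(3) that by simp
    then show ?thesis using h(3)[of "f - g" g] h(1) by (simp add: T.zer_pls)
  qed
  define \<sigma> where "\<sigma> f = \<tau> (- ([:\<rho>:] * f))" for f
  obtain a b where ab: "a * \<kappa> + b * \<rho> = 1" using \<rho>_inverse_mod_\<kappa> by blast
  obtain k where k: "\<kappa> = q * k" using q_dvd_\<kappa> ..
  have ab': "f - [:b * \<rho>:] * f = [:q:] * ([:k * a:] * f)" for f
  proof -
    have "f - [:b * \<rho>:] * f = ([:1:] - [:b * \<rho>:]) * f" by (simp add: algebra_simps smult_diff_left)
    also have "[:1:] - [:b * \<rho>:] = [:q:] * [:k * a:]" using ab k by (simp add: algebra_simps)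
    finally show ?thesis by (simp only: mult.assoc)
  qed
  have hom: "alg_hom \<sigma> br_alg ?T"
    unfolding alg_hom_def
  proof (intro conjI ballI allI)
    show "\<sigma> ` carr br_alg \<subseteq> carr ?T" using h(1) by (auto simp: \<sigma>_def)
    show "\<sigma> (zer br_alg) = zer ?T" by (simp add: \<sigma>_def br_alg_def h(2))
    fix f g
    show "\<sigma> (f \<oplus>\<^bsub>br_alg\<^esub> g) = \<sigma> f \<oplus>\<^bsub>?T\<^esub> \<sigma> g"
      by (simp add: \<sigma>_def br_alg_def h(3)[symmetric] smult_add_right)
    show "\<sigma> (c \<odot>\<^bsub>br_alg\<^esub> f) = c \<odot>\<^bsub>?T\<^esub> \<sigma> f" for c
      by (simp add: \<sigma>_def br_alg_def h(5)[symmetric] mult.commute)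
    have "[:\<rho>:] * ([:\<rho>:] * (g * pderiv f - f * pderiv g)) = - wbr (- ([:\<rho>:] * f)) (- ([:\<rho>:] * g))"
      by (simp add: wbr_def pderiv_minus pderiv_smult algebra_simps smult_diff_right)
    then have "- ([:\<rho>:] * br f g) - wbr (- ([:\<rho>:] * f)) (- ([:\<rho>:] * g))
      = - ([:\<rho>:] * (br f g - [:\<rho>:] * (g * pderiv f - f * pderiv g)))"
      by (simp add: right_diff_distrib)
    moreover have "[:q:] dvd - ([:\<rho>:] * (br f g - [:\<rho>:] * (g * pderiv f - f * pderiv g)))"
      using br_mod_q[of f g] by (metis dvd_minus_iff dvd_mult)
    ultimately have "[:q:] dvd - ([:\<rho>:] * br f g) - wbr (- ([:\<rho>:] * f)) (- ([:\<rho>:] * g))" by simp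
    then show "\<sigma> (f \<star>\<^bsub>br_alg\<^esub> g) = \<sigma> f \<star>\<^bsub>?T\<^esub> \<sigma> g"
      unfolding \<sigma>_def h(4)[symmetric] by (simp add: br_alg_def eq)
  qed
  have surj: "\<sigma> ` carr br_alg = carr ?T"
  proof
    show "\<sigma> ` carr br_alg \<subseteq> carr ?T" using h(1) by (auto simp: \<sigma>_def)
    show "carr ?T \<subseteq> \<sigma> ` carr br_alg"
    proof
      fix x assume "x \<in> carr ?T"
      then obtain f where f: "x = \<tau> f" using \<tau>(2) by blast
      have "- ([:\<rho>:] * - ([:b:] * f)) = [:b * \<rho>:] * f" by simp
      moreover have "[:q:] dvd f - [:b * \<rho>:] * f" unfolding ab' by (rule dvd_triv_left)
      ultimately have "x = \<sigma> (- ([:b:] * f))" unfolding f \<sigma>_def by (simp only: eq)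
      then show "x \<in> \<sigma> ` carr br_alg" by (simp add: br_alg_def)
    qed
  qed
  have ker: "coset L N (M f) = zer (quot L N) \<longleftrightarrow> \<sigma> f = zer ?T" for f
  proof -
    have "\<sigma> f = zer ?T \<longleftrightarrow> [:q:] dvd [:\<rho>:] * f" by (simp add: \<sigma>_def \<tau>(3))
    also have "\<dots> \<longleftrightarrow> [:q:] dvd f"
    proof
      assume "[:q:] dvd [:\<rho>:] * f"
      then have "[:q:] dvd [:b:] * ([:\<rho>:] * f)" by (rule dvd_mult)
      also have "[:b:] * ([:\<rho>:] * f) = [:b * \<rho>:] * f" by (simp add: mult.commute)
      finally show "[:q:] dvd f" using ab'[of f] by (metis diff_add_cancel dvd_add dvd_triv_left)
    qed (rule dvd_mult)
    finally show ?thesis by (simp add: coset_M_hom(3))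
  qed
  have "(\<lambda>f. coset L N (M f)) ` carr br_alg = carr (quot L N)" using coset_M_hom(2) by (simp add: br_alg_def)
  from same_kernel_alg_iso[OF br_algebra coset_M_hom(1) this hom surj ker]
  show ?thesis unfolding isomorphic_def by metis
qed

end

section \<open>Differential operators on power series\<close>

text \<open>A type of its own makes these endomorphisms an instance of \<open>ring_1\<close> with
  composition as product, so that commutators are computed by ring rewriting.\<close>

typedef (overloaded) 'f lop =
  "{L :: 'f::field fps \<Rightarrow> 'f fps. (\<forall>x y. L (x + y) = L x + L y) \<and> (\<forall>c x. L (fps_const c * x) = fps_const c * L x)}"
  morphisms lop_app Lop
  by (rule exI[of _ "\<lambda>_. 0"]) simp

setup_lifting type_definition_lop

instantiation lop :: (field) ring_1
begin

lift_definition zero_lop :: "'a lop" is "\<lambda>_. 0" by simp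
lift_definition one_lop :: "'a lop" is "\<lambda>x. x" by simp
lift_definition plus_lop :: "'a lop \<Rightarrow> 'a lop \<Rightarrow> 'a lop" is "\<lambda>L K x. L x + K x"
  by (simp add: algebra_simps)
lift_definition uminus_lop :: "'a lop \<Rightarrow> 'a lop" is "\<lambda>L x. - L x" by simp
lift_definition minus_lop :: "'a lop \<Rightarrow> 'a lop \<Rightarrow> 'a lop" is "\<lambda>L K x. L x - K x"
  by (simp add: algebra_simps)
lift_definition times_lop :: "'a lop \<Rightarrow> 'a lop \<Rightarrow> 'a lop" is "\<lambda>L K x. L (K x)" by simp

instance
proof
  fix a b c :: "'a lop"
  show "a * b * c = a * (b * c)" by transfer simp
  show "a + b + c = a + (b + c)" by transfer (simp add: add.assoc)
  show "a + b = b + a" by transfer (simp add: add.commute)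
  show "0 + a = a" by transfer simp
  show "- a + a = 0" by transfer simp
  show "a - b = a + - b" by transfer simp
  show "1 * a = a" by transfer simp
  show "a * 1 = a" by transfer simp
  show "(a + b) * c = a * c + b * c" by transfer simp
  show "a * (b + c) = a * b + a * c" by transfer simp
  show "(0 :: 'a lop) \<noteq> 1" by transfer (metis one_neq_zero)
qed

end

lift_definition mu :: "'f::field fps \<Rightarrow> 'f lop" is "\<lambda>f x. f * x"
  by (simp add: algebra_simps)

lift_definition dd :: "'f::field lop" is fps_deriv by simp

lemma mu_0 [simp]: "mu 0 = 0" by transfer simp
lemma mu_1 [simp]: "mu 1 = 1" by transfer simp
lemma mu_add: "mu (f + g) = mu f + mu g" by transfer (simp add: fun_eq_iff algebra_simps)
lemma mu_diff: "mu (f - g) = mu f - mu g" by transfer (simp add: fun_eq_iff algebra_simps)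
lemma mu_minus: "mu (- f) = - mu f" by transfer (simp add: fun_eq_iff)
lemma mu_mult: "mu (f * g) = mu f * mu g" by transfer (simp add: fun_eq_iff mult.assoc)
lemma mu_commute: "mu f * mu g = mu g * mu f" by (simp add: mu_mult[symmetric] mult.commute)
lemma dd_mu: "dd * mu f = mu f * dd + mu (fps_deriv f)" by transfer (simp add: fun_eq_iff)

lemma mu_inject: "mu f = mu g \<longleftrightarrow> f = g"
proof
  show "mu f = mu g \<Longrightarrow> f = g" by transfer (metis mult.right_neutral)
qed simp

definition scal :: "'f::field \<Rightarrow> 'f lop" where
  "scal c = mu (fps_const c)"

lemma scal_central: "scal c * L = L * scal c"
  unfolding scal_def by transfer simp

lemma scal_add: "scal (c + d) = scal c + scal d"
  by (simp add: scal_def mu_add[symmetric])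

lemma scal_mult: "scal (c * d) = scal c * scal d"
  by (simp add: scal_def mu_mult[symmetric])

lemma scal_0 [simp]: "scal 0 = 0" and scal_1 [simp]: "scal 1 = 1"
  by (simp_all add: scal_def)

section \<open>Commutators of operators\<close>

definition cm :: "'a::ring \<Rightarrow> 'a \<Rightarrow> 'a" where
  "cm a b = a * b - b * a"

lemma cm_0_right [simp]: "cm a 0 = 0" and cm_0_left [simp]: "cm 0 a = 0" and cm_self [simp]: "cm a a = 0"
  by (simp_all add: cm_def)
lemma cm_add_left: "cm (a + b) c = cm a c + cm b c" by (simp add: cm_def algebra_simps)
lemma cm_add_right: "cm a (b + c) = cm a b + cm a c" by (simp add: cm_def algebra_simps)
lemma cm_diff_left: "cm (a - b) c = cm a c - cm b c" by (simp add: cm_def algebra_simps)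
lemma cm_mult_left: "cm (a * b) c = a * cm b c + cm a c * b" by (simp add: cm_def algebra_simps)
lemma cm_mult_right: "cm a (b * c) = b * cm a c + cm a b * c" by (simp add: cm_def algebra_simps)
lemma cm_swap: "cm a b = - cm b a" by (simp add: cm_def)
lemma cm_swap_mult: "a * b = b * a + cm a b" by (simp add: cm_def)
lemma cm_mu: "cm (mu f) (mu g) = 0" by (simp add: cm_def mu_commute)
lemma cm_scal: "cm a (scal c * b) = scal c * cm a b"
  by (simp add: cm_def scal_central right_diff_distrib mult.assoc[symmetric])
    (metis mult.assoc scal_central)
lemma cm_scal_left: "cm (scal c * a) b = scal c * cm a b"
  by (simp add: cm_def right_diff_distrib mult.assoc)
    (metis mult.assoc scal_central)

text \<open>Polynomials act on power series through their Taylor expansion at a point \<open>c0\<close> that is not a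
  root of \<open>h\<close>: there \<open>h\<close> is invertible, and every series has an antiderivative.\<close>

locale weyl = poly_data h for h :: "'f::field_char_0 poly" +
  fixes c0 :: 'f
  assumes h_c0: "poly h c0 \<noteq> 0"
begin

definition \<iota> :: "'f poly \<Rightarrow> 'f fps" where
  "\<iota> r = fps_of_poly (pcompose r [:c0, 1:])"

lemma \<iota>_0 [simp]: "\<iota> 0 = 0" and \<iota>_1 [simp]: "\<iota> 1 = 1"
  by (simp_all add: \<iota>_def pcompose_1)

lemma \<iota>_add: "\<iota> (r + s) = \<iota> r + \<iota> s"
  by (simp add: \<iota>_def pcompose_add fps_of_poly_add)

lemma \<iota>_diff: "\<iota> (r - s) = \<iota> r - \<iota> s"
  by (simp add: \<iota>_def pcompose_diff fps_of_poly_diff)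

lemma \<iota>_minus: "\<iota> (- r) = - \<iota> r"
  using \<iota>_diff[of 0 r] by simp

lemma \<iota>_mult: "\<iota> (r * s) = \<iota> r * \<iota> s"
  by (simp add: \<iota>_def pcompose_mult fps_of_poly_mult)

lemma \<iota>_const: "\<iota> [:c:] = fps_const c"
  by (simp add: \<iota>_def fps_of_poly_const)

lemma \<iota>_smult: "\<iota> (smult c r) = fps_const c * \<iota> r"
  using \<iota>_mult[of "[:c:]" r] by (simp add: \<iota>_const)

lemma \<iota>_pderiv: "fps_deriv (\<iota> r) = \<iota> (pderiv r)"
  by (simp add: \<iota>_def fps_of_poly_pderiv[symmetric] pderiv_pcompose pderiv_pCons)

lemma \<iota>_eq_0_iff: "\<iota> r = 0 \<longleftrightarrow> r = 0"
proof
  assume "\<iota> r = 0"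
  then have "pcompose r [:c0, 1:] = 0" unfolding \<iota>_def by (metis fps_of_poly_0 fps_of_poly_eq_iff)
  then show "r = 0" by (rule pcompose_eq_0) simp
qed simp

lemma \<iota>_h_nth_0: "fps_nth (\<iota> h) 0 \<noteq> 0"
  using h_c0 by (simp add: \<iota>_def poly_0_coeff_0[symmetric] poly_pcompose)

definition "hinv = inverse (\<iota> h)"

lemma hinv_h: "hinv * \<iota> h = 1"
  unfolding hinv_def using \<iota>_h_nth_0 by (rule inverse_mult_eq_1)

lemma deriv_hinv: "fps_deriv hinv = - \<iota> (pderiv h) * (hinv * hinv)"
  unfolding hinv_def using fps_inverse_deriv[OF \<iota>_h_nth_0] by (simp add: \<iota>_pderiv power2_eq_square)

section \<open>Normal forms for the image of A_h\<close>

definition "j r = mu (\<iota> r)"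
definition "Y = dd * j h"
text \<open>\<open>S\<close> sends \<open>\<Sum> r\<^sub>n t\<^sup>n\<close> to \<open>\<Sum> r\<^sub>n Y\<^sup>n\<close>; its range is the image of \<open>A\<^sub>h\<close>.\<close>

definition "S f = fold_coeffs (\<lambda>r a. j r + a * Y) f 0"

lemma j_0 [simp]: "j 0 = 0" and j_1 [simp]: "j 1 = 1"
  by (simp_all add: j_def)

lemma j_add: "j (r + s) = j r + j s" by (simp add: j_def \<iota>_add mu_add)
lemma j_diff: "j (r - s) = j r - j s" by (simp add: j_def \<iota>_diff mu_diff)
lemma j_minus: "j (- r) = - j r" by (simp add: j_def \<iota>_minus mu_minus)
lemma j_mult: "j (r * s) = j r * j s" by (simp add: j_def \<iota>_mult mu_mult)
lemma j_commute: "j r * j s = j s * j r" by (simp add: j_def mu_commute)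
lemma j_const: "j [:c:] = scal c" by (simp add: j_def \<iota>_const scal_def)
lemma j_eq_0_iff: "j r = 0 \<longleftrightarrow> r = 0"
  unfolding j_def using mu_inject[of "\<iota> r" 0] by (simp add: \<iota>_eq_0_iff)

lemma mu_hinv_j_h: "mu hinv * j h = 1"
  by (simp add: j_def mu_mult[symmetric] hinv_h)

lemma j_h_cancel: "j h * a = j h * b \<Longrightarrow> a = b"
  by (metis mult.assoc mult_1 mu_hinv_j_h)

lemma Y_mu: "Y * mu f = mu f * Y + mu (\<iota> h * fps_deriv f)"
proof -
  have "Y * mu f = dd * mu f * j h" unfolding Y_def j_def by (metis mult.assoc mu_commute)
  also have "\<dots> = mu f * Y + mu (fps_deriv f) * j h"
    unfolding dd_mu Y_def by (simp add: distrib_right mult.assoc)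
  finally show ?thesis by (simp add: j_def mu_mult[symmetric] mult.commute)
qed

lemma cm_Y_mu: "cm Y (mu f) = mu (\<iota> h * fps_deriv f)"
  by (simp add: cm_def Y_mu)

lemma cm_Y_j: "cm Y (j r) = j (h * pderiv r)"
  by (simp add: j_def cm_Y_mu \<iota>_pderiv \<iota>_mult)

lemma S_0 [simp]: "S 0 = 0"
  by (simp add: S_def)

lemma S_pCons: "S (pCons r f) = j r + S f * Y"
  by (cases "r = 0 \<and> f = 0") (auto simp: S_def)

lemma S_const: "S [:r:] = j r"
  by (simp add: S_pCons)

lemma S_1 [simp]: "S 1 = 1"
  by (simp add: one_pCons S_const) (simp flip: one_pCons)

lemma S_add: "S (f + g) = S f + S g"
  by (induction f g rule: poly_induct2) (simp_all add: S_pCons j_add algebra_simps)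

lemma S_smult: "S (smult r f) = j r * S f"
  by (induction f) (simp_all add: S_pCons j_mult distrib_left mult.assoc)

lemma S_minus: "S (- f) = - S f"
  using S_smult[of "- 1" f] by (simp add: j_minus)

lemma S_diff: "S (f - g) = S f - S g"
  using S_add[of f "- g"] by (simp add: S_minus)

lemma S_Y: "S (pCons 0 f) = S f * Y"
  by (simp add: S_pCons)

lemma Y_S: "Y * S f = S (pCons 0 f + smult h (dx f))"
proof (induction f)
  case (pCons r f)
  have "Y * S (pCons r f) = Y * j r + Y * S f * Y" by (simp add: S_pCons algebra_simps)
  also have "Y * j r = j r * Y + j (h * pderiv r)" using cm_Y_j[of r] by (simp add: cm_def algebra_simps)
  finally show ?case
    unfolding pCons(2) by (simp add: S_pCons S_add dx_pCons S_smult algebra_simps)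
qed simp

lemma cm_S_Y: "cm (S f) Y = - (j h * S (dx f))"
  by (simp add: cm_def Y_S S_add S_Y S_smult)

text \<open>The degree bound on the error term gives the injectivity of \<open>S\<close> and the solvability of
  \<open>[S g, x] = h S f\<close>; its divisibility by \<open>\<kappa>\<close> gives the bracket modulo inner derivations.\<close>

lemma cm_S_j:
  "\<exists>k. cm (S f) (j r) = j h * S (smult (pderiv r) (pderiv f) + k) \<and> [:\<kappa>:] dvd k
    \<and> (\<forall>i. degree f \<le> Suc i \<longrightarrow> coeff k i = 0)"
proof (induction f arbitrary: r)
  case 0
  show ?case by (rule exI[of _ 0]) simp
next
  case (pCons a f)
  obtain k1 where k1: "cm (S f) (j r) = j h * S (smult (pderiv r) (pderiv f) + k1)" "[:\<kappa>:] dvd k1"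
    "\<forall>i. degree f \<le> Suc i \<longrightarrow> coeff k1 i = 0" using pCons(2) by blast
  obtain k2 where k2: "cm (S f) (j (h * pderiv r)) = j h * S (smult (pderiv (h * pderiv r)) (pderiv f) + k2)"
    "[:\<kappa>:] dvd k2" "\<forall>i. degree f \<le> Suc i \<longrightarrow> coeff k2 i = 0" using pCons(2) by blast
  let ?k = "smult (pderiv (h * pderiv r)) (pderiv f) + k2 + pCons 0 k1"
  have "cm (S (pCons a f)) (j r) = S f * j (h * pderiv r) + cm (S f) (j r) * Y"
    by (simp add: S_pCons cm_add_left cm_mult_left cm_Y_j) (simp add: cm_def j_commute)
  also have "S f * j (h * pderiv r) = j (h * pderiv r) * S f + cm (S f) (j (h * pderiv r))"
    by (rule cm_swap_mult)
  also have "j (h * pderiv r) * S f + cm (S f) (j (h * pderiv r)) + cm (S f) (j r) * Y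
      = j h * S (smult (pderiv r) (pderiv (pCons a f)) + ?k)"
    unfolding k1(1) k2(1)
    by (simp add: pderiv_pCons S_add S_smult S_Y smult_add_right j_mult algebra_simps)
  finally have 1: "cm (S (pCons a f)) (j r) = j h * S (smult (pderiv r) (pderiv (pCons a f)) + ?k)" .
  \<comment> \<open>\<open>\<kappa>\<close> divides both \<open>h\<close> and its derivative, hence
    also the derivative of \<open>h * pderiv r\<close>.\<close>
  have "pderiv (h * pderiv r) = ph * \<kappa> * pderiv (pderiv r) + pderiv r * (\<kappa> * \<theta>)"
    unfolding ph_\<kappa> by (simp add: pderiv_mult pderiv_h)
  also have "\<dots> = \<kappa> * (ph * pderiv (pderiv r) + \<theta> * pderiv r)" by (simp add: algebra_simps)
  finally have "pderiv (h * pderiv r) = \<kappa> * (ph * pderiv (pderiv r) + \<theta> * pderiv r)" .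
  then have "[:\<kappa>:] dvd smult (pderiv (h * pderiv r)) (pderiv f)" by (simp add: const_dvd_iff)
  then have 2: "[:\<kappa>:] dvd ?k" using k1(2) k2(2) by (intro dvd_add) (auto simp: const_dvd_pCons)
  have 3: "\<forall>i. degree (pCons a f) \<le> Suc i \<longrightarrow> coeff ?k i = 0"
  proof (intro allI impI)
    fix i assume i: "degree (pCons a f) \<le> Suc i"
    show "coeff ?k i = 0"
    proof (cases "f = 0")
      case True
      then have "k1 = 0" "k2 = 0" using k1(3) k2(3) by (auto intro!: poly_eqI)
      then show ?thesis using True by simp
    next
      case False
      then have i': "degree f \<le> i" using i by simp
      then have "coeff (pderiv f) i = 0" "coeff k2 i = 0" "coeff (pCons 0 k1) i = 0"
        using k1(3) k2(3) by (auto simp: coeff_pderiv coeff_eq_0 coeff_pCons split: nat.split)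
      then show ?thesis by simp
    qed
  qed
  show ?case using 1 2 3 by blast
qed

abbreviation "x1 \<equiv> [:0, 1:]"

text \<open>The commutator with x is h times the t-derivative of \<open>f\<close> plus terms of
  lower degree, so its vanishing kills the leading coefficient. Injectivity is assumed only below
  \<open>degree f\<close>, which lets \<open>S_inj\<close> use the lemma inside its
  induction.\<close>

lemma S_comm_x_imp_const:
  assumes inj: "\<And>g. degree g < degree f \<Longrightarrow> S g = 0 \<Longrightarrow> g = 0" and c: "cm (S f) (j x1) = 0"
  shows "degree f = 0"
proof (rule ccontr)
  assume "degree f \<noteq> 0"
  then obtain n where n: "degree f = Suc n" by (cases "degree f") auto
  obtain k where k: "cm (S f) (j x1) = j h * S (smult (pderiv x1) (pderiv f) + k)"
    "\<forall>i. degree f \<le> Suc i \<longrightarrow> coeff k i = 0" using cm_S_j by blast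
  have "j h * S (pderiv f + k) = j h * 0" using k(1) c by (simp add: pderiv_pCons smult_const_1)
  then have "S (pderiv f + k) = 0" by (rule j_h_cancel)
  moreover have "degree (pderiv f + k) < degree f"
  proof -
    have "degree (pderiv f + k) \<le> n"
      by (rule degree_le) (use k(2) n in \<open>auto simp: coeff_pderiv coeff_eq_0\<close>)
    then show ?thesis using n by simp
  qed
  ultimately have "coeff (pderiv f + k) n = 0" using inj by fastforce
  moreover have "coeff k n = 0" using k(2) n by simp
  ultimately have "of_nat (Suc n) * coeff f (Suc n) = 0" by (simp add: coeff_pderiv)
  then have "coeff f (Suc n) = 0" by (simp del: of_nat_Suc)
  then show False using n by (metis leading_coeff_0_iff degree_0 nat.distinct(1))
qed

lemma S_inj: "S f = 0 \<Longrightarrow> f = 0"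
proof (induction "degree f" arbitrary: f rule: less_induct)
  case less
  have "degree f = 0"
    by (rule S_comm_x_imp_const) (use less in auto)
  then obtain a where "f = [:a:]" by (rule degree_eq_zeroE)
  then show ?case using less.prems by (simp add: S_const j_eq_0_iff)
qed

lemma S_inject: "S f = S g \<longleftrightarrow> f = g"
  using S_inj[of "f - g"] by (auto simp: S_diff)

lemma S_comm_x: "cm (S f) (j x1) = 0 \<Longrightarrow> degree f = 0"
  using S_comm_x_imp_const S_inj by blast

text \<open>Moving \<open>Y\<close> to the right of a coefficient costs a multiple of
  \<open>h\<close>, so modulo \<open>h\<close> normal forms multiply like polynomials.\<close>

lemma S_mult: "\<exists>k. S f * S g = S (f * g + smult h k)"
proof (induction f arbitrary: g)
  case 0
  show ?case by (rule exI[of _ 0]) simp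
next
  case (pCons r f)
  obtain k where k: "S f * S (pCons 0 g + smult h (dx g)) = S (f * (pCons 0 g + smult h (dx g)) + smult h k)"
    using pCons(2) by blast
  have "S (pCons r f) * S g = j r * S g + S f * (Y * S g)" by (simp add: S_pCons algebra_simps)
  also have "\<dots> = S (smult r g + (f * (pCons 0 g + smult h (dx g)) + smult h k))"
    unfolding Y_S k by (simp add: S_add S_smult)
  also have "smult r g + (f * (pCons 0 g + smult h (dx g)) + smult h k)
      = pCons r f * g + smult h (f * dx g + k)"
    by (simp add: algebra_simps smult_add_right)
  finally show ?case by blast
qed

lemma range_S_mult: "a \<in> range S \<Longrightarrow> b \<in> range S \<Longrightarrow> a * b \<in> range S"
proof -
  assume "a \<in> range S" "b \<in> range S"
  then obtain f g where fg: "a = S f" "b = S g" by blast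
  obtain k where "S f * S g = S (f * g + smult h k)" using S_mult by blast
  then show ?thesis unfolding fg by simp
qed

lemma \<kappa>_dvd_smult_h: "[:\<kappa>:] dvd smult h k"
  using \<kappa>_dvd_h by (simp add: const_dvd_iff)

lemma S_mult_mod: "\<exists>k. S f * S g = S (f * g + k) \<and> [:\<kappa>:] dvd k"
  using S_mult \<kappa>_dvd_smult_h by blast

text \<open>The error is kept divisible by \<open>\<kappa>\<close> because two factors
  \<open>e\<close> are applied to it below: one turns \<open>h\<close> into \<open>ph\<close>, the
  other absorbs \<open>\<kappa>\<close>.\<close>

lemma cm_S_S:
  "\<exists>k. cm (S f) (S g) = j h * S (pderiv f * dx g - pderiv g * dx f + k) \<and> [:\<kappa>:] dvd k"
proof (induction g)
  case 0
  show ?case by (rule exI[of _ 0]) simp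
next
  case (pCons r g)
  obtain k1 where k1: "cm (S f) (S g) = j h * S (pderiv f * dx g - pderiv g * dx f + k1)" "[:\<kappa>:] dvd k1"
    using pCons(2) by blast
  obtain k2 where k2: "cm (S f) (j r) = j h * S (smult (pderiv r) (pderiv f) + k2)" "[:\<kappa>:] dvd k2"
    using cm_S_j by blast
  \<comment> \<open>The factor \<open>h\<close> from the commutator of \<open>S f\<close> and
    \<open>Y\<close> stands to the right of \<open>S g\<close> and has to be moved to the
    front.\<close>
  obtain k3 where k3: "cm (S g) (j h) = j h * S (smult (pderiv h) (pderiv g) + k3)" "[:\<kappa>:] dvd k3"
    using cm_S_j by blast
  let ?u = "smult (pderiv h) (pderiv g) + k3"
  obtain k4 where k4: "S (g + ?u) * S (dx f) = S ((g + ?u) * dx f + k4)" "[:\<kappa>:] dvd k4"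
    using S_mult_mod by blast
  have u: "[:\<kappa>:] dvd ?u" using k3(2) by (intro dvd_add) (auto simp: pderiv_h const_dvd_iff)
  have "cm (S f) (S (pCons r g)) = cm (S f) (j r) + (cm (S f) (S g) * Y - S g * j h * S (dx f))"
    by (simp add: S_pCons cm_add_right cm_mult_right cm_S_Y algebra_simps)
  also have "S g * j h = j h * S (g + ?u)" using cm_swap_mult[of "S g" "j h"] k3(1) by (simp add: S_add algebra_simps)
  also have "cm (S f) (j r) + (cm (S f) (S g) * Y - j h * S (g + ?u) * S (dx f)) =
      j h * S (smult (pderiv r) (pderiv f) + k2 + pCons 0 (pderiv f * dx g - pderiv g * dx f + k1)
        - ((g + ?u) * dx f + k4))"
    unfolding k1(1) k2(1) by (simp only: mult.assoc k4(1) S_Y[symmetric])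
      (simp only: S_add S_diff distrib_left right_diff_distrib add_diff_eq)
  also have "smult (pderiv r) (pderiv f) + k2 + pCons 0 (pderiv f * dx g - pderiv g * dx f + k1)
        - ((g + ?u) * dx f + k4)
      = pderiv f * dx (pCons r g) - pderiv (pCons r g) * dx f + (k2 + pCons 0 k1 - ?u * dx f - k4)"
    by (simp add: dx_pCons pderiv_pCons algebra_simps)
  finally have "cm (S f) (S (pCons r g)) = j h * S (pderiv f * dx (pCons r g) - pderiv (pCons r g) * dx f
      + (k2 + pCons 0 k1 - ?u * dx f - k4))" .
  moreover have "[:\<kappa>:] dvd k2 + pCons 0 k1 - ?u * dx f - k4"
    by (intro dvd_diff dvd_add k2(2) dvd_mult2[OF u] k4(2)) (simp add: const_dvd_pCons k1(2))
  ultimately show ?case by blast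
qed

text \<open>\<open>e\<close> is \<open>a\<^sub>0\<close>.\<close>

definition "e = mu (\<iota> ph * hinv)"

lemma e_\<kappa>: "e * j \<kappa> = 1"
proof -
  have "\<iota> ph * hinv * \<iota> \<kappa> = hinv * \<iota> (ph * \<kappa>)" by (simp add: \<iota>_mult mult_ac)
  then show ?thesis by (simp add: e_def j_def mu_mult[symmetric] ph_\<kappa> hinv_h)
qed

lemma e_h: "e * j h = j ph"
proof -
  have "\<iota> ph * hinv * \<iota> h = \<iota> ph * (hinv * \<iota> h)" by (simp add: mult_ac)
  then show ?thesis by (simp only: e_def j_def mu_mult[symmetric] hinv_h mult_1_right)
qed

lemma e_eq: "e = mu hinv * j ph"
  by (simp add: e_def j_def mu_mult[symmetric] mult.commute)

lemma e_j: "e * j r = j r * e"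
  by (simp add: e_def j_def mu_commute)

text \<open>As ph h' / h = h' / \<kappa> = \<theta>, the product rule for \<open>ph\<close> times
  \<open>hinv\<close> yields \<open>pderiv ph - \<theta>\<close>.\<close>

lemma cm_Y_e: "cm Y e = j \<rho>"
proof -
  have "\<iota> h * fps_deriv (\<iota> ph * hinv) = (hinv * \<iota> h) * \<iota> (pderiv ph) - \<iota> ph * \<iota> (pderiv h) * hinv * (hinv * \<iota> h)"
    by (simp add: deriv_hinv \<iota>_pderiv algebra_simps)
  also have "\<dots> = \<iota> (pderiv ph) - \<iota> ph * \<iota> (pderiv h) * hinv" by (simp add: hinv_h)
  also have "\<iota> ph * \<iota> (pderiv h) * hinv = (hinv * \<iota> (ph * \<kappa>)) * \<iota> \<theta>"
    by (simp add: pderiv_h \<iota>_mult mult_ac)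
  finally have "\<iota> h * fps_deriv (\<iota> ph * hinv) = \<iota> (pderiv ph) - \<iota> \<theta>" by (simp add: ph_\<kappa> hinv_h)
  then show ?thesis unfolding e_def cm_Y_mu by (simp add: j_def \<rho>_def \<iota>_diff)
qed

lemma e_S_\<kappa>: "[:\<kappa>:] dvd f \<Longrightarrow> e * S f \<in> range S"
proof -
  assume "[:\<kappa>:] dvd f"
  then obtain k where "f = [:\<kappa>:] * k" ..
  then have "e * S f = e * j \<kappa> * S k" by (simp add: S_smult mult.assoc)
  then show ?thesis by (simp add: e_\<kappa>)
qed

lemma cm_S_e: "\<exists>k. cm (S f) e = S (smult \<rho> (pderiv f) + k) \<and> [:\<kappa>:] dvd k"
proof (induction f)
  case 0
  show ?case by (rule exI[of _ 0]) simp
next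
  case (pCons r f)
  obtain k1 where k1: "cm (S f) e = S (smult \<rho> (pderiv f) + k1)" "[:\<kappa>:] dvd k1" using pCons(2) by blast
  obtain k2 where k2: "S f * S [:\<rho>:] = S (f * [:\<rho>:] + k2)" "[:\<kappa>:] dvd k2" using S_mult_mod by blast
  have "cm (S (pCons r f)) e = S f * S [:\<rho>:] + cm (S f) e * Y"
    by (simp add: S_pCons cm_add_left cm_mult_left cm_Y_e) (simp add: cm_def e_j)
  also have "\<dots> = S (smult \<rho> (pderiv (pCons r f)) + (k2 + pCons 0 k1))"
    unfolding k1(1) k2(1) S_Y[symmetric] S_add[symmetric]
    by (simp add: pderiv_pCons smult_add_right algebra_simps)
  finally have "cm (S (pCons r f)) e = S (smult \<rho> (pderiv (pCons r f)) + (k2 + pCons 0 k1))" .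
  moreover have "[:\<kappa>:] dvd k2 + pCons 0 k1" using k1 k2 by (intro dvd_add) (auto simp: const_dvd_pCons)
  ultimately show ?case by blast
qed

text \<open>The product rule leaves \<open>e\<close> times three terms. In one, \<open>e\<close>
  meets the commutator of \<open>S f\<close> and \<open>S g\<close> and gives the Poisson part with
  factor \<open>ph\<close>; the two commutators with \<open>e\<close> give the part with factor
  \<open>\<rho>\<close>.\<close>

lemma cm_eS_eS: "\<exists>k. cm (e * S f) (e * S g) = e * S (br f g) + S k"
proof -
  obtain k1 where k1: "cm (S f) e = S (smult \<rho> (pderiv f) + k1)" "[:\<kappa>:] dvd k1" using cm_S_e by blast
  obtain k2 where k2: "cm (S g) e = S (smult \<rho> (pderiv g) + k2)" "[:\<kappa>:] dvd k2" using cm_S_e by blast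
  obtain k3 where k3: "cm (S f) (S g) = j h * S (pderiv f * dx g - pderiv g * dx f + k3)" "[:\<kappa>:] dvd k3"
    using cm_S_S by blast
  obtain k4 where k4: "cm (S f) e * S g = S ((smult \<rho> (pderiv f) + k1) * g + k4)" "[:\<kappa>:] dvd k4"
    unfolding k1(1) using S_mult_mod by blast
  obtain k5 where k5: "cm (S g) e * S f = S ((smult \<rho> (pderiv g) + k2) * f + k5)" "[:\<kappa>:] dvd k5"
    unfolding k2(1) using S_mult_mod by blast
  let ?k = "smult ph k3 + (k1 * g + k4) - (k2 * f + k5)"
  have "cm (e * S f) (e * S g) = e * (e * cm (S f) (S g) + cm (S f) e * S g - cm (S g) e * S f)"
    by (simp add: cm_def algebra_simps)
  also have "e * cm (S f) (S g) = S (smult ph (pderiv f * dx g - pderiv g * dx f + k3))"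
    unfolding k3(1) by (simp add: mult.assoc[symmetric] e_h S_smult)
  also have "S (smult ph (pderiv f * dx g - pderiv g * dx f + k3)) + cm (S f) e * S g - cm (S g) e * S f
      = S (br f g + ?k)"
    unfolding k4(1) k5(1) S_add[symmetric] S_diff[symmetric]
    by (simp add: br_def algebra_simps smult_add_right smult_diff_right)
  finally have *: "cm (e * S f) (e * S g) = e * S (br f g) + e * S ?k" by (simp add: S_add distrib_left)
  have "[:\<kappa>:] dvd ?k"
    using k1(2) k2(2) k3(2) k4(2) k5(2) by (intro dvd_add dvd_diff dvd_mult2 dvd_smult)
  then obtain k where "e * S ?k = S k" using e_S_\<kappa> by blast
  with * show ?thesis by auto
qed

lemma cm_eS_S: "cm (e * S f) (S g) \<in> range S"
proof -
  obtain k2 where k2: "cm (S g) e = S (smult \<rho> (pderiv g) + k2)" using cm_S_e by blast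
  obtain k3 where k3: "cm (S f) (S g) = j h * S (pderiv f * dx g - pderiv g * dx f + k3)"
    using cm_S_S by blast
  have "cm (e * S f) (S g) = e * cm (S f) (S g) - cm (S g) e * S f" by (simp add: cm_def algebra_simps)
  also have "e * cm (S f) (S g) = S (smult ph (pderiv f * dx g - pderiv g * dx f + k3))"
    unfolding k3(1) by (simp add: mult.assoc[symmetric] e_h S_smult)
  also have "cm (S g) e * S f \<in> range S" unfolding k2 by (rule range_S_mult) auto
  then obtain k where "cm (S g) e * S f = S k" by blast
  finally show ?thesis by (simp add: S_diff[symmetric])
qed

text \<open>The derivation \<open>D_g\<close> is inner in the operator ring, since \<open>g / h\<close> has an antiderivative there.\<close>

definition "sg g = mu (- fps_integral (\<iota> g * hinv) 0)"

lemma cm_sg_Y: "cm (sg g) Y = j g"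
proof -
  have "cm (sg g) Y = - cm Y (sg g)" by (rule cm_swap)
  also have "\<dots> = mu ((hinv * \<iota> h) * \<iota> g)"
    unfolding sg_def cm_Y_mu by (simp add: fps_deriv_fps_integral mu_minus[symmetric] mult_ac)
  finally show ?thesis by (simp add: hinv_h j_def)
qed

lemma cm_sg_j [simp]: "cm (sg g) (j r) = 0"
  by (simp add: sg_def j_def cm_mu)

lemma cm_sg_sg [simp]: "cm (sg g) (sg r) = 0"
  by (simp add: sg_def cm_mu)

lemma cm_sg_e [simp]: "cm (sg g) e = 0"
  by (simp add: sg_def e_def cm_mu)

lemma sg_add: "sg (a + b) = sg a + sg b"
proof -
  have "fps_integral (\<iota> (a + b) * hinv) 0 = fps_integral (\<iota> a * hinv) 0 + fps_integral (\<iota> b * hinv) 0"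
    by (rule fps_ext) (simp add: fps_integral_def \<iota>_add algebra_simps)
  then show ?thesis by (simp add: sg_def mu_add[symmetric])
qed

lemma sg_smult: "sg (smult c a) = scal c * sg a"
proof -
  have "fps_integral (\<iota> (smult c a) * hinv) 0 = fps_const c * fps_integral (\<iota> a * hinv) 0"
    by (rule fps_ext) (simp add: fps_integral_def \<iota>_smult algebra_simps)
  then show ?thesis by (simp add: sg_def scal_def mu_mult[symmetric] mu_minus)
qed

lemma cm_sg_S: "cm (sg g) (S f) \<in> range S"
proof (induction f)
  case (pCons r f)
  obtain k where "cm (sg g) (S f) = S k" using pCons(2) by blast
  then have "cm (sg g) (S (pCons r f)) = S f * S [:g:] + S (pCons 0 k)"
    by (simp add: S_pCons cm_add_right cm_mult_right cm_sg_Y)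
  moreover have "S f * S [:g:] \<in> range S" by (rule range_S_mult) auto
  ultimately show ?case by (auto simp: S_add[symmetric])
next
  case 0
  have "cm (sg g) (S 0) = S 0" by simp
  then show ?case by (metis rangeI)
qed

text \<open>A factor \<open>\<kappa>\<close> in the argument of \<open>sg\<close> reappears in the
  values, where \<open>e\<close> absorbs it. Hence the \<open>sg\<close> part of \<open>W\<close>
  brackets with \<open>e * S g\<close> into the range of \<open>S\<close>.\<close>

lemma cm_sg_S_\<kappa>: "\<exists>k. cm (sg (\<kappa> * s)) (S f) = S k \<and> [:\<kappa>:] dvd k"
proof (induction f)
  case (pCons r f)
  obtain k where k: "cm (sg (\<kappa> * s)) (S f) = S k" "[:\<kappa>:] dvd k" using pCons(2) by blast
  obtain k2 where k2: "S f * S [:\<kappa> * s:] = S (f * [:\<kappa> * s:] + k2)" "[:\<kappa>:] dvd k2"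
    using S_mult_mod by blast
  have "cm (sg (\<kappa> * s)) (S (pCons r f)) = S f * S [:\<kappa> * s:] + S (pCons 0 k)"
    by (simp add: S_pCons cm_add_right cm_mult_right cm_sg_Y k(1))
  then have "cm (sg (\<kappa> * s)) (S (pCons r f)) = S (f * [:\<kappa> * s:] + k2 + pCons 0 k)"
    unfolding k2(1) by (simp add: S_add)
  moreover have "[:\<kappa>:] dvd f * [:\<kappa> * s:] + k2 + pCons 0 k"
    using k k2 by (intro dvd_add dvd_mult) (auto simp: const_dvd_pCons)
  ultimately show ?case by blast
next
  case 0
  show ?case by (rule exI[of _ 0]) simp
qed

text \<open>Since \<kappa> / h = 1 / ph, \<open>sg (\<kappa> * s)\<close> is multiplication by minus
  an antiderivative of s / ph.\<close>

definition "W s f = sg (\<kappa> * s) + e * S f"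

lemma W_add: "W (s + t) (f + g) = W s f + W t g"
  by (simp add: W_def sg_add S_add algebra_simps)

lemma W_smult: "W (smult c s) (smult [:c:] f) = scal c * W s f"
proof -
  have "e * (scal c * S f) = scal c * (e * S f)" by (metis mult.assoc scal_central)
  then show ?thesis by (simp add: W_def sg_smult S_smult j_const distrib_left)
qed

lemma cm_W_S: "cm (W s f) (S g) \<in> range S"
proof -
  obtain a where "cm (sg (\<kappa> * s)) (S g) = S a" using cm_sg_S by blast
  moreover obtain b where "cm (e * S f) (S g) = S b" using cm_eS_S by blast
  ultimately have "cm (W s f) (S g) = S (a + b)" by (simp add: W_def cm_add_left S_add)
  then show ?thesis by simp
qed

lemma cm_W_W: "\<exists>k. cm (W s f) (W t g) = W 0 (br f g) + S k"
proof -
  have se: "\<exists>k. cm (sg (\<kappa> * s)) (e * S g) = S k" for s g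
  proof -
    obtain k where k: "cm (sg (\<kappa> * s)) (S g) = S k" "[:\<kappa>:] dvd k" using cm_sg_S_\<kappa> by blast
    then have "cm (sg (\<kappa> * s)) (e * S g) = e * S k" by (simp add: cm_mult_right)
    then show ?thesis using e_S_\<kappa>[OF k(2)] by auto
  qed
  obtain k1 where k1: "cm (sg (\<kappa> * s)) (e * S g) = S k1" using se by blast
  obtain k2 where k2: "cm (sg (\<kappa> * t)) (e * S f) = S k2" using se by blast
  obtain k3 where k3: "cm (e * S f) (e * S g) = e * S (br f g) + S k3" using cm_eS_eS by blast
  have "cm (e * S f) (sg (\<kappa> * t)) = - S k2" using cm_swap[of "e * S f" "sg (\<kappa> * t)"] k2 by simp
  then have "cm (W s f) (W t g) = e * S (br f g) + S (k1 + k3 - k2)"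
    unfolding W_def cm_add_left cm_add_right by (simp add: k1 k3 S_add S_diff)
  moreover have "sg 0 = 0" using sg_add[of 0 0] by simp
  ultimately show ?thesis by (auto simp: W_def)
qed

lemma cm_hinv_S_Y:
  "cm (mu hinv * S u) Y = mu hinv * S (smult (pderiv h) u - smult h (dx u))"
proof -
  have "cm (mu hinv) Y = - mu (\<iota> h * fps_deriv hinv)" using cm_swap[of "mu hinv" Y] cm_Y_mu by simp
  also have "\<iota> h * fps_deriv hinv = - (hinv * \<iota> h * (hinv * \<iota> (pderiv h)))"
    by (simp add: deriv_hinv mult_ac)
  finally have "cm (mu hinv) Y = mu hinv * j (pderiv h)" by (simp add: hinv_h mu_minus j_def mu_mult)
  then show ?thesis by (simp add: cm_mult_left cm_S_Y S_diff S_smult algebra_simps)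
qed

lemma e_S: "e * S g = mu hinv * S (smult ph g)"
  by (simp add: e_eq S_smult mult.assoc)

end

section \<open>Derivations of the operator image of A_h\<close>

context weyl
begin

lemma Y_eq_S: "Y = S [:0, 1:]"
  by (simp add: S_pCons)

lemma j_eq_S: "j r = S [:r:]"
  by (simp add: S_const)

definition der :: "('f lop \<Rightarrow> 'f lop) \<Rightarrow> bool" where
  "der D \<longleftrightarrow> (\<forall>a\<in>range S. \<forall>b\<in>range S. D (a + b) = D a + D b \<and> D (a * b) = D a * b + a * D b)
    \<and> (\<forall>c. \<forall>a\<in>range S. D (scal c * a) = scal c * D a)"

lemma der_cm: "der (cm U)"
  unfolding der_def
  by (intro conjI ballI allI cm_add_right cm_scal) (simp add: cm_mult_right add.commute)

lemma der_j_eq: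
  assumes "der D1" "der D2" "D1 (j x1) = D2 (j x1)"
  shows "D1 (j r) = D2 (j r)"
proof -
  have one: "D 1 = 0" if D: "der D" for D
  proof -
    have "1 \<in> range S" by (metis S_1 rangeI)
    then have "D (1 * 1) = D 1 * 1 + 1 * D 1" using D unfolding der_def by blast
    then show ?thesis by simp
  qed
  have step: "D (j (pCons c r)) = D (j x1) * j r + j x1 * D (j r)" if D: "der D" for D c r
  proof -
    have m: "j r \<in> range S" "scal c * 1 \<in> range S" "j x1 * j r \<in> range S" "1 \<in> range S" for r
      by (metis j_eq_S rangeI, metis j_const j_eq_S mult.right_neutral rangeI,
          metis j_mult j_eq_S rangeI, metis S_1 rangeI)
    have "pCons c r = [:c:] + x1 * r" by simp
    then have "j (pCons c r) = scal c * 1 + j x1 * j r" by (metis j_add j_const j_mult mult.right_neutral)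
    then have "D (j (pCons c r)) = D (scal c * 1) + D (j x1 * j r)"
      using D m(2,3) unfolding der_def by metis
    moreover have "D (scal c * 1) = scal c * D 1" using D m(4) unfolding der_def by blast
    moreover have "D (j x1 * j r) = D (j x1) * j r + j x1 * D (j r)" using D m(1) unfolding der_def by blast
    ultimately show ?thesis using one[OF D] by simp
  qed
  have zero: "D 0 = 0" if D: "der D" for D
  proof -
    have "0 \<in> range S" by (metis S_0 rangeI)
    then have "D (0 + 0) = D 0 + D 0" using D unfolding der_def by blast
    then show ?thesis by simp
  qed
  show ?thesis
  proof (induction r)
    case 0
    show ?case using zero[OF assms(1)] zero[OF assms(2)] by simp
  next
    case (pCons c r)
    show ?case using step[OF assms(1), of c r] step[OF assms(2), of c r] assms(3) pCons(2) by simp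
  qed
qed

lemma der_eqI:
  assumes D: "der D1" "der D2" and x: "D1 (j x1) = D2 (j x1)" and Y: "D1 Y = D2 Y"
  shows "D1 (S f) = D2 (S f)"
proof (induction f)
  case 0
  show ?case using der_j_eq[OF D x, of 0] by simp
next
  case (pCons r f)
  have m: "j r \<in> range S" "S f * Y \<in> range S" "S f \<in> range S" "Y \<in> range S"
    by (metis j_eq_S rangeI, metis S_Y rangeI, simp, metis Y_eq_S rangeI)
  have step: "D (S (pCons r f)) = D (j r) + (D (S f) * Y + S f * D Y)" if "der D" for D
    using that m unfolding der_def S_pCons by metis
  show ?case unfolding step[OF D(1)] step[OF D(2)] using pCons(2) Y der_j_eq[OF D x, of r] by simp
qed

text \<open>Integrate in t from the top coefficient downwards; the error in \<open>cm_S_j\<close>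
  has lower degree and is passed on. The normalization \<open>coeff g 0 = 0\<close> uses the freedom
  of adding a polynomial in x and later settles index 0 when divisibility by \<open>ph\<close> is
  shown.\<close>

lemma cm_S_x_surj:
  "\<exists>g. coeff g 0 = 0 \<and> cm (S g) (j x1) = j h * S f"
proof -
  have "\<exists>g. coeff g 0 = 0 \<and> cm (S g) (j x1) = j h * S f" if "\<forall>i\<ge>n. coeff f i = 0" for n f
    using that
  proof (induction n arbitrary: f)
    case 0
    then have "f = 0" by (simp add: poly_eq_iff)
    then show ?case by (intro exI[of _ 0]) simp
  next
    case (Suc n)
    obtain b :: "'f poly" where b: "of_nat (Suc n) * b = coeff f n" using of_nat_mult_surj_poly by blast
    let ?g = "monom b (Suc n)"
    obtain k where k: "cm (S ?g) (j x1) = j h * S (smult (pderiv x1) (pderiv ?g) + k)"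
      "\<forall>i. degree ?g \<le> Suc i \<longrightarrow> coeff k i = 0" using cm_S_j by blast
    have dg: "pderiv ?g = monom (coeff f n) n"
      using b by (simp add: pderiv_monom del: of_nat_Suc)
    have "degree ?g \<le> Suc n" by (rule degree_monom_le)
    have "coeff (f - monom (coeff f n) n - k) i = 0" if i: "i \<ge> n" for i
    proof -
      have "degree ?g \<le> Suc i" using \<open>degree ?g \<le> Suc n\<close> i by simp
      then have "coeff k i = 0" using k(2) by blast
      then show ?thesis using Suc.prems i by (cases "i = n") auto
    qed
    then obtain g2 where g2: "coeff g2 0 = 0" "cm (S g2) (j x1) = j h * S (f - monom (coeff f n) n - k)"
      using Suc.IH by blast
    have "cm (S (?g + g2)) (j x1) = j h * S (monom (coeff f n) n + k + (f - monom (coeff f n) n - k))"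
      unfolding S_add[of ?g] cm_add_left g2(2) k(1) dg
      by (simp add: pderiv_pCons smult_const_1 S_add S_diff algebra_simps)
    moreover have "coeff (?g + g2) 0 = 0" using g2(1) by simp
    ultimately show ?case by (intro exI[of _ "?g + g2"]) simp
  qed
  moreover have "\<forall>i\<ge>Suc (degree f). coeff f i = 0" by (simp add: coeff_eq_0)
  ultimately show ?thesis by blast
qed

lemma cm_ej_Y: "cm (e * j r) Y = j (T r)"
proof -
  have "cm e Y = - j \<rho>" "cm (j r) Y = - j (h * pderiv r)"
    using cm_swap[of e Y] cm_swap[of "j r" Y] by (simp_all add: cm_Y_e cm_Y_j)
  then have "cm (e * j r) Y = - (e * j h * j (pderiv r)) - j \<rho> * j r"
    by (simp add: cm_mult_left j_mult mult.assoc)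
  then show ?thesis
    by (simp add: e_h T_def j_minus j_diff j_mult j_commute)
qed

lemma cm_hinv_j: "cm (mu hinv) (j r) = 0"
  by (simp add: j_def cm_mu)

lemma cm_e_j: "cm e (j r) = 0"
  by (simp add: cm_def e_j)

lemma j_h_hinv: "j h * (mu hinv * a) = a"
proof -
  have "j h * mu hinv = 1" using mu_hinv_j_h by (metis j_def mu_commute)
  then show ?thesis by (simp add: mult.assoc[symmetric])
qed

lemma derivation_eq_cm_W:
  assumes D: "der D" and cl: "\<And>a. a \<in> range S \<Longrightarrow> D a \<in> range S"
  shows "\<exists>s f. \<forall>a. D (S a) = cm (W s f) (S a)"
proof -
  obtain f0 where f0: "D (j x1) = S f0" using cl[of "j x1"] j_eq_S by blast
  obtain d where d: "D Y = S d" using cl[of Y] Y_eq_S by blast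
  obtain g0 where g0: "coeff g0 0 = 0" "cm (S g0) (j x1) = j h * S f0" using cm_S_x_surj by blast
  \<comment> \<open>\<open>mu hinv\<close> commutes with x and cancels the factor \<open>h\<close>
    in the choice of \<open>g0\<close>.\<close>
  define w where "w = mu hinv * S g0"
  have wx: "cm w (j x1) = S f0"
    unfolding w_def cm_mult_left g0(2) cm_hinv_j by (simp add: mult.assoc[symmetric] mu_hinv_j_h)
  define v where "v = S d - cm w Y"
  \<comment> \<open>\<open>D\<close> and \<open>cm w\<close> are both applied to the relation that
    the commutator of \<open>Y\<close> and x is h. They agree on x, hence on h, so their values at
    \<open>Y\<close> differ by something that commutes with x.\<close>
  have "cm v (j x1) = 0"
  proof -
    have rel: "D' (j h) = cm (D' Y) (j x1) + cm Y (D' (j x1))" if D': "der D'" for D'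
    proof -
      have m: "Y * j x1 \<in> range S" "j x1 * Y \<in> range S" "j h \<in> range S" "Y \<in> range S" "j x1 \<in> range S"
        using range_S_mult[of Y "j x1"] range_S_mult[of "j x1" Y] Y_eq_S j_eq_S by auto
      have "Y * j x1 = j x1 * Y + j h" using cm_Y_j[of x1] by (simp add: cm_def pderiv_pCons algebra_simps)
      then have "D' (Y * j x1) = D' (j x1 * Y) + D' (j h)" using D' m unfolding der_def by metis
      moreover have "D' (Y * j x1) = D' Y * j x1 + Y * D' (j x1)" using D' m unfolding der_def by blast
      moreover have "D' (j x1 * Y) = D' (j x1) * Y + j x1 * D' Y" using D' m unfolding der_def by blast
      ultimately show ?thesis by (simp add: cm_def algebra_simps)
    qed
    have "D (j h) = cm w (j h)" using der_j_eq[OF D der_cm] f0 wx by simp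
    then have "cm (D Y) (j x1) + cm Y (D (j x1)) = cm (cm w Y) (j x1) + cm Y (cm w (j x1))"
      using rel[OF D] rel[OF der_cm, of w] by simp
    then show ?thesis by (simp add: v_def cm_diff_left d f0 wx)
  qed
  \<comment> \<open>Multiplication by \<open>h\<close> clears \<open>mu hinv\<close> and brings
    \<open>v\<close> into the range of \<open>S\<close>.\<close>
  define m where "m = smult h d - (smult (pderiv h) g0 - smult h (dx g0))"
  have jv: "j h * v = S m"
    unfolding v_def w_def cm_hinv_S_Y m_def right_diff_distrib j_h_hinv by (simp add: S_diff S_smult)
  have "cm (S m) (j x1) = 0"
    using \<open>cm v (j x1) = 0\<close> by (simp add: jv[symmetric] cm_mult_left) (simp add: cm_def j_commute)
  then have "degree m = 0" by (rule S_comm_x)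
  \<comment> \<open>Since \<open>m\<close> is free of t, its coefficients at positive indices
    vanish, which makes \<open>h\<close> divide \<open>pderiv h * coeff g0 n\<close>: the condition
    that defines \<open>ph\<close>.\<close>
  have "ph dvd coeff g0 n" for n
  proof (cases n)
    case (Suc i)
    have "coeff m n = 0" using \<open>degree m = 0\<close> Suc by (simp add: coeff_eq_0)
    then have "pderiv h * coeff g0 n = h * (coeff d n + pderiv (coeff g0 n))"
      by (simp add: m_def algebra_simps)
    then have "h dvd pderiv h * coeff g0 n" by simp
    then show ?thesis by (simp add: ph_iff)
  qed (simp add: g0)
  then have "[:ph:] dvd g0" by (simp add: const_dvd_iff)
  then obtain g where g: "g0 = smult ph g" by (auto elim!: dvdE)
  have w: "w = e * S g" unfolding w_def e_S g ..
  have "m = [:coeff m 0:]" using \<open>degree m = 0\<close> by (metis degree_0_id)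
  moreover have "coeff m 0 = h * coeff d 0" by (simp add: m_def g0(1))
  ultimately have "j h * v = j h * j (coeff d 0)" using jv by (metis S_const j_mult)
  then have v: "v = j (coeff d 0)" by (rule j_h_cancel)
  \<comment> \<open>Hermite reduction splits the remaining value at \<open>Y\<close> between
    \<open>sg\<close> and \<open>e * j r\<close>.\<close>
  obtain r s where rs: "coeff d 0 = \<kappa> * s + T r" using T_decomposition by blast
  have W: "W s (g + [:r:]) = sg (\<kappa> * s) + w + e * j r"
    by (simp add: W_def w S_add S_const distrib_left)
  show ?thesis
  proof (intro exI allI)
    fix a
    show "D (S a) = cm (W s (g + [:r:])) (S a)"
    proof (rule der_eqI[OF D der_cm])
      show "D (j x1) = cm (W s (g + [:r:])) (j x1)"
        unfolding W cm_add_left wx f0 by (simp add: cm_mult_left cm_e_j) (simp add: cm_def j_commute)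
      have "cm (W s (g + [:r:])) Y = j (\<kappa> * s) + cm w Y + j (T r)"
        unfolding W cm_add_left by (simp add: cm_sg_Y cm_ej_Y)
      also have "\<dots> = cm w Y + v" by (simp add: v rs j_add)
      finally show "D Y = cm (W s (g + [:r:])) Y" by (simp add: v_def d)
    qed
  qed
qed

text \<open>If the derivation is inner, the values at x make the positive coefficients of
  \<open>f\<close> multiples of \<open>\<kappa>\<close>, and the values at \<open>Y\<close> give
  \<open>\<kappa> * s + T (coeff f 0) = - (h * pderiv (coeff g 0))\<close>. Injectivity of
  \<open>T\<close> modulo \<open>\<kappa>\<close> settles the constant coefficient, and
  \<open>T_\<kappa>_mult\<close> then leaves \<open>s\<close> as a multiple of
  \<open>ph\<close>.\<close>

lemma W_inner_iff:
  "(\<exists>g. \<forall>a. cm (W s f) (S a) = cm (S g) (S a)) \<longleftrightarrow> ph dvd s \<and> [:\<kappa>:] dvd f"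
proof
  assume "ph dvd s \<and> [:\<kappa>:] dvd f"
  then obtain s' k where s': "s = ph * s'" and k: "f = [:\<kappa>:] * k" by (meson dvdE)
  have "\<exists>d. of_nat (Suc n) * d = c" for n and c :: 'f
    by (rule exI[of _ "c / of_nat (Suc n)"]) (simp del: of_nat_Suc)
  then obtain r where r: "pderiv r = s'" using pderiv_surj by blast
  have "\<kappa> * s = ph * \<kappa> * s'" by (simp add: s' mult_ac)
  then have "\<kappa> * s = h * s'" unfolding ph_\<kappa> .
  moreover have "e * S f = S k" using e_\<kappa> by (simp add: k S_smult mult.assoc[symmetric])
  ultimately have W: "W s f = sg (h * s') + S k" by (simp add: W_def)
  \<comment> \<open>Here the integrand is the polynomial \<open>s'\<close>, and its antiderivative
    \<open>r\<close> lies in R; this is why multiples of \<open>ph\<close> give inner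
    derivations.\<close>
  have "cm (sg (h * s')) (S a) = cm (- j r) (S a)" for a
  proof (rule der_eqI[OF der_cm der_cm])
    show "cm (sg (h * s')) (j x1) = cm (- j r) (j x1)" by (simp add: cm_def j_commute sg_def) (simp add: j_def mu_commute)
    show "cm (sg (h * s')) Y = cm (- j r) Y"
      using cm_Y_j[of r] by (simp add: cm_sg_Y r) (simp add: cm_def algebra_simps)
  qed
  then have "cm (W s f) (S a) = cm (S (k - [:r:])) (S a)" for a
    unfolding W cm_add_left S_diff S_const by (simp add: cm_def algebra_simps)
  then show "\<exists>g. \<forall>a. cm (W s f) (S a) = cm (S g) (S a)" by blast
next
  assume "\<exists>g. \<forall>a. cm (W s f) (S a) = cm (S g) (S a)"
  then obtain g where g: "cm (W s f) (S a) = cm (S g) (S a)" for a by blast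
  define u where "u = smult ph f"
  have eS: "e * S f = mu hinv * S u" by (simp add: u_def e_S)
  have "cm (W s f) (j x1) = mu hinv * cm (S u) (j x1)"
    by (simp add: W_def eS cm_add_left cm_mult_left cm_hinv_j)
  then have "mu hinv * cm (S u) (j x1) = cm (S g) (j x1)" using g[of "[:x1:]"] by (simp add: S_const)
  then have "cm (S u) (j x1) = j h * cm (S g) (j x1)" by (metis j_h_hinv)
  also have "\<dots> = cm (S (smult h g)) (j x1)" by (simp add: S_smult cm_mult_left) (simp add: cm_def j_commute)
  finally have "cm (S (u - smult h g)) (j x1) = 0" by (simp add: S_diff cm_diff_left)
  then have deg: "degree (u - smult h g) = 0" by (rule S_comm_x)
  have "\<kappa> dvd coeff f (Suc n)" for n
  proof -
    have "coeff (u - smult h g) (Suc n) = 0" by (rule coeff_eq_0) (simp add: deg)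
    then have "ph * coeff f (Suc n) = ph * (\<kappa> * coeff g (Suc n))"
      by (simp add: u_def mult.assoc[symmetric] ph_\<kappa>)
    then show ?thesis using ph_nonzero by simp
  qed
  have "cm (W s f) Y = j (\<kappa> * s) + mu hinv * S (smult (pderiv h) u - smult h (dx u))"
    by (simp add: W_def eS cm_add_left cm_sg_Y cm_hinv_S_Y)
  then have "j (\<kappa> * s) + mu hinv * S (smult (pderiv h) u - smult h (dx u)) = - (j h * S (dx g))"
    using g[of "[:0, 1:]"] by (simp add: Y_eq_S[symmetric] cm_S_Y)
  then have "j h * (j (\<kappa> * s) + mu hinv * S (smult (pderiv h) u - smult h (dx u))) = j h * - (j h * S (dx g))"
    by simp
  then have "S ([:h * (\<kappa> * s):] + (smult (pderiv h) u - smult h (dx u))) = S (- smult (h * h) (dx g))"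
    by (simp add: distrib_left j_h_hinv S_add S_const S_minus S_smult j_mult mult.assoc)
  then have "[:h * (\<kappa> * s):] + (smult (pderiv h) u - smult h (dx u)) = - smult (h * h) (dx g)"
    by (simp add: S_inject)
  from arg_cong[OF this, of "\<lambda>p. coeff p 0"]
  have eq: "h * (\<kappa> * s) + (pderiv h * (ph * coeff f 0) - h * pderiv (ph * coeff f 0)) = - (h * h * pderiv (coeff g 0))"
    by (simp add: u_def mult.assoc)
  have "pderiv h * (ph * coeff f 0) = h * (\<theta> * coeff f 0)"
    unfolding pderiv_h using ph_\<kappa> by (metis mult.assoc mult.commute)
  from eq[unfolded this] have "h * (\<kappa> * s + T (coeff f 0)) = h * - (h * pderiv (coeff g 0))"
    by (simp add: T_def \<rho>_def pderiv_mult algebra_simps)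
  then have main: "\<kappa> * s + T (coeff f 0) = - (h * pderiv (coeff g 0))"
    using h_nonzero mult_left_cancel by blast
  have "\<kappa> dvd h * pderiv (coeff g 0)" using \<kappa>_dvd_h by simp
  then have "\<kappa> dvd T (coeff f 0)" using main
    by (metis dvd_add_right_iff dvd_minus_iff dvd_triv_left)
  then have f0: "\<kappa> dvd coeff f 0" by (rule T_inj_mod_\<kappa>)
  then obtain r where r: "coeff f 0 = \<kappa> * r" ..
  have "\<kappa> * s = \<kappa> * (ph * (pderiv r - pderiv (coeff g 0)))"
  proof -
    have "\<kappa> * s = h * (pderiv r - pderiv (coeff g 0))" using main unfolding r T_\<kappa>_mult by (simp add: algebra_simps)
    then show ?thesis using ph_\<kappa> by (metis mult.assoc mult.commute)
  qed
  then have "s = ph * (pderiv r - pderiv (coeff g 0))" using \<kappa>_nonzero mult_left_cancel by blast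
  then have "ph dvd s" by simp
  moreover have "\<kappa> dvd coeff f n" for n using f0 \<open>\<And>n. \<kappa> dvd coeff f (Suc n)\<close> by (cases n) auto
  ultimately show "ph dvd s \<and> [:\<kappa>:] dvd f" by (simp add: const_dvd_iff)
qed

text \<open>Passing \<open>h\<close> through \<open>dd\<close> costs a multiple of the derivative of
  \<open>h\<close>, which \<open>\<kappa>\<close> divides. So h^n y^n and \<open>Y ^ n\<close> have
  the same normal form modulo \<open>\<kappa>\<close>.\<close>

lemma h_power_dd_power: "\<exists>c. j (h ^ n) * dd ^ n = S c \<and> [:\<kappa>:] dvd c - monom 1 n"
proof (induction n)
  case 0
  show ?case by (rule exI[of _ 1]) simp
next
  case (Suc n)
  then obtain c where c: "j (h ^ n) * dd ^ n = S c" "[:\<kappa>:] dvd c - monom 1 n" by blast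
  let ?c = "pCons 0 c + smult h (dx c) - smult (of_nat (Suc n) * pderiv h) c"
  have "dd * j (h ^ Suc n) = j (h ^ Suc n) * dd + j (pderiv (h ^ Suc n))"
    by (simp add: j_def dd_mu \<iota>_pderiv del: power_Suc)
  moreover have "pderiv (h ^ Suc n) = of_nat (Suc n) * pderiv h * h ^ n"
    by (simp only: pderiv_power_Suc) (simp add: of_nat_poly mult_ac del: of_nat_Suc power_Suc)
  ultimately have "j (h ^ Suc n) * dd = dd * j (h ^ Suc n) - j (of_nat (Suc n) * pderiv h) * j (h ^ n)"
    by (simp add: j_mult del: of_nat_Suc power_Suc)
  also have "dd * j (h ^ Suc n) = Y * j (h ^ n)" by (simp add: Y_def j_mult mult.assoc)
  finally have "j (h ^ Suc n) * dd ^ Suc n = Y * (j (h ^ n) * dd ^ n) - j (of_nat (Suc n) * pderiv h) * (j (h ^ n) * dd ^ n)"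
    by (simp add: mult.assoc[symmetric] left_diff_distrib power_Suc del: of_nat_Suc)
  also have "\<dots> = S ?c" unfolding c(1) Y_S by (simp add: S_diff S_smult del: of_nat_Suc)
  finally have 1: "j (h ^ Suc n) * dd ^ Suc n = S ?c" .
  have "?c - monom 1 (Suc n) = pCons 0 (c - monom 1 n) + smult h (dx c) - smult (of_nat (Suc n) * pderiv h) c"
    by (simp add: monom_Suc)
  moreover have "[:\<kappa>:] dvd pCons 0 (c - monom 1 n) + smult h (dx c) - smult (of_nat (Suc n) * pderiv h) c"
    using c(2) \<kappa>_dvd_smult_h[of "dx c"]
    by (intro dvd_diff dvd_add) (auto simp: const_dvd_pCons, simp add: const_dvd_iff pderiv_h)
  ultimately show ?case using 1 by metis
qed

definition "a_op n = (case n of 0 \<Rightarrow> j ph * mu hinv | Suc m \<Rightarrow> j (ph * h ^ m) * dd ^ n)"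

text \<open>a_n is a_0 h^n y^n, and \<open>e\<close> absorbs the difference between h^n y^n and
  \<open>Y ^ n\<close>.\<close>

lemma a_op_eq: "\<exists>k. j r * a_op n = W 0 (monom r n) + S k"
proof -
  obtain c where c: "j (h ^ n) * dd ^ n = S c" "[:\<kappa>:] dvd c - monom 1 n" using h_power_dd_power by blast
  have "a_op n = e * (j (h ^ n) * dd ^ n)"
  proof (cases n)
    case 0
    then show ?thesis by (simp add: a_op_def e_def j_def mu_mult)
  next
    case (Suc m)
    have "e * (j (h ^ n) * dd ^ n) = e * j h * j (h ^ m) * dd ^ n" by (simp add: Suc j_mult mult.assoc)
    then show ?thesis by (simp add: Suc a_op_def e_h j_mult mult.assoc)
  qed
  then have "j r * a_op n = e * S (smult r c)"
    unfolding c(1) by (simp add: S_smult mult.assoc[symmetric] e_j)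
  also have "smult r c = monom r n + smult r (c - monom 1 n)"
    by (simp add: smult_diff_right smult_monom)
  finally have "j r * a_op n = e * S (monom r n) + e * S (smult r (c - monom 1 n))"
    by (simp add: S_add distrib_left)
  moreover have "e * S (smult r (c - monom 1 n)) \<in> range S"
    using c(2) by (intro e_S_\<kappa> dvd_smult)
  moreover have "sg 0 = 0" using sg_add[of 0 0] by simp
  ultimately show ?thesis by (auto simp: W_def)
qed

end

section \<open>Faithful representation of the presented algebras\<close>

lemma poly_mapping_single_induct:
  fixes p :: "'k \<Rightarrow>\<^sub>0 'c::comm_monoid_add"
  assumes "Q 0" "\<And>k c. Q (Poly_Mapping.single k c)" "\<And>p q. Q p \<Longrightarrow> Q q \<Longrightarrow> Q (p + q)"
  shows "Q p"
proof -
  have "Q (\<Sum>k\<in>K. Poly_Mapping.single k (Poly_Mapping.lookup p k))" if "finite K" for K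
    using that by (induction K rule: finite_induct) (use assms in auto)
  then have "Q (pm_sum Poly_Mapping.single p)" by (simp add: pm_sum_def)
  then show ?thesis by (simp add: pm_sum_expand)
qed

section \<open>Free algebras and their evaluations\<close>

abbreviation fscal :: "'f::field \<Rightarrow> ('f, 'g) free" where
  "fscal c \<equiv> Poly_Mapping.single 0 c"

lemma map_mult_0: "Poly_Mapping.map ((*) c) 0 = 0" for c :: "'c::mult_zero"
  by (rule poly_mapping_eqI) (simp add: lookup_map_mult)

lemma map_mult_eq_fscal: "Poly_Mapping.map ((*) c) p = fscal c * p"
  for p :: "('f::field, 'g) free"
  by (induction p rule: poly_mapping_single_induct)
    (simp_all add: map_mult_0 map_mult_single map_mult_add mult_single distrib_left)

lemma fscal_commute: "fscal c * p = p * fscal c"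
  for p :: "('f::field, 'g) free"
  by (induction p rule: poly_mapping_single_induct)
    (simp_all add: mult_single algebra_simps)

lemma single_Word_Cons: "Poly_Mapping.single (Word (g # w)) c = gen g * Poly_Mapping.single (Word w) c"
  by (simp add: gen_def mult_single plus_word_def)

lemma free_algebra_simps:
  "carr free_algebra = UNIV" "zer free_algebra = 0" "pls free_algebra = (+)"
  "scl free_algebra = (\<lambda>c p. fscal c * p)" "mlt free_algebra = (*)"
  "mns free_algebra = (-)"
  by (simp_all add: free_algebra_def mns_def map_mult_eq_fscal[symmetric] map_mult_uminus_1 fun_eq_iff)

lemma free_f_algebra: "f_algebra free_algebra"
proof
  fix c :: "'a::field" and a b :: "('a, 'b) free"
  show "a \<star>\<^bsub>free_algebra\<^esub> (c \<odot>\<^bsub>free_algebra\<^esub> b) = c \<odot>\<^bsub>free_algebra\<^esub> (a \<star>\<^bsub>free_algebra\<^esub> b)"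
    by (simp add: free_algebra_simps) (metis fscal_commute mult.assoc)
  show "c \<odot>\<^bsub>free_algebra\<^esub> (d \<odot>\<^bsub>free_algebra\<^esub> a) = (c * d) \<odot>\<^bsub>free_algebra\<^esub> a" for d
    by (simp add: free_algebra_simps mult.assoc[symmetric] mult_single)
qed (simp_all add: free_algebra_simps distrib_left distrib_right single_add add.assoc add.commute mult.assoc)

locale evaluation =
  fixes sc :: "'f::field \<Rightarrow> 'r::ring_1" and \<phi> :: "'g \<Rightarrow> 'r"
  assumes sc_add: "sc (c + d) = sc c + sc d" and sc_mult: "sc (c * d) = sc c * sc d"
    and sc_1: "sc 1 = 1" and sc_central: "sc c * a = a * sc c"
begin

definition ev :: "('f, 'g) free \<Rightarrow> 'r" where
  "ev = pm_sum (\<lambda>w c. sc c * prod_list (map \<phi> (letters w)))"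

lemma sc_0: "sc 0 = 0"
  using sc_add[of 0 0] by simp

lemma ev_add: "ev (p + q) = ev p + ev q"
  unfolding ev_def by (rule pm_sum_add) (simp_all add: sc_0 sc_add distrib_right)

lemma ev_0: "ev 0 = 0"
  by (simp add: ev_def)

lemma ev_diff: "ev (p - q) = ev p - ev q"
  using ev_add[of "p - q" q] by simp

lemma ev_single: "ev (Poly_Mapping.single w c) = sc c * prod_list (map \<phi> (letters w))"
  unfolding ev_def by (subst pm_sum_single) (simp_all add: sc_0)

lemma ev_mult: "ev (p * q) = ev p * ev q"
proof (induction p rule: poly_mapping_single_induct)
  case (2 v c)
  show ?case
  proof (induction q rule: poly_mapping_single_induct)
    case (2 w d)
    have "sc (c * d) * (prod_list (map \<phi> (letters v)) * prod_list (map \<phi> (letters w)))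
      = sc c * prod_list (map \<phi> (letters v)) * (sc d * prod_list (map \<phi> (letters w)))"
      by (simp add: sc_mult mult.assoc) (metis mult.assoc sc_central)
    then show ?case by (simp add: mult_single ev_single plus_word_def)
  qed (simp_all add: ev_0 ev_add distrib_left)
qed (simp_all add: ev_0 ev_add distrib_right)

lemma ev_fscal: "ev (fscal c) = sc c"
  by (simp add: ev_single zero_word_def)

lemma ev_1: "ev 1 = 1"
  using ev_fscal[of 1] by (simp add: sc_1)

lemma ev_gen: "ev (gen g) = \<phi> g"
  by (simp add: gen_def ev_single sc_1)

lemma ev_power: "ev (p ^ n) = ev p ^ n"
  by (induction n) (simp_all add: ev_1 ev_mult)

lemma ev_unique:
  assumes "f 0 = 0" "\<And>p q. f (p + q) = f p + f q" "\<And>p q. f (p * q) = f p * f q"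
    "\<And>c. f (fscal c) = sc c" "\<And>g. f (gen g) = \<phi> g"
  shows "f p = ev p"
proof (induction p rule: poly_mapping_single_induct)
  case (2 w c)
  have "f (Poly_Mapping.single (Word l) c) = ev (Poly_Mapping.single (Word l) c)" for l
  proof (induction l)
    case Nil
    then show ?case using assms(4)[of c] ev_fscal[of c] by (simp add: zero_word_def)
  next
    case (Cons g l)
    then show ?case by (simp add: single_Word_Cons assms(3,5) ev_mult ev_gen)
  qed
  then show ?case by (metis word.exhaust)
qed (simp_all add: assms ev_0 ev_add)

end

section \<open>Polynomials in an element of a free algebra\<close>

lemma poly_at_sum: "degree r \<le> N \<Longrightarrow> poly_at r a = (\<Sum>i\<le>N. fscal (coeff r i) * a ^ i)"
  unfolding poly_at_def by (intro sum.mono_neutral_left) (auto simp: coeff_eq_0)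

lemma poly_at_pCons: "poly_at (pCons c r) a = fscal c + a * poly_at r a"
proof -
  have "poly_at (pCons c r) a = (\<Sum>i\<le>Suc (degree r). fscal (coeff (pCons c r) i) * a ^ i)"
    by (rule poly_at_sum) (rule degree_pCons_le)
  also have "\<dots> = fscal c + (\<Sum>i\<le>degree r. fscal (coeff r i) * a ^ Suc i)"
    by (simp add: sum.atMost_Suc_shift del: sum.atMost_Suc)
  also have "(\<Sum>i\<le>degree r. fscal (coeff r i) * a ^ Suc i) = a * poly_at r a"
    unfolding poly_at_def sum_distrib_left
    by (intro sum.cong refl) (metis fscal_commute mult.assoc power_Suc)
  finally show ?thesis .
qed

lemma poly_at_0 [simp]: "poly_at 0 a = 0"
  by (simp add: poly_at_def)

lemma poly_at_1 [simp]: "poly_at 1 a = 1"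
  by (simp add: one_pCons poly_at_pCons)

lemma poly_at_add: "poly_at (r + s) a = poly_at r a + poly_at s a"
  by (induction r s rule: poly_induct2) (simp_all add: poly_at_pCons single_add algebra_simps)

lemma poly_at_commute: "a * poly_at r a = poly_at r a * a"
proof (induction r)
  case (pCons c r)
  have "a * fscal c = fscal c * a" by (rule fscal_commute[symmetric])
  then show ?case
    by (simp add: poly_at_pCons distrib_left distrib_right mult.assoc pCons(2)[symmetric])
qed simp

lemma poly_at_smult: "poly_at (smult c r) a = fscal c * poly_at r a"
proof (induction r)
  case (pCons d r)
  have "a * (fscal c * poly_at r a) = fscal c * (a * poly_at r a)" by (metis fscal_commute mult.assoc)
  then show ?case using pCons(2) by (simp add: poly_at_pCons distrib_left mult_single)
qed simp

lemma poly_at_mult: "poly_at (r * s) a = poly_at r a * poly_at s a"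
  by (induction r) (simp_all add: poly_at_pCons poly_at_add poly_at_smult distrib_right mult.assoc)

lemma poly_at_mult_commute: "poly_at r a * poly_at s a = poly_at s a * poly_at r a"
  by (metis mult.commute poly_at_mult)

locale two_sided_ideal =
  fixes I :: "('f::field, 'g) free set"
  assumes I_0: "0 \<in> I" and I_add: "p \<in> I \<Longrightarrow> q \<in> I \<Longrightarrow> p + q \<in> I"
    and I_left: "p \<in> I \<Longrightarrow> q * p \<in> I" and I_right: "p \<in> I \<Longrightarrow> p * q \<in> I"
begin

lemma I_minus: "p \<in> I \<Longrightarrow> - p \<in> I"
  using I_left[of p "- 1"] by simp

lemma I_diff: "p \<in> I \<Longrightarrow> q \<in> I \<Longrightarrow> p - q \<in> I"
  using I_add[OF _ I_minus, of p q] by simp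

end

text \<open>Used three times: for x and yh in the presentation of A_h, and in the localized algebra
  for x and y, with 1 in place of \<open>h\<close>, and for x and yh.\<close>

locale ore_relation = two_sided_ideal I for I :: "('f::field, 'g) free set" +
  fixes a b :: "('f, 'g) free" and h :: "'f poly"
  assumes relation: "b * a - a * b - poly_at h a \<in> I"
begin

lemma relation_poly: "b * poly_at r a - poly_at r a * b - poly_at (h * pderiv r) a \<in> I"
proof (induction r)
  case 0
  show ?case by (simp add: I_0)
next
  case (pCons c r)
  have "b * poly_at (pCons c r) a - poly_at (pCons c r) a * b - poly_at (h * pderiv (pCons c r)) a
    = (b * a - a * b - poly_at h a) * poly_at r a
      + a * (b * poly_at r a - poly_at r a * b - poly_at (h * pderiv r) a)"
  proof -
    have "poly_at (h * pderiv (pCons c r)) a = poly_at h a * poly_at r a + a * poly_at (h * pderiv r) a"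
    proof -
      have "h * pderiv (pCons c r) = h * r + [:0, 1:] * (h * pderiv r)"
        by (simp add: pderiv_pCons algebra_simps)
      also have "poly_at \<dots> a = poly_at h a * poly_at r a + poly_at [:0, 1:] a * poly_at (h * pderiv r) a"
        by (simp only: poly_at_add poly_at_mult)
      also have "poly_at [:0, 1:] a = a" by (simp add: poly_at_pCons)
      finally show ?thesis .
    qed
    then show ?thesis by (simp add: poly_at_pCons algebra_simps fscal_commute)
  qed
  then show ?case using I_right[OF relation] I_left[OF pCons(2)] I_add by simp
qed

text \<open>The formal counterpart of \<open>S\<close>.\<close>

definition FS :: "'f poly poly \<Rightarrow> ('f, 'g) free" where
  "FS f = fold_coeffs (\<lambda>r u. poly_at r a + u * b) f 0"

lemma FS_0 [simp]: "FS 0 = 0"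
  by (simp add: FS_def)

lemma FS_pCons: "FS (pCons r f) = poly_at r a + FS f * b"
  by (cases "r = 0 \<and> f = 0") (auto simp: FS_def)

lemma FS_add: "FS (f + g) = FS f + FS g"
  by (induction f g rule: poly_induct2) (simp_all add: FS_pCons poly_at_add algebra_simps)

lemma FS_smult: "FS (smult r f) = poly_at r a * FS f"
  by (induction f) (simp_all add: FS_pCons poly_at_mult distrib_left mult.assoc)

lemma FS_minus: "FS (- f) = - FS f"
proof -
  have "FS (- f) + FS f = FS (- f + f)" by (simp only: FS_add)
  then show ?thesis by (simp add: eq_neg_iff_add_eq_0)
qed

lemma b_FS: "b * FS f - FS (pCons 0 f + smult h (dx f)) \<in> I"
proof (induction f)
  case 0
  show ?case by (simp add: I_0)
next
  case (pCons r f)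
  have "b * FS (pCons r f) - FS (pCons 0 (pCons r f) + smult h (dx (pCons r f)))
    = (b * poly_at r a - poly_at r a * b - poly_at (h * pderiv r) a)
      + (b * FS f - FS (pCons 0 f + smult h (dx f))) * b"
    by (simp add: FS_pCons FS_add dx_pCons algebra_simps)
  then show ?case using I_add[OF relation_poly[of r] I_right[OF pCons(2), of b]] by simp
qed

end

lemma ideal_free_iff:
  "ideal free_algebra I \<longleftrightarrow> two_sided_ideal (I :: ('f::field, 'g) free set)"
  unfolding ideal_def subspace_def two_sided_ideal_def free_algebra_simps by blast

lemma two_sided_rel_ideal: "two_sided_ideal (rel_ideal \<rho>)"
  unfolding two_sided_ideal_def rel_ideal_def ideal_gen_def
  by (auto simp: ideal_free_iff two_sided_ideal_def)

lemma rel_ideal_base: "\<rho> \<subseteq> rel_ideal \<rho>"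
  by (auto simp: rel_ideal_def ideal_gen_def)

lemma rel_ideal_ideal: "ideal free_algebra (rel_ideal \<rho>)"
  unfolding ideal_free_iff by (rule two_sided_rel_ideal)

context evaluation
begin

lemma ev_rel_ideal:
  assumes "\<And>p. p \<in> \<rho> \<Longrightarrow> ev p = 0" and "p \<in> rel_ideal \<rho>"
  shows "ev p = 0"
proof -
  have "two_sided_ideal {p. ev p = 0}"
    by unfold_locales (simp_all add: ev_0 ev_add ev_mult)
  then have "rel_ideal \<rho> \<subseteq> {p. ev p = 0}"
    unfolding rel_ideal_def ideal_gen_def using assms(1) by (auto simp: ideal_free_iff)
  then show ?thesis using assms(2) by blast
qed

end

section \<open>Faithfulness of the two representations by operators\<close>

context weyl
begin

definition "gen2_op g = (case g of X \<Rightarrow> j x1 | Yh \<Rightarrow> Y)"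
definition "gen3_op g = (case g of GX \<Rightarrow> j x1 | GY \<Rightarrow> dd | GZ \<Rightarrow> mu hinv)"

lemma gen2_op [simp]: "gen2_op X = j x1" "gen2_op Yh = Y"
  by (simp_all add: gen2_op_def)

lemma gen3_op [simp]: "gen3_op GX = j x1" "gen3_op GY = dd" "gen3_op GZ = mu hinv"
  by (simp_all add: gen3_op_def)

sublocale ev2: evaluation scal gen2_op
  by unfold_locales (rule scal_add scal_mult scal_1 scal_central)+

sublocale ev3: evaluation scal gen3_op
  by unfold_locales (rule scal_add scal_mult scal_1 scal_central)+

lemma ev2_poly_at: "ev2.ev (poly_at r (gen X)) = j r"
proof (induction r)
  case (pCons c r)
  have "pCons c r = [:c:] + x1 * r" by simp
  then have "j (pCons c r) = scal c + j x1 * j r" by (metis j_add j_const j_mult)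
  then show ?case using pCons(2)
    by (simp add: poly_at_pCons ev2.ev_add ev2.ev_mult ev2.ev_fscal ev2.ev_gen)
qed (simp add: ev2.ev_0)

lemma ev3_poly_at: "ev3.ev (poly_at r lx) = j r"
proof (induction r)
  case (pCons c r)
  have "pCons c r = [:c:] + x1 * r" by simp
  then have "j (pCons c r) = scal c + j x1 * j r" by (metis j_add j_const j_mult)
  then show ?case using pCons(2)
    by (simp add: poly_at_pCons ev3.ev_add ev3.ev_mult ev3.ev_fscal ev3.ev_gen)
qed (simp add: ev3.ev_0)

abbreviation "I2 \<equiv> rel_ideal (Ah_rels h)"
abbreviation "I3 \<equiv> rel_ideal (loc_rels h)"

sublocale I2: ore_relation I2 "gen X" "gen Yh" h
proof -
  interpret two_sided_ideal I2 by (rule two_sided_rel_ideal)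
  show "ore_relation I2 (gen X) (gen Yh) h"
    by unfold_locales (rule subsetD[OF rel_ideal_base], simp add: Ah_rels_def)
qed

lemma ev2_I2: "p \<in> I2 \<Longrightarrow> ev2.ev p = 0"
proof (rule ev2.ev_rel_ideal)
  fix p assume "p \<in> Ah_rels h"
  then show "ev2.ev p = 0"
    using cm_Y_j[of x1]
    by (simp add: Ah_rels_def ev2.ev_diff ev2.ev_mult ev2.ev_gen ev2_poly_at cm_def pderiv_pCons)
qed

lemma ev2_FS: "ev2.ev (I2.FS f) = S f"
  by (induction f) (simp_all add: I2.FS_pCons S_pCons ev2.ev_0 ev2.ev_add ev2.ev_mult ev2.ev_gen ev2_poly_at)

lemma normal_form_2: "\<exists>f. p - I2.FS f \<in> I2"
proof (induction p rule: poly_mapping_single_induct)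
  case 1
  show ?case by (rule exI[of _ 0]) (simp add: I2.I_0)
next
  case (2 w c)
  have "\<exists>f. Poly_Mapping.single (Word l) c - I2.FS f \<in> I2" for l
  proof (induction l)
    case Nil
    show ?case
      by (rule exI[of _ "[:[:c:]:]"])
        (simp add: I2.FS_pCons poly_at_pCons zero_word_def I2.I_0)
  next
    case (Cons g l)
    then obtain f where f: "Poly_Mapping.single (Word l) c - I2.FS f \<in> I2" by blast
    have *: "gen g * Poly_Mapping.single (Word l) c - gen g * I2.FS f \<in> I2"
      using I2.I_left[OF f, of "gen g"] by (simp add: right_diff_distrib)
    have "\<exists>f'. gen g * I2.FS f - I2.FS f' \<in> I2"
    proof (cases g)
      case X
      then show ?thesis
        by (intro exI[of _ "smult x1 f"]) (simp add: I2.FS_smult poly_at_pCons I2.I_0)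
    next
      case Yh
      then show ?thesis using I2.b_FS by blast
    qed
    then obtain f' where "gen g * I2.FS f - I2.FS f' \<in> I2" by blast
    from I2.I_add[OF * this] show ?case by (auto simp: single_Word_Cons)
  qed
  then show ?case by (metis word.exhaust)
next
  case (3 p q)
  then obtain f g where "p - I2.FS f \<in> I2" "q - I2.FS g \<in> I2" by blast
  from I2.I_add[OF this] show ?case by (intro exI[of _ "f + g"]) (simp add: I2.FS_add algebra_simps)
qed

text \<open>Every element is congruent to a normal form, and \<open>S\<close> is injective on normal
  forms.\<close>

lemma kernel_ev2: "ev2.ev p = 0 \<longleftrightarrow> p \<in> I2"
proof
  assume p: "ev2.ev p = 0"
  obtain f where f: "p - I2.FS f \<in> I2" using normal_form_2 by blast
  then have "S f = 0" using ev2_I2[OF f] p by (simp add: ev2.ev_diff ev2_FS)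
  then show "p \<in> I2" using f S_inj by fastforce
qed (rule ev2_I2)

lemma range_ev2: "range ev2.ev = range S"
proof
  show "range ev2.ev \<subseteq> range S"
  proof
    fix a assume "a \<in> range ev2.ev"
    then obtain p where p: "a = ev2.ev p" by blast
    obtain f where f: "p - I2.FS f \<in> I2" using normal_form_2 by blast
    then have "a = S f" using ev2_I2[OF f] p by (simp add: ev2.ev_diff ev2_FS)
    then show "a \<in> range S" by simp
  qed
  show "range S \<subseteq> range ev2.ev" using ev2_FS by (metis image_subsetI rangeI)
qed

abbreviation "ph3 r \<equiv> poly_at r (gen GX :: ('f, gen3) free)"

lemma loc_rels_I3:
  "ly * lx - lx * ly - 1 \<in> I3" "ph3 h * lz - 1 \<in> I3" "lz * ph3 h - 1 \<in> I3"
  by (rule subsetD[OF rel_ideal_base], simp add: loc_rels_def)+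

sublocale D3: ore_relation I3 lx ly 1
proof -
  interpret two_sided_ideal I3 by (rule two_sided_rel_ideal)
  show "ore_relation I3 lx ly 1"
    by unfold_locales (use loc_rels_I3(1) in simp)
qed

sublocale I3: ore_relation I3 lx "ly * ph3 h" h
proof -
  have "ly * ph3 h * lx - lx * (ly * ph3 h) - ph3 h = (ly * lx - lx * ly - 1) * ph3 h"
    using poly_at_commute[of lx h] by (simp add: algebra_simps)
  then show "ore_relation I3 lx (ly * ph3 h) h"
    by unfold_locales (use D3.I_right[OF loc_rels_I3(1)] in simp)
qed

lemma ev3_I3: "p \<in> I3 \<Longrightarrow> ev3.ev p = 0"
proof (rule ev3.ev_rel_ideal)
  fix p assume p: "p \<in> loc_rels h"
  have "dd * j x1 - j x1 * dd = 1"
    using \<iota>_pderiv[of x1] by (simp add: j_def dd_mu pderiv_pCons) (simp flip: one_pCons)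
  moreover have "j h * mu hinv = 1" using mu_hinv_j_h by (metis j_def mu_commute)
  ultimately show "ev3.ev p = 0"
    using p mu_hinv_j_h
    by (auto simp: loc_rels_def ev3.ev_diff ev3.ev_mult ev3.ev_gen ev3.ev_1 ev3_poly_at)
qed

lemma ev3_FS: "ev3.ev (I3.FS f) = S f"
proof (induction f)
  case (pCons r f)
  have "ev3.ev (ly * ph3 h) = Y" by (simp add: ev3.ev_mult ev3.ev_gen ev3_poly_at Y_def)
  then show ?case using pCons(2)
    by (simp add: I3.FS_pCons S_pCons ev3.ev_add ev3.ev_mult[of _ "ly * ph3 h"] ev3_poly_at)
qed (simp add: ev3.ev_0)

text \<open>Multiplying by a power of \<open>h\<close> clears \<open>lz\<close> and turns \<open>ly\<close> into \<open>ly h\<close>, so that the normal form of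
  \<open>A\<^sub>h\<close> also detects zero in the localization.\<close>

lemma normal_form_3: "\<exists>k f. ph3 (h ^ k) * p - I3.FS f \<in> I3"
proof (induction p rule: poly_mapping_single_induct)
  case 1
  show ?case by (rule exI[of _ 0], rule exI[of _ 0]) (simp add: D3.I_0)
next
  case (2 w c)
  have "\<exists>k f. ph3 (h ^ k) * Poly_Mapping.single (Word l) c - I3.FS f \<in> I3" for l
  proof (induction l)
    case Nil
    show ?case
      by (rule exI[of _ 0], rule exI[of _ "[:[:c:]:]"])
        (simp add: I3.FS_pCons poly_at_pCons zero_word_def D3.I_0)
  next
    case (Cons g l)
    let ?p = "Poly_Mapping.single (Word l) c"
    from Cons obtain k f where f: "ph3 (h ^ k) * ?p - I3.FS f \<in> I3" by blast
    have "\<exists>k f. ph3 (h ^ k) * (gen g * ?p) - I3.FS f \<in> I3"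
    proof (cases g)
      case GX
      have "ph3 (h ^ k) * (lx * ?p) = lx * (ph3 (h ^ k) * ?p)"
        using poly_at_commute[of lx "h ^ k"] by (simp add: mult.assoc[symmetric])
      then have "ph3 (h ^ k) * (lx * ?p) - I3.FS (smult x1 f) = lx * (ph3 (h ^ k) * ?p - I3.FS f)"
        by (simp add: I3.FS_smult poly_at_pCons right_diff_distrib)
      then show ?thesis using D3.I_left[OF f, of lx] GX by metis
    next
      case GZ
      have "ph3 (h ^ Suc k) = ph3 (h ^ k) * ph3 h" by (simp only: power_Suc2 poly_at_mult)
      then have "ph3 (h ^ Suc k) * (lz * ?p) - I3.FS f = ph3 (h ^ k) * ((ph3 h * lz - 1) * ?p) + (ph3 (h ^ k) * ?p - I3.FS f)"
        by (simp add: algebra_simps)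
      also have "\<dots> \<in> I3" by (intro D3.I_add D3.I_left D3.I_right loc_rels_I3 f)
      finally show ?thesis using GZ by blast
    next
      \<comment> \<open>One more factor \<open>h\<close> is needed to turn the new y into yh; moving
        \<open>h ^ Suc k\<close> past y then costs \<open>Suc k\<close> times the derivative of
        \<open>h\<close> times \<open>h ^ k\<close>.\<close>
      case GY
      let ?d = "pderiv h * of_nat (Suc k)"
      let ?f = "pCons 0 f + smult h (dx f)"
      have hk: "pderiv (h ^ Suc k) = ?d * h ^ k"
        by (simp only: pderiv_power_Suc) (simp add: of_nat_poly mult_ac del: of_nat_Suc power_Suc)
      have "ly * ph3 (h ^ Suc k) - ph3 (h ^ Suc k) * ly - ph3 (?d * h ^ k) \<in> I3"
        using D3.relation_poly[of "h ^ Suc k"] unfolding hk mult_1 .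
      from D3.I_right[OF this, of ?p]
      have 1: "ly * ph3 (h ^ Suc k) * ?p - ph3 (h ^ Suc k) * ly * ?p - ph3 (?d * h ^ k) * ?p \<in> I3"
        by (simp only: left_diff_distrib)
      have 2: "ly * ph3 h * (ph3 (h ^ k) * ?p - I3.FS f) \<in> I3" by (rule D3.I_left[OF f])
      have 3: "ph3 ?d * (ph3 (h ^ k) * ?p - I3.FS f) \<in> I3" by (rule D3.I_left[OF f])
      have 4: "ly * ph3 h * I3.FS f - I3.FS ?f \<in> I3" by (rule I3.b_FS)
      have hs: "ph3 (h ^ Suc k) = ph3 h * ph3 (h ^ k)" "ph3 (?d * h ^ k) = ph3 ?d * ph3 (h ^ k)"
        by (simp_all only: power_Suc poly_at_mult)
      have "ph3 (h ^ Suc k) * (ly * ?p) - I3.FS (?f - smult ?d f)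
        = (ly * ph3 h * (ph3 (h ^ k) * ?p - I3.FS f) + (ly * ph3 h * I3.FS f - I3.FS ?f))
          - ph3 ?d * (ph3 (h ^ k) * ?p - I3.FS f)
          - (ly * ph3 (h ^ Suc k) * ?p - ph3 (h ^ Suc k) * ly * ?p - ph3 (?d * h ^ k) * ?p)"
        using I3.FS_add[of ?f "- smult ?d f"] unfolding hs I3.FS_minus I3.FS_smult
        by (simp add: algebra_simps del: of_nat_Suc)
      also have "\<dots> \<in> I3" by (rule D3.I_diff[OF D3.I_diff[OF D3.I_add[OF 2 4] 3] 1])
      finally show ?thesis using GY by blast
    qed
    then show ?case by (simp add: single_Word_Cons)
  qed
  then show ?case by (metis word.exhaust)
next
  case (3 p q)
  then obtain k f l g where kl: "ph3 (h ^ k) * p - I3.FS f \<in> I3" "ph3 (h ^ l) * q - I3.FS g \<in> I3" by blast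
  have "ph3 (h ^ (k + l)) * (p + q) - I3.FS (smult (h ^ l) f + smult (h ^ k) g)
    = ph3 (h ^ l) * (ph3 (h ^ k) * p - I3.FS f) + ph3 (h ^ k) * (ph3 (h ^ l) * q - I3.FS g)"
    unfolding I3.FS_add I3.FS_smult power_add poly_at_mult
    using arg_cong[OF poly_at_mult_commute[of "h ^ k" lx "h ^ l"], of "\<lambda>u. u * p"]
      arg_cong[OF poly_at_mult_commute[of "h ^ k" lx "h ^ l"], of "\<lambda>u. u * q"]
    by (simp add: algebra_simps)
  also have "\<dots> \<in> I3" using kl by (intro D3.I_add D3.I_left)
  finally show ?case by blast
qed

lemma kernel_ev3: "ev3.ev p = 0 \<longleftrightarrow> p \<in> I3"
proof
  assume p: "ev3.ev p = 0"
  obtain k f where f: "ph3 (h ^ k) * p - I3.FS f \<in> I3" using normal_form_3 by blast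
  have "S f = 0" using ev3_I3[OF f] p by (simp add: ev3.ev_diff ev3_FS ev3.ev_mult)
  then have "ph3 (h ^ k) * p \<in> I3" using f S_inj by fastforce
  \<comment> \<open>The powers of \<open>h\<close> are cancelled one at a time by the inverse
    \<open>lz\<close>.\<close>
  then show "p \<in> I3"
  proof (induction k)
    case (Suc k)
    have "lz * (ph3 (h ^ Suc k) * p) - (lz * ph3 h - 1) * (ph3 (h ^ k) * p) = ph3 (h ^ k) * p"
      by (simp only: power_Suc poly_at_mult) (simp add: algebra_simps)
    moreover have "lz * (ph3 (h ^ Suc k) * p) - (lz * ph3 h - 1) * (ph3 (h ^ k) * p) \<in> I3"
      by (intro D3.I_diff D3.I_left[OF Suc.prems] D3.I_right loc_rels_I3)
    ultimately show ?case using Suc.IH by simp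
  qed simp
qed (rule ev3_I3)

end

section \<open>The first Hochschild cohomology of \<open>A\<^sub>h\<close>\<close>

context weyl
begin

definition op_alg :: "('f, 'f lop) alg" where
  "op_alg = \<lparr>carr = range S, zer = 0, pls = (+), scl = (\<lambda>c a. scal c * a), mlt = (*)\<rparr>"

lemma op_alg_simps:
  "carr op_alg = range S" "zer op_alg = 0" "pls op_alg = (+)" "scl op_alg = (\<lambda>c a. scal c * a)"
  "mlt op_alg = (*)"
  by (simp_all add: op_alg_def)

abbreviation "A \<equiv> Ah h"
abbreviation "cls2 \<equiv> cls (Ah_rels h)"
abbreviation "cls3 \<equiv> cls (loc_rels h)"

lemma ev2_hom: "alg_hom ev2.ev free_algebra op_alg" "ev2.ev ` carr free_algebra = carr op_alg"
  using range_ev2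
  by (auto simp: alg_hom_def free_algebra_simps op_alg_simps ev2.ev_0 ev2.ev_add ev2.ev_mult ev2.ev_fscal)

lemma Ah_eq: "A = quot free_algebra I2"
  by (simp add: Ah_def presented_def)

lemma carr_A: "carr A = range cls2"
  by (simp add: Ah_eq quot_def cls_def[abs_def] free_algebra_simps)

lemma A_algebra: "f_algebra A"
  unfolding Ah_eq by (rule f_algebra.quot_f_algebra[OF free_f_algebra rel_ideal_ideal])

definition \<phi> :: "('f, gen2) free set \<Rightarrow> 'f lop" where
  "\<phi> = (SOME \<phi>. alg_iso \<phi> A op_alg \<and> (\<forall>p. \<phi> (cls2 p) = ev2.ev p))"

lemma \<phi>: "alg_iso \<phi> A op_alg" "\<phi> (cls2 p) = ev2.ev p"
proof -
  have "I2 = {p \<in> carr free_algebra. ev2.ev p = zer op_alg}"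
    by (simp add: free_algebra_simps op_alg_simps kernel_ev2)
  then obtain \<phi>' where "alg_iso \<phi>' (quot free_algebra I2) op_alg"
    "\<And>p. p \<in> carr free_algebra \<Longrightarrow> \<phi>' (coset free_algebra I2 p) = ev2.ev p"
    using f_algebra.quot_kernel_alg_iso[OF free_f_algebra ev2_hom] by metis
  then have "alg_iso \<phi>' A op_alg \<and> (\<forall>p. \<phi>' (cls2 p) = ev2.ev p)"
    by (simp add: Ah_eq cls_def free_algebra_simps)
  then have "alg_iso \<phi> A op_alg \<and> (\<forall>p. \<phi> (cls2 p) = ev2.ev p)"
    unfolding \<phi>_def by (rule someI[of "\<lambda>\<phi>. alg_iso \<phi> A op_alg \<and> (\<forall>p. \<phi> (cls2 p) = ev2.ev p)"])
  then show "alg_iso \<phi> A op_alg" "\<phi> (cls2 p) = ev2.ev p" by simp_all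
qed

definition "\<psi> = inv_into (carr A) \<phi>"

lemma \<phi>_bij: "bij_betw \<phi> (carr A) (range S)"
  using \<phi>(1) by (simp add: alg_iso_def op_alg_simps)

lemma
  shows \<phi>_closed: "a \<in> carr A \<Longrightarrow> \<phi> a \<in> range S"
    and \<psi>_closed: "x \<in> range S \<Longrightarrow> \<psi> x \<in> carr A"
    and \<phi>_\<psi>: "x \<in> range S \<Longrightarrow> \<phi> (\<psi> x) = x"
    and \<psi>_\<phi>: "a \<in> carr A \<Longrightarrow> \<psi> (\<phi> a) = a"
proof -
  show "a \<in> carr A \<Longrightarrow> \<phi> a \<in> range S" using \<phi>_bij by (rule bij_betwE[rule_format])
  have *: "range S = \<phi> ` carr A" using \<phi>_bij by (simp add: bij_betw_def)
  show "x \<in> range S \<Longrightarrow> \<psi> x \<in> carr A" unfolding * \<psi>_def by (rule inv_into_into)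
  show "x \<in> range S \<Longrightarrow> \<phi> (\<psi> x) = x" unfolding * \<psi>_def by (rule f_inv_into_f)
  show "a \<in> carr A \<Longrightarrow> \<psi> (\<phi> a) = a" unfolding \<psi>_def using \<phi>_bij by (simp add: bij_betw_def)
qed

lemma
  shows \<phi>_add: "a \<in> carr A \<Longrightarrow> b \<in> carr A \<Longrightarrow> \<phi> (a \<oplus>\<^bsub>A\<^esub> b) = \<phi> a + \<phi> b"
    and \<phi>_mult: "a \<in> carr A \<Longrightarrow> b \<in> carr A \<Longrightarrow> \<phi> (a \<star>\<^bsub>A\<^esub> b) = \<phi> a * \<phi> b"
    and \<phi>_scl: "a \<in> carr A \<Longrightarrow> \<phi> (c \<odot>\<^bsub>A\<^esub> a) = scal c * \<phi> a"
  using \<phi>(1) by (simp_all add: alg_iso_def op_alg_simps)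

interpretation A: f_algebra A by (rule A_algebra)

lemma scal_m1: "scal (- 1) * a = - a" for a :: "'f lop"
proof -
  have "scal (- 1) + scal 1 = (0 :: 'f lop)" by (simp only: scal_add[symmetric]) simp
  then have "scal (- 1) = (- 1 :: 'f lop)" by (simp add: eq_neg_iff_add_eq_0)
  then show ?thesis by simp
qed

lemma \<phi>_mns: "a \<in> carr A \<Longrightarrow> b \<in> carr A \<Longrightarrow> \<phi> (a \<ominus>\<^bsub>A\<^esub> b) = \<phi> a - \<phi> b"
  by (simp add: mns_def \<phi>_add \<phi>_scl A.scl_closed scal_m1)

lemma \<phi>_inj: "a \<in> carr A \<Longrightarrow> b \<in> carr A \<Longrightarrow> \<phi> a = \<phi> b \<Longrightarrow> a = b"
  by (metis \<psi>_\<phi>)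

lemma \<phi>_zer: "\<phi> (zer A) = 0"
  using \<phi>_mns[OF A.zer_closed A.zer_closed] A.mns_self[OF A.zer_closed] by simp

text \<open>The normalizer of the image of A_h. Derivations are computed in it, and
  \<open>\<delta>\<close> maps it onto \<open>Der A\<close>.\<close>

definition norm_op :: "'f lop \<Rightarrow> bool" where
  "norm_op U \<longleftrightarrow> (\<forall>x\<in>range S. cm U x \<in> range S)"

lemma norm_opD: "norm_op U \<Longrightarrow> x \<in> range S \<Longrightarrow> cm U x \<in> range S"
  unfolding norm_op_def by blast

definition \<delta> :: "'f lop \<Rightarrow> ('f, gen2) free set \<Rightarrow> ('f, gen2) free set" where
  "\<delta> U = (\<lambda>a\<in>carr A. \<psi> (cm U (\<phi> a)))"

definition nrm_alg :: "('f, 'f lop) alg" where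
  "nrm_alg = \<lparr>carr = {U. norm_op U}, zer = 0, pls = (+), scl = (\<lambda>c a. scal c * a), mlt = cm\<rparr>"

lemma nrm_alg_simps:
  "carr nrm_alg = {U. norm_op U}" "zer nrm_alg = 0" "pls nrm_alg = (+)"
  "scl nrm_alg = (\<lambda>c a. scal c * a)" "mlt nrm_alg = cm"
  by (simp_all add: nrm_alg_def)

lemma range_S_add: "x \<in> range S \<Longrightarrow> y \<in> range S \<Longrightarrow> x + y \<in> range S"
  by (auto simp: S_add[symmetric])

lemma range_S_diff: "x \<in> range S \<Longrightarrow> y \<in> range S \<Longrightarrow> x - y \<in> range S"
  by (auto simp: S_diff[symmetric])

lemma range_S_scal: "x \<in> range S \<Longrightarrow> scal c * x \<in> range S"
  by (auto simp: j_const[symmetric] S_smult[symmetric])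

lemma norm_add: "norm_op U \<Longrightarrow> norm_op V \<Longrightarrow> norm_op (U + V)"
  by (simp add: norm_op_def cm_add_left range_S_add)

lemma norm_scal: "norm_op U \<Longrightarrow> norm_op (scal c * U)"
  by (simp add: norm_op_def cm_scal_left range_S_scal)

lemma cm_cm: "cm (cm U V) x = cm U (cm V x) - cm V (cm U x)"
  by (simp add: cm_def algebra_simps)

lemma norm_cm: "norm_op U \<Longrightarrow> norm_op V \<Longrightarrow> norm_op (cm U V)"
  unfolding norm_op_def[of "cm U V"] cm_cm by (blast intro: range_S_diff norm_opD)

lemma norm_S: "x \<in> range S \<Longrightarrow> norm_op x"
  unfolding norm_op_def cm_def by (simp add: range_S_diff range_S_mult)

lemma norm_W: "norm_op (W s f)"
  using cm_W_S by (auto simp: norm_op_def)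

lemma norm_sg: "norm_op (sg g)"
  using cm_sg_S by (auto simp: norm_op_def)

lemma norm_0: "norm_op 0"
  unfolding norm_op_def by (metis S_0 cm_0_left rangeI)

lemma nrm_algebra: "f_algebra nrm_alg"
proof
  fix a b :: "'f lop" and c c' :: 'f
  show "c \<odot>\<^bsub>nrm_alg\<^esub> (c' \<odot>\<^bsub>nrm_alg\<^esub> a) = (c * c') \<odot>\<^bsub>nrm_alg\<^esub> a"
    by (simp add: nrm_alg_simps scal_mult mult.assoc)
qed (simp_all add: nrm_alg_simps mns_def norm_0 norm_add norm_scal norm_cm scal_m1
    scal_add cm_add_left cm_add_right cm_scal cm_scal_left add.assoc add.commute distrib_left distrib_right)

lemma Der_simps:
  "carr (Der A) = {d \<in> carr A \<rightarrow>\<^sub>E carr A.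
       (\<forall>a\<in>carr A. \<forall>b\<in>carr A. d (a \<oplus>\<^bsub>A\<^esub> b) = d a \<oplus>\<^bsub>A\<^esub> d b)
     \<and> (\<forall>c. \<forall>a\<in>carr A. d (c \<odot>\<^bsub>A\<^esub> a) = c \<odot>\<^bsub>A\<^esub> d a)
     \<and> (\<forall>a\<in>carr A. \<forall>b\<in>carr A. d (a \<star>\<^bsub>A\<^esub> b) = d a \<star>\<^bsub>A\<^esub> b \<oplus>\<^bsub>A\<^esub> a \<star>\<^bsub>A\<^esub> d b)}"
  "zer (Der A) = (\<lambda>a\<in>carr A. \<zero>\<^bsub>A\<^esub>)" "pls (Der A) = (\<lambda>d e. \<lambda>a\<in>carr A. d a \<oplus>\<^bsub>A\<^esub> e a)"
  "scl (Der A) = (\<lambda>c d. \<lambda>a\<in>carr A. c \<odot>\<^bsub>A\<^esub> d a)"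
  "mlt (Der A) = (\<lambda>d e. \<lambda>a\<in>carr A. d (e a) \<ominus>\<^bsub>A\<^esub> e (d a))"
  by (simp_all add: Der_def)

lemma \<phi>_\<delta>: "norm_op U \<Longrightarrow> a \<in> carr A \<Longrightarrow> \<phi> (\<delta> U a) = cm U (\<phi> a)"
  by (simp add: \<delta>_def \<phi>_\<psi> norm_opD[OF _ \<phi>_closed])

lemma \<delta>_closed: "norm_op U \<Longrightarrow> a \<in> carr A \<Longrightarrow> \<delta> U a \<in> carr A"
  by (simp add: \<delta>_def \<psi>_closed norm_opD[OF _ \<phi>_closed])

lemma \<delta>_extI:
  assumes "norm_op U" "f \<in> extensional (carr A)" "\<And>a. a \<in> carr A \<Longrightarrow> f a \<in> carr A"
    "\<And>a. a \<in> carr A \<Longrightarrow> \<phi> (f a) = cm U (\<phi> a)"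
  shows "\<delta> U = f"
proof (rule extensionalityI[of _ "carr A"])
  show "\<delta> U \<in> extensional (carr A)" by (simp add: \<delta>_def)
  show "f \<in> extensional (carr A)" by fact
  show "\<delta> U a = f a" if "a \<in> carr A" for a
    using that assms by (intro \<phi>_inj) (simp_all add: \<delta>_closed \<phi>_\<delta>)
qed

lemma \<delta>_Der: "norm_op U \<Longrightarrow> \<delta> U \<in> carr (Der A)"
  unfolding Der_simps
proof (intro CollectI conjI ballI allI)
  assume U: "norm_op U"
  show "\<delta> U \<in> carr A \<rightarrow>\<^sub>E carr A" using \<delta>_closed[OF U] by (auto simp: \<delta>_def)
  fix a assume a: "a \<in> carr A"
  note c = \<delta>_closed[OF U] \<phi>_\<delta>[OF U] A.pls_closed A.mlt_closed A.scl_closed \<phi>_add \<phi>_mult \<phi>_scl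
  show "\<delta> U (c \<odot>\<^bsub>A\<^esub> a) = c \<odot>\<^bsub>A\<^esub> \<delta> U a" for c
    using a by (intro \<phi>_inj) (simp_all add: c cm_scal)
  fix b assume b: "b \<in> carr A"
  show "\<delta> U (a \<oplus>\<^bsub>A\<^esub> b) = \<delta> U a \<oplus>\<^bsub>A\<^esub> \<delta> U b"
    using a b by (intro \<phi>_inj) (simp_all add: c cm_add_right)
  show "\<delta> U (a \<star>\<^bsub>A\<^esub> b) = \<delta> U a \<star>\<^bsub>A\<^esub> b \<oplus>\<^bsub>A\<^esub> a \<star>\<^bsub>A\<^esub> \<delta> U b"
    using a b by (intro \<phi>_inj) (simp_all add: c cm_mult_right add.commute)
qed

lemma \<delta>_hom: "alg_hom \<delta> nrm_alg (Der A)"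
  unfolding alg_hom_def nrm_alg_simps
proof (intro conjI ballI allI)
  show "\<delta> ` {U. norm_op U} \<subseteq> carr (Der A)" using \<delta>_Der by blast
  show "\<delta> 0 = zer (Der A)"
    by (rule \<delta>_extI) (simp_all add: norm_0 Der_simps(2) A.zer_closed \<phi>_zer)
  fix U assume "U \<in> {U. norm_op U}"
  then have U: "norm_op U" by simp
  note c = \<delta>_closed[OF U] \<phi>_\<delta>[OF U]
  show "\<delta> (scal c * U) = c \<odot>\<^bsub>Der A\<^esub> \<delta> U" for c
    using norm_scal[OF U, of c]
    by (rule \<delta>_extI) (simp_all add: Der_simps(4) c A.scl_closed \<phi>_scl cm_scal_left)
  fix V assume "V \<in> {U. norm_op U}"
  then have V: "norm_op V" by simp
  note d = \<delta>_closed[OF V] \<phi>_\<delta>[OF V]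
  show "\<delta> (U + V) = \<delta> U \<oplus>\<^bsub>Der A\<^esub> \<delta> V"
    using norm_add[OF U V]
    by (rule \<delta>_extI) (simp_all add: Der_simps(3) c d A.pls_closed \<phi>_add cm_add_left)
  show "\<delta> (cm U V) = \<delta> U \<star>\<^bsub>Der A\<^esub> \<delta> V"
    using norm_cm[OF U V]
    by (rule \<delta>_extI) (simp_all add: Der_simps(5) c d A.mns_closed \<phi>_mns cm_cm)
qed

lemma \<delta>_eq_iff:
  assumes "norm_op U" "norm_op V"
  shows "\<delta> U = \<delta> V \<longleftrightarrow> (\<forall>f. cm U (S f) = cm V (S f))"
proof
  assume eq: "\<delta> U = \<delta> V"
  show "\<forall>f. cm U (S f) = cm V (S f)"
  proof
    fix f
    have "\<psi> (S f) \<in> carr A" "\<phi> (\<psi> (S f)) = S f" by (simp_all add: \<psi>_closed \<phi>_\<psi>)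
    then show "cm U (S f) = cm V (S f)"
      using eq \<phi>_\<delta>[OF assms(1), of "\<psi> (S f)"] \<phi>_\<delta>[OF assms(2), of "\<psi> (S f)"] by simp
  qed
next
  assume eq: "\<forall>f. cm U (S f) = cm V (S f)"
  then have "cm U (\<phi> a) = cm V (\<phi> a)" if "a \<in> carr A" for a using \<phi>_closed[OF that] by auto
  then show "\<delta> U = \<delta> V" unfolding \<delta>_def by (intro restrict_ext) simp
qed

text \<open>Conjugation by the isomorphism \<open>\<phi>\<close> turns \<open>d\<close> into a
  derivation of the range of \<open>S\<close>, to which \<open>derivation_eq_cm_W\<close>
  applies.\<close>

lemma Der_eq_\<delta>_W:
  assumes d: "d \<in> carr (Der A)"
  shows "\<exists>s f. d = \<delta> (W s f)"
proof -
  have dc: "a \<in> carr A \<Longrightarrow> d a \<in> carr A" and dext: "d \<in> extensional (carr A)"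
    and da: "\<And>a b. a \<in> carr A \<Longrightarrow> b \<in> carr A \<Longrightarrow> d (a \<oplus>\<^bsub>A\<^esub> b) = d a \<oplus>\<^bsub>A\<^esub> d b"
    and ds: "\<And>a c. a \<in> carr A \<Longrightarrow> d (c \<odot>\<^bsub>A\<^esub> a) = c \<odot>\<^bsub>A\<^esub> d a"
    and dm: "\<And>a b. a \<in> carr A \<Longrightarrow> b \<in> carr A \<Longrightarrow> d (a \<star>\<^bsub>A\<^esub> b) = d a \<star>\<^bsub>A\<^esub> b \<oplus>\<^bsub>A\<^esub> a \<star>\<^bsub>A\<^esub> d b" for a
    using d by (auto simp: Der_simps PiE_def Pi_def)
  define D where "D x = \<phi> (d (\<psi> x))" for x
  have D\<phi>: "D (\<phi> a) = \<phi> (d a)" if "a \<in> carr A" for a using that by (simp add: D_def \<psi>_\<phi>)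
  have ex: "x \<in> range S \<Longrightarrow> \<exists>a\<in>carr A. x = \<phi> a" for x using \<psi>_closed \<phi>_\<psi> by metis
  have "der D"
    unfolding der_def
  proof (intro conjI ballI allI)
    fix x assume "x \<in> range S"
    then obtain a where a: "a \<in> carr A" "x = \<phi> a" using ex by blast
    show "D (scal c * x) = scal c * D x" for c
      using a by (simp add: \<phi>_scl[symmetric] D\<phi> A.scl_closed ds dc)
    fix y assume "y \<in> range S"
    then obtain b where b: "b \<in> carr A" "y = \<phi> b" using ex by blast
    show "D (x + y) = D x + D y"
      using a b by (simp add: \<phi>_add[symmetric] D\<phi> A.pls_closed da dc)
    show "D (x * y) = D x * y + x * D y"
      using a b by (simp add: \<phi>_mult[symmetric] \<phi>_add[symmetric] D\<phi> A.mlt_closed dm dc)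
  qed
  moreover have "D x \<in> range S" if "x \<in> range S" for x
    using that by (simp add: D_def \<phi>_closed dc \<psi>_closed)
  ultimately obtain s f where sf: "\<forall>a. D (S a) = cm (W s f) (S a)" using derivation_eq_cm_W by blast
  have "\<delta> (W s f) = d"
  proof (rule \<delta>_extI[OF norm_W dext dc])
    fix a assume a: "a \<in> carr A"
    then obtain g where "\<phi> a = S g" using \<phi>_closed by blast
    then show "\<phi> (d a) = cm (W s f) (\<phi> a)" using D\<phi>[OF a] sf by simp
  qed
  then show ?thesis by blast
qed

lemma \<delta>_surj: "\<delta> ` carr nrm_alg = carr (Der A)"
proof
  show "\<delta> ` carr nrm_alg \<subseteq> carr (Der A)" using \<delta>_Der by (auto simp: nrm_alg_simps)
  show "carr (Der A) \<subseteq> \<delta> ` carr nrm_alg" using Der_eq_\<delta>_W norm_W by (fastforce simp: nrm_alg_simps)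
qed

lemma Der_algebra: "f_algebra (Der A)"
  using nrm_algebra \<delta>_hom \<delta>_surj by (rule f_algebra_image)

lemma Inder_eq: "Inder A = \<delta> ` range S"
proof -
  have *: "\<delta> (\<phi> u) = (\<lambda>a\<in>carr A. u \<star>\<^bsub>A\<^esub> a \<ominus>\<^bsub>A\<^esub> a \<star>\<^bsub>A\<^esub> u)" if u: "u \<in> carr A" for u
    using norm_S[OF \<phi>_closed[OF u]]
    by (rule \<delta>_extI) (simp_all add: u A.mns_closed A.mlt_closed \<phi>_mns \<phi>_mult cm_def)
  have "Inder A = (\<lambda>u. \<delta> (\<phi> u)) ` carr A"
    unfolding Inder_def using * by (auto simp: image_iff)
  also have "\<dots> = \<delta> ` range S"
    using bij_betw_imp_surj_on[OF \<phi>_bij] by (simp add: image_image[symmetric])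
  finally show ?thesis .
qed

text \<open>The image of A_h is an ideal of its own normalizer, and ideals pass along the surjection
  \<open>\<delta>\<close>.\<close>

lemma ideal_Inder: "ideal (Der A) (Inder A)"
  unfolding Inder_eq
proof (rule f_algebra.ideal_image[OF nrm_algebra \<delta>_hom \<delta>_surj])
  have "0 \<in> range S" by (metis S_0 rangeI)
  have swap: "cm x U \<in> range S" if "norm_op U" "x \<in> range S" for U x
  proof -
    have "cm x U = 0 - cm U x" using cm_swap[of x U] by simp
    then show ?thesis using range_S_diff[OF \<open>0 \<in> range S\<close> norm_opD[OF that]] by simp
  qed
  show "ideal nrm_alg (range S)"
    unfolding ideal_def subspace_def nrm_alg_simps
  proof (intro conjI ballI allI subsetI)
    fix x assume x: "x \<in> range S"
    show "x \<in> {U. norm_op U}" using norm_S[OF x] by simp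
    show "scal c * x \<in> range S" for c using x by (rule range_S_scal)
    show "x + y \<in> range S" if "y \<in> range S" for y using x that by (rule range_S_add)
    show "cm U x \<in> range S" "cm x U \<in> range S" if "U \<in> {U. norm_op U}" for U
      using that norm_opD[OF _ x] swap[OF _ x] by simp_all
  qed fact
qed

lemma to_HH1_eq: "to_HH1 h = coset (Der A) (Inder A)"
  by (simp add: to_HH1_def fun_eq_iff)

definition \<Psi> :: "'f poly \<times> 'f poly poly \<Rightarrow> (('f, gen2) free set \<Rightarrow> ('f, gen2) free set) set" where
  "\<Psi> x = to_HH1 h (\<delta> (W (fst x) (snd x)))"

lemma \<delta>_add: "norm_op U \<Longrightarrow> norm_op V \<Longrightarrow> \<delta> (U + V) = \<delta> U \<oplus>\<^bsub>Der A\<^esub> \<delta> V"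
  using alg_homD(3)[OF \<delta>_hom, of U V] by (simp add: nrm_alg_simps)

lemma HH1_hom: "alg_hom (to_HH1 h) (Der A) (HH1 A)"
  unfolding to_HH1_eq HH1_def by (rule f_algebra.coset_hom[OF Der_algebra ideal_Inder])

lemma HH1_algebra: "f_algebra (HH1 A)"
  unfolding HH1_def by (rule f_algebra.quot_f_algebra[OF Der_algebra ideal_Inder])

lemma to_HH1_add_S:
  assumes "norm_op U"
  shows "to_HH1 h (\<delta> (U + S k)) = to_HH1 h (\<delta> U)"
proof -
  interpret HA: f_algebra "HH1 A" by (rule HH1_algebra)
  have S: "norm_op (S k)" by (rule norm_S) simp
  have "to_HH1 h (\<delta> (S k)) = zer (HH1 A)"
    using f_algebra.coset_eq_zer_iff[OF Der_algebra ideal_Inder \<delta>_Der[OF S]] Inder_eq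
    by (simp add: to_HH1_eq HH1_def)
  then show ?thesis
    using alg_homD(3)[OF HH1_hom \<delta>_Der[OF assms] \<delta>_Der[OF S]] alg_homD(1)[OF HH1_hom \<delta>_Der[OF assms]]
    by (simp add: \<delta>_add[OF assms S] HA.pls_zer)
qed

sublocale HQ: bracket_quotient h "HH1 A" \<Psi>
proof
  have nW: "\<delta> (W s f) \<in> carr (Der A)" for s f by (rule \<delta>_Der[OF norm_W])
  show "alg_hom \<Psi> pr_alg (HH1 A)"
    unfolding alg_hom_def
  proof (intro conjI ballI allI)
    show "\<Psi> ` carr pr_alg \<subseteq> carr (HH1 A)"
      using alg_homD(1)[OF HH1_hom nW] by (auto simp: \<Psi>_def)
    have "W 0 0 = 0"
      using W_add[of 0 0 0 0] by simp
    then show "\<Psi> (zer pr_alg) = zer (HH1 A)"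
      using alg_homD(2)[OF \<delta>_hom] alg_homD(2)[OF HH1_hom] by (simp add: \<Psi>_def pr_alg_def nrm_alg_simps)
    fix x y :: "'f poly \<times> 'f poly poly"
    show "\<Psi> (x \<oplus>\<^bsub>pr_alg\<^esub> y) = \<Psi> x \<oplus>\<^bsub>HH1 A\<^esub> \<Psi> y"
      by (simp add: \<Psi>_def pr_alg_def W_add \<delta>_add norm_W alg_homD(3)[OF HH1_hom nW nW])
    have "to_HH1 h (\<delta> (scal c * W (fst x) (snd x))) = c \<odot>\<^bsub>HH1 A\<^esub> to_HH1 h (\<delta> (W (fst x) (snd x)))" for c
      using alg_homD(5)[OF \<delta>_hom, of "W (fst x) (snd x)" c] alg_homD(5)[OF HH1_hom nW[of "fst x" "snd x"], of c]
      by (simp add: nrm_alg_simps norm_W)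
    then show "\<Psi> (c \<odot>\<^bsub>pr_alg\<^esub> x) = c \<odot>\<^bsub>HH1 A\<^esub> \<Psi> x" for c
      by (simp add: \<Psi>_def pr_alg_def W_smult)
    obtain k where k: "cm (W (fst x) (snd x)) (W (fst y) (snd y)) = W 0 (br (snd x) (snd y)) + S k"
      using cm_W_W by blast
    have "\<Psi> x \<star>\<^bsub>HH1 A\<^esub> \<Psi> y = to_HH1 h (\<delta> (cm (W (fst x) (snd x)) (W (fst y) (snd y))))"
      using alg_homD(4)[OF \<delta>_hom, of "W (fst x) (snd x)" "W (fst y) (snd y)"]
      by (simp add: \<Psi>_def nrm_alg_simps norm_W alg_homD(4)[OF HH1_hom nW nW])
    then show "\<Psi> (x \<star>\<^bsub>pr_alg\<^esub> y) = \<Psi> x \<star>\<^bsub>HH1 A\<^esub> \<Psi> y"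
      unfolding k by (simp add: \<Psi>_def pr_alg_def to_HH1_add_S norm_W)
  qed
  have "carr (HH1 A) = to_HH1 h ` carr (Der A)" by (simp add: HH1_def quot_def to_HH1_eq)
  also have "\<dots> = range \<Psi>"
  proof
    show "to_HH1 h ` carr (Der A) \<subseteq> range \<Psi>"
    proof
      fix x assume "x \<in> to_HH1 h ` carr (Der A)"
      then obtain s f where "x = to_HH1 h (\<delta> (W s f))" using Der_eq_\<delta>_W by blast
      then have "x = \<Psi> (s, f)" by (simp add: \<Psi>_def)
      then show "x \<in> range \<Psi>" by simp
    qed
    show "range \<Psi> \<subseteq> to_HH1 h ` carr (Der A)" using nW by (auto simp: \<Psi>_def)
  qed
  finally show "range \<Psi> = carr (HH1 A)" ..
  fix s f
  have "\<Psi> (s, f) = zer (HH1 A) \<longleftrightarrow> \<delta> (W s f) \<in> Inder A"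
    using f_algebra.coset_eq_zer_iff[OF Der_algebra ideal_Inder nW, of s f]
    by (simp add: \<Psi>_def to_HH1_eq HH1_def)
  also have "\<dots> \<longleftrightarrow> (\<exists>g. \<delta> (W s f) = \<delta> (S g))" by (auto simp: Inder_eq)
  also have "\<dots> \<longleftrightarrow> ph dvd s \<and> [:\<kappa>:] dvd f"
    using \<delta>_eq_iff[OF norm_W norm_S] W_inner_iff by simp
  finally show "\<Psi> (s, f) = zer (HH1 A) \<longleftrightarrow> ph dvd s \<and> [:\<kappa>:] dvd f" .
qed

text \<open>\<open>sg g\<close> has the prescribed values at x and \<open>Y\<close>. Uniqueness
  holds because every derivation is a commutator and is determined by these two values.\<close>

lemma D_der_eq: "D_der h g = \<delta> (sg g)"
  unfolding D_der_def
proof (rule the_equality)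
  have X: "cls2 (gen X) \<in> carr A" "\<phi> (cls2 (gen X)) = j x1"
    and Y: "cls2 (gen Yh) \<in> carr A" "\<phi> (cls2 (gen Yh)) = Y"
    and G: "cls2 (poly_at g (gen X)) \<in> carr A" "\<phi> (cls2 (poly_at g (gen X))) = j g"
    by (simp_all add: carr_A \<phi>(2) ev2.ev_gen ev2_poly_at)
  have "\<delta> (sg g) (cls2 (gen X)) = zer A"
    using X by (intro \<phi>_inj) (simp_all add: \<delta>_closed norm_sg A.zer_closed \<phi>_\<delta> \<phi>_zer)
  moreover have "\<delta> (sg g) (cls2 (gen Yh)) = cls2 (poly_at g (gen X))"
    using Y G by (intro \<phi>_inj) (simp_all add: \<delta>_closed norm_sg \<phi>_\<delta> cm_sg_Y)
  ultimately show "\<delta> (sg g) \<in> carr (Der A) \<and> \<delta> (sg g) (cls2 (gen X)) = zer A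
      \<and> \<delta> (sg g) (cls2 (gen Yh)) = cls2 (poly_at g (gen X))"
    using \<delta>_Der norm_sg by blast
  fix d assume d: "d \<in> carr (Der A) \<and> d (cls2 (gen X)) = zer A \<and> d (cls2 (gen Yh)) = cls2 (poly_at g (gen X))"
  then obtain s f where sf: "d = \<delta> (W s f)" using Der_eq_\<delta>_W by blast
  have "cm (W s f) (S a) = cm (sg g) (S a)" for a
  proof (rule der_eqI[OF der_cm der_cm])
    show "cm (W s f) (j x1) = cm (sg g) (j x1)"
      using d \<phi>_\<delta>[OF norm_W[of s f] X(1)] by (simp add: sf X(2) \<phi>_zer)
    show "cm (W s f) Y = cm (sg g) Y"
      using d \<phi>_\<delta>[OF norm_W[of s f] Y(1)] by (simp add: sf Y(2) G(2) cm_sg_Y)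
  qed
  then show "d = \<delta> (sg g)" unfolding sf using \<delta>_eq_iff[OF norm_W norm_sg] by simp
qed

section \<open>Commutators in the localized Weyl algebra\<close>

definition "emb_gen g = (case g of X \<Rightarrow> lx | Yh \<Rightarrow> ly * ph3 h)"

sublocale evF: evaluation "fscal :: 'f \<Rightarrow> ('f, gen3) free" emb_gen
  by unfold_locales (simp_all add: single_add mult_single fscal_commute)

lemma subst_eq: "subst emb_gen p = evF.ev p"
  by (simp add: subst_def evF.ev_def pm_sum_def)

lemma ev3_subst: "ev3.ev (subst emb_gen p) = ev2.ev p"
proof -
  have "ev3.ev (evF.ev p) = ev2.ev p"
  proof (rule ev2.ev_unique)
    show "ev3.ev (evF.ev (gen g)) = gen2_op g" for g
      by (cases g) (simp_all add: evF.ev_gen emb_gen_def ev3.ev_gen ev3.ev_mult ev3_poly_at Y_def)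
  qed (simp_all add: evF.ev_0 evF.ev_add evF.ev_mult evF.ev_fscal ev3.ev_0 ev3.ev_add ev3.ev_mult ev3.ev_fscal)
  then show ?thesis by (simp add: subst_eq)
qed

lemma cls3_eq_iff: "cls3 p = cls3 r \<longleftrightarrow> ev3.ev p = ev3.ev r"
proof -
  have "cls3 p = cls3 r \<longleftrightarrow> p - r \<in> I3"
    using f_algebra.coset_eq_iff[OF free_f_algebra rel_ideal_ideal, of p r "loc_rels h"]
    by (simp add: cls_def free_algebra_simps)
  then show ?thesis by (simp add: kernel_ev3[symmetric] ev3.ev_diff)
qed

text \<open>The union over the coset collapses: substitution followed by \<open>ev3.ev\<close> is
  \<open>ev2.ev\<close>, which is constant on the coset, and \<open>ev3.ev\<close> is faithful on
  the localization.\<close>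

lemma embed_cls2: "embed h (cls2 p) = cls3 (subst emb_gen p)"
proof -
  have p: "p \<in> cls2 p"
    unfolding cls_def by (rule f_algebra.coset_self[OF free_f_algebra rel_ideal_ideal]) (simp add: free_algebra_simps)
  have "cls3 (subst emb_gen r) = cls3 (subst emb_gen p)" if "r \<in> cls2 p" for r
  proof -
    have "r - p \<in> I2"
      using that f_algebra.mem_coset_iff[OF free_f_algebra rel_ideal_ideal, of p r "Ah_rels h"]
      by (simp add: cls_def free_algebra_simps)
    then have "ev2.ev r = ev2.ev p" by (simp add: kernel_ev2[symmetric] ev2.ev_diff)
    then show ?thesis by (simp add: cls3_eq_iff ev3_subst)
  qed
  then show ?thesis
    unfolding embed_def emb_gen_def[abs_def, symmetric] by (rule UN_eq_const[OF p])
qed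

lemma cls3_hom: "alg_hom cls3 free_algebra (Weyl_loc h)"
  unfolding Weyl_loc_def presented_def cls_def[abs_def]
  by (rule f_algebra.coset_hom[OF free_f_algebra rel_ideal_ideal])

text \<open>Read through the faithful \<open>ev3.ev\<close>, the equation that defines
  \<open>ad\<close> says that \<open>\<phi> b\<close> is the commutator of \<open>ev3.ev u\<close>
  and \<open>\<phi> a\<close>. The assumption on \<open>u\<close> places it in the range of
  \<open>S\<close>, so exactly one \<open>b\<close> exists.\<close>

lemma ad_eq_\<delta>:
  assumes u: "norm_op (ev3.ev u)"
  shows "ad h (cls3 u) = \<delta> (ev3.ev u)"
proof -
  let ?L = "Weyl_loc h"
  note c = alg_homD[OF cls3_hom, unfolded free_algebra_simps, simplified]
  have mns: "cls3 p \<ominus>\<^bsub>?L\<^esub> cls3 r = cls3 (p - r)" for p r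
    using f_algebra.alg_hom_mns[OF free_f_algebra cls3_hom, of p r] by (simp add: free_algebra_simps)
  have "(THE b. b \<in> carr A \<and> embed h b = cls3 u \<star>\<^bsub>?L\<^esub> embed h a \<ominus>\<^bsub>?L\<^esub> embed h a \<star>\<^bsub>?L\<^esub> cls3 u)
    = \<psi> (cm (ev3.ev u) (\<phi> a))" if a: "a \<in> carr A" for a
  proof -
    obtain p where p: "a = cls2 p" using a by (auto simp: carr_A)
    have iff: "embed h b = cls3 u \<star>\<^bsub>?L\<^esub> embed h a \<ominus>\<^bsub>?L\<^esub> embed h a \<star>\<^bsub>?L\<^esub> cls3 u
      \<longleftrightarrow> \<phi> b = cm (ev3.ev u) (\<phi> a)" if b: "b \<in> carr A" for b
    proof -
      obtain r where r: "b = cls2 r" using b by (auto simp: carr_A)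
      show ?thesis
        unfolding p r embed_cls2 c(4)[symmetric] mns cls3_eq_iff ev3.ev_diff ev3.ev_mult ev3_subst \<phi>(2) cm_def ..
    qed
    have m: "cm (ev3.ev u) (\<phi> a) \<in> range S" using norm_opD[OF u \<phi>_closed[OF a]] .
    show ?thesis
    proof (rule the_equality)
      show "\<psi> (cm (ev3.ev u) (\<phi> a)) \<in> carr A \<and> embed h (\<psi> (cm (ev3.ev u) (\<phi> a)))
          = cls3 u \<star>\<^bsub>?L\<^esub> embed h a \<ominus>\<^bsub>?L\<^esub> embed h a \<star>\<^bsub>?L\<^esub> cls3 u"
        using iff[OF \<psi>_closed[OF m]] \<psi>_closed[OF m] \<phi>_\<psi>[OF m] by simp
      show "b = \<psi> (cm (ev3.ev u) (\<phi> a))"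
        if "b \<in> carr A \<and> embed h b = cls3 u \<star>\<^bsub>?L\<^esub> embed h a \<ominus>\<^bsub>?L\<^esub> embed h a \<star>\<^bsub>?L\<^esub> cls3 u" for b
        using that iff[of b] \<psi>_\<phi>[of b] by simp
    qed
  qed
  then show ?thesis unfolding ad_def \<delta>_def by (intro restrict_ext) simp
qed

text \<open>Carries the family that spans the nilpotent ideal over to the polynomial model.\<close>

lemma to_HH1_ad_ra: "to_HH1 h (ad_ra h r n) = HQ.M (monom r n)"
proof -
  have "ev3.ev (a_elem h n) = a_op n"
    by (cases n) (simp_all add: a_elem_def a_op_def ev3.ev_mult ev3.ev_gen ev3_poly_at ev3.ev_power ph_def[symmetric])
  then have ev: "ev3.ev (poly_at r lx * a_elem h n) = j r * a_op n" by (simp add: ev3.ev_mult ev3_poly_at)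
  obtain k where k: "j r * a_op n = W 0 (monom r n) + S k" using a_op_eq by blast
  have "norm_op (j r * a_op n)" unfolding k by (intro norm_add norm_W norm_S) simp
  then have "ad_ra h r n = \<delta> (W 0 (monom r n) + S k)"
    unfolding ad_ra_def using ad_eq_\<delta>[of "poly_at r lx * a_elem h n"] by (simp add: ev k)
  then show ?thesis by (simp add: to_HH1_add_S norm_W HQ.M_def \<Psi>_def)
qed

lemma center_iso:
  "alg_iso (to_HH1 h)
    (restr (Der A) {D_der h (r * \<kappa>) | r. r = 0 \<or> degree r < degree ph}) (restr (HH1 A) (center (HH1 A)))"
proof -
  let ?R = "{r. r = 0 \<or> degree r < degree ph}"
  have D: "D_der h (r * \<kappa>) = \<delta> (W r 0)" for r
    by (simp add: D_der_eq W_def mult.commute)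
  have set: "{D_der h (r * \<kappa>) | r. r = 0 \<or> degree r < degree ph} = (\<lambda>r. \<delta> (W r 0)) ` ?R"
    unfolding D by blast
  have sub: "d \<in> carr (Der A)" if "d \<in> (\<lambda>r. \<delta> (W r 0)) ` ?R" for d
    using that \<delta>_Der norm_W by blast
  have eq: "to_HH1 h (\<delta> (W r 0)) = \<Psi> (r, 0)" for r by (simp add: \<Psi>_def)
  show ?thesis
    unfolding alg_iso_def set restr_simps
  proof (intro conjI ballI allI bij_betw_imageI)
    show "inj_on (to_HH1 h) ((\<lambda>r. \<delta> (W r 0)) ` ?R)"
    proof (rule inj_onI)
      fix x y assume "x \<in> (\<lambda>r. \<delta> (W r 0)) ` ?R" "y \<in> (\<lambda>r. \<delta> (W r 0)) ` ?R"
        and xy: "to_HH1 h x = to_HH1 h y"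
      then obtain r s where rs: "x = \<delta> (W r 0)" "y = \<delta> (W s 0)" "r \<in> ?R" "s \<in> ?R" by blast
      then have "ph dvd r - s" using xy by (simp add: eq HQ.\<Psi>_eq_iff)
      have "r = s"
      proof (rule ccontr)
        assume "r \<noteq> s"
        then have "degree ph \<le> degree (r - s)" using \<open>ph dvd r - s\<close> by (intro dvd_imp_degree_le) simp_all
        moreover have "degree (r - s) < degree ph"
        proof -
          \<comment> \<open>\<open>degree 0\<close> is 0, so the strict degree bounds for both
            \<open>r\<close> and \<open>s\<close> follow only once \<open>degree ph\<close> is known
            to be positive.\<close>
          have "r \<noteq> 0 \<or> s \<noteq> 0" using \<open>r \<noteq> s\<close> by auto
          then have "0 < degree ph" using rs(3,4) by auto
          then have "degree r < degree ph" "degree s < degree ph" using rs(3,4) by auto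
          then show ?thesis by (rule degree_diff_less)
        qed
        ultimately show False by simp
      qed
      then show "x = y" using rs by simp
    qed
    show "to_HH1 h ` (\<lambda>r. \<delta> (W r 0)) ` ?R = center (HH1 A)"
    proof
      show "to_HH1 h ` (\<lambda>r. \<delta> (W r 0)) ` ?R \<subseteq> center (HH1 A)" by (auto simp: HQ.center_H eq)
      show "center (HH1 A) \<subseteq> to_HH1 h ` (\<lambda>r. \<delta> (W r 0)) ` ?R"
      proof
        fix z assume "z \<in> center (HH1 A)"
        then obtain s where s: "z = \<Psi> (s, 0)" by (auto simp: HQ.center_H)
        have "s mod ph \<in> ?R" using degree_mod_less[OF ph_nonzero, of s] by simp
        moreover have "z = \<Psi> (s mod ph, 0)"
          unfolding s HQ.\<Psi>_eq_iff by (simp add: minus_mod_eq_mult_div)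
        ultimately show "z \<in> to_HH1 h ` (\<lambda>r. \<delta> (W r 0)) ` ?R" by (auto simp: eq image_image)
      qed
    qed
    show "to_HH1 h (d \<oplus>\<^bsub>Der A\<^esub> d') = to_HH1 h d \<oplus>\<^bsub>HH1 A\<^esub> to_HH1 h d'"
      "to_HH1 h (d \<star>\<^bsub>Der A\<^esub> d') = to_HH1 h d \<star>\<^bsub>HH1 A\<^esub> to_HH1 h d'"
      if "d \<in> (\<lambda>r. \<delta> (W r 0)) ` ?R" "d' \<in> (\<lambda>r. \<delta> (W r 0)) ` ?R" for d d'
      using alg_homD(3,4)[OF HH1_hom] sub that by auto
    show "to_HH1 h (c \<odot>\<^bsub>Der A\<^esub> d) = c \<odot>\<^bsub>HH1 A\<^esub> to_HH1 h d"
      if "d \<in> (\<lambda>r. \<delta> (W r 0)) ` ?R" for d c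
      using alg_homD(5)[OF HH1_hom] sub that by auto
  qed
qed

end

theorem theorem5p1:
  fixes h :: "'f::field_char_0 poly"
  assumes "h \<noteq> 0"
  defines "H \<equiv> HH1 (Ah h)"
  defines "Z \<equiv> center H"
  defines "L \<equiv> restr H (derived H)"
  defines "q \<equiv> pi_poly (h div pi_poly h)"
  defines "N \<equiv> lspan H {to_HH1 h (ad_ra h r n) | r n. r \<in> range (\<lambda>s. s * q)}"
  defines "U \<equiv> {u. lead_coeff u = 1 \<and> prime_elem u \<and> u\<^sup>2 dvd h}"
  shows "is_direct_sum H Z (derived H)
    \<and> (maximal_nilpotent_ideal L N \<and> (\<forall>I. maximal_nilpotent_ideal L I \<longrightarrow> I = N))
    \<and> (ideal H N \<and> inj_on (coset H N) Z
        \<and> is_direct_sum (quot H N) (coset H N ` Z) (carr (quot L N)))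
    \<and> \<comment> \<open>(i)\<close> alg_iso (to_HH1 h)
        (restr (Der (Ah h))
          {D_der h (r * (h div pi_poly h)) | r. r = 0 \<or> degree r < degree (pi_poly h)})
        (restr H Z)
    \<and> \<comment> \<open>(ii)\<close> isomorphic (quot L N) (tensor (R_mod q) Witt)
    \<and> carr (Witt :: ('f, _) alg) = lspan Witt (witt_w ` {-1..})
    \<and> \<comment> \<open>(iii)\<close> finite U
    \<and> isomorphic (tensor (R_mod q) Witt) (direct_sum U (\<lambda>u. tensor (R_mod u) Witt))
    \<and> (\<forall>u\<in>U. simple_lie_algebra (tensor (R_mod u) Witt) \<and> field_algebra (R_mod u))"
proof -
  \<comment> \<open>A field of characteristic 0 is infinite, so \<open>h\<close> has a non-root to
    expand at.\<close>
  have "finite {x. poly h x = 0}" using assms(1) by (rule poly_roots_finite)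
  then obtain c0 where c0: "poly h c0 \<noteq> 0"
    using infinite_UNIV_char_0[where 'a = 'f] by (metis (mono_tags) UNIV_eq_I mem_Collect_eq)
  interpret w: weyl h c0 by unfold_locales (rule assms(1), rule c0)
  have q: "q = w.q" by (simp add: q_def w.q_def w.\<kappa>_def w.ph_def)
  have N: "N = w.HQ.N" unfolding N_def H_def w.to_HH1_ad_ra q w.HQ.lspan_N ..
  have L: "L = w.HQ.L" by (simp add: L_def H_def w.HQ.L_def)
  \<comment> \<open>The multiple prime factors of \<open>h\<close> are the prime factors of the
    squarefree \<open>q\<close>, so divisibility by \<open>q\<close> is divisibility by all of
    them.\<close>
  have U: "U = {u. lead_coeff u = 1 \<and> prime_elem u \<and> u dvd w.q}"
    using w.prime_square_dvd_h_iff by (auto simp: U_def)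
  have fin: "finite U" unfolding U by (rule finite_monic_primes[OF w.q_nonzero])
  have dvd: "q dvd r \<longleftrightarrow> (\<forall>u\<in>U. u dvd r)" for r
    using squarefree_dvd_iff_monic_primes[OF w.q_nonzero w.q_prime_square, of r] by (auto simp: U q)
  have "is_direct_sum H Z (derived H)" unfolding H_def Z_def by (rule w.HQ.direct_sum_H)
  moreover have "maximal_nilpotent_ideal L N \<and> (\<forall>I. maximal_nilpotent_ideal L I \<longrightarrow> I = N)"
    unfolding L N by (rule w.HQ.maximal_N)
  moreover have "ideal H N" unfolding H_def N by (rule w.HQ.ideal_N)
  moreover have "inj_on (coset H N) Z" unfolding H_def Z_def N by (rule w.HQ.inj_coset_center)
  moreover have "is_direct_sum (quot H N) (coset H N ` Z) (carr (quot L N))"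
    unfolding L N Z_def unfolding H_def by (rule w.HQ.direct_sum_quot)
  moreover have "alg_iso (to_HH1 h)
        (restr (Der (Ah h))
          {D_der h (r * (h div pi_poly h)) | r. r = 0 \<or> degree r < degree (pi_poly h)})
        (restr H Z)"
    using w.center_iso unfolding H_def Z_def w.\<kappa>_def w.ph_def .
  moreover have "isomorphic (quot L N) (tensor (R_mod q) Witt)"
    unfolding L N q by (rule w.HQ.quot_L_N_iso)
  moreover have "isomorphic (tensor (R_mod q) Witt) (direct_sum U (\<lambda>u. tensor (R_mod u) Witt))"
    by (rule tensor_Witt_direct_sum[OF fin _ dvd]) (simp add: U)
  moreover have "\<forall>u\<in>U. simple_lie_algebra (tensor (R_mod u) Witt) \<and> field_algebra (R_mod u)"
    using tensor_Witt_simple R_mod_field_algebra by (auto simp: U)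
  ultimately show ?thesis using carr_Witt_lspan fin by blast
qed

end
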